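(* There exists a function $f$, univalent in $\mathbb D$, of the form $$f(z)=\sum_{n=1}^\infty\frac{c_n}{1-\overline{a}_n z},$$ where $(a_n)_{n\ge1}$ is an infinite Blaschke sequence in $\mathbb D$ satisfying the Carleson condition and $(c_n)_{n\ge1}$ is a sequence of complex coefficients, such that $G=f(\mathbb D)$ is a Nevanlinna domain with $m_2(\partial G)>0$ and $\dim_M(\partial_aG)=2$.
   Context: $\mathbb D=\{z\in\mathbb C:|z|<1\}$, $\mathbb T=\partial\mathbb D$. A Blaschke sequence is a sequence $(a_n)$ in $\mathbb D$ with $\sum_n(1-|a_n|)<\infty$; the Carleson condition is $\inf_{n}\prod_{k\ne n}\left|\frac{a_n-a_k}{1-a_n\overline a_k}\right|>0$. The series defining $f$ is understood to converge locally uniformly in $\mathbb D$. For an open set $U$, $H^\infty(U)$ is the set of bounded holomorphic functions on $U$. A bounded simply connected domain $G\subset\mathbb C$ is called a Nevanlinna domain if there exist $u,v\in H^\infty(G)$ with $v\not\equiv 0$ such that for a conformal mapping $g$ of $\mathbb D$ onto $G$ the equality of angular boundary values $\overline{g(\zeta)}=\dfrac{(u\circ g)(\zeta)}{(v\circ g)(\zeta)}$ holds for almost all $\zeta\in\mathbb T$ with respect to Lebesgue measure (this does not depend on the choice of $g$). For a bounded simply connected domain $G$, $\partial_aG\subset\partial G$ is the set of all points of $\partial G$ accessible from $G$ by some curve; equivalently, $\partial_aG$ is the set of all angular boundary values $g(\zeta)$, taken over all $\zeta\in\mathbb T$ at which the angular boundary value exists, of a conformal map $g:\mathbb D\to G$.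 $m_2$ is planar Lebesgue measure. $\dim_M$ is the Minkowski (box-counting) dimension: for a bounded non-empty set $E\subset\mathbb C$, $\dim_M(E)=\lim_{N\to\infty}\frac{\log_2 M_E(N)}{N}$, where $M_E(N)$ is the minimal number of squares of side length $2^{-N}$ required to cover $E$. *)

theory Defs
  imports "HOL-Complex_Analysis.Complex_Analysis"
begin

definition blaschke_sequence :: "(nat \<Rightarrow> complex) \<Rightarrow> bool" where
  "blaschke_sequence a \<longleftrightarrow> (\<forall>n. cmod (a n) < 1) \<and> summable (\<lambda>n. 1 - cmod (a n))"

text \<open>
  The product over all \<open>k \<noteq> n\<close> is written as a product over all \<open>k\<close> whose \<open>n\<close>-th factor is 1.
  For a Blaschke sequence it always converges in the sense of \<^const>\<open>convergent_prod\<close>: every point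
  is repeated only finitely often, so at most finitely many factors vanish, and the deviations of
  the factors from 1 are summable.
\<close>
definition carleson_condition :: "(nat \<Rightarrow> complex) \<Rightarrow> bool" where
  "carleson_condition a \<longleftrightarrow>
     (INF n. \<Prod>k. if k = n then 1 else cmod ((a n - a k) / (1 - a n * cnj (a k)))) > 0"

definition sums_locally_uniformly_on ::
    "(nat \<Rightarrow> complex \<Rightarrow> complex) \<Rightarrow> (complex \<Rightarrow> complex) \<Rightarrow> complex set \<Rightarrow> bool" where
  "sums_locally_uniformly_on h f U \<longleftrightarrow>
     (\<forall>K. compact K \<and> K \<subseteq> U \<longrightarrow>
        uniform_limit K (\<lambda>N z. \<Sum>n<N. h n z) f sequentially)"

definition univalent_on :: "(complex \<Rightarrow> complex) \<Rightarrow> complex set \<Rightarrow> bool" where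
  "univalent_on f U \<longleftrightarrow> f holomorphic_on U \<and> inj_on f U"

definition conformal_map :: "(complex \<Rightarrow> complex) \<Rightarrow> complex set \<Rightarrow> complex set \<Rightarrow> bool" where
  "conformal_map g U V \<longleftrightarrow> univalent_on g U \<and> g ` U = V"

definition H_infinity :: "complex set \<Rightarrow> (complex \<Rightarrow> complex) set" where
  "H_infinity U = {h. h holomorphic_on U \<and> bounded (h ` U)}"

definition stolz_region :: "complex \<Rightarrow> real \<Rightarrow> complex set" where
  "stolz_region \<zeta> M = {z \<in> ball 0 1. cmod (z - \<zeta>) < M * (1 - cmod z)}"

text \<open>For \<open>M > 1\<close> and \<open>|\<zeta>| = 1\<close> the Stolz region contains the radius ending at \<open>\<zeta>\<close>,
  so the filters below are proper and the limit is unique.\<close>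
definition has_angular_limit :: "(complex \<Rightarrow> complex) \<Rightarrow> complex \<Rightarrow> complex \<Rightarrow> bool" where
  "has_angular_limit h \<zeta> L \<longleftrightarrow> (\<forall>M>1. (h \<longlongrightarrow> L) (at \<zeta> within stolz_region \<zeta> M))"

text \<open>
  Almost every point of the unit circle is expressed through the parametrisation
  \<open>t \<mapsto> cis t\<close> by arc length on \<open>[0, 2\<pi>)\<close>. The requirement \<open>V \<noteq> 0\<close> excludes the
  convention \<open>x / 0 = 0\<close>.
\<close>
definition nevanlinna_domain :: "complex set \<Rightarrow> bool" where
  "nevanlinna_domain G \<longleftrightarrow>
     open G \<and> G \<noteq> {} \<and> simply_connected G \<and> bounded G \<and>
     (\<exists>u\<in>H_infinity G. \<exists>v\<in>H_infinity G. (\<exists>w\<in>G. v w \<noteq> 0) \<and>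
        (\<exists>g. conformal_map g (ball 0 1) G \<and>
           (AE t in lebesgue_on {0..<2 * pi}. \<exists>L U V.
              has_angular_limit g (cis t) L \<and>
              has_angular_limit (u \<circ> g) (cis t) U \<and>
              has_angular_limit (v \<circ> g) (cis t) V \<and>
              V \<noteq> 0 \<and> cnj L = U / V)))"

definition accessible_boundary :: "complex set \<Rightarrow> complex set" where
  "accessible_boundary G =
     {w \<in> frontier G. \<exists>\<gamma>. path \<gamma> \<and> \<gamma> ` {0..<1} \<subseteq> G \<and> pathfinish \<gamma> = w}"

text \<open>Closed squares of side length \<open>s\<close>, in arbitrary position and orientation.\<close>
definition squares :: "real \<Rightarrow> complex set set" where
  "squares s = {(\<lambda>z. p + \<omega> * z) ` cbox 0 (Complex s s) | p \<omega>. cmod \<omega> = 1}"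

text \<open>For bounded \<open>E\<close> such a finite cover exists, so the minimum is attained.\<close>
definition square_covering_number :: "complex set \<Rightarrow> nat \<Rightarrow> nat" where
  "square_covering_number E N =
     (LEAST m. \<exists>Q. finite Q \<and> card Q = m \<and> Q \<subseteq> squares (1 / 2 ^ N) \<and> E \<subseteq> \<Union>Q)"

definition has_minkowski_dim :: "complex set \<Rightarrow> real \<Rightarrow> bool" where
  "has_minkowski_dim E d \<longleftrightarrow> bounded E \<and> E \<noteq> {} \<and>
     (\<lambda>N. log 2 (real (square_covering_number E N)) / real N) \<longlonglongrightarrow> d"

end

theory Submission
  imports Defs
begin

text \<open>
  Adding to a univalent map \<open>R\<close> a single term \<open>b s / (s + 1 - cnj \<xi> z)\<close> with \<open>|\<xi>| = 1\<close> and tiny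
  \<open>s > 0\<close> attaches to \<open>R(\<D>)\<close>, at the boundary point \<open>R(\<xi>)\<close>, approximately the disc with diameter
  \<open>[R(\<xi>), R(\<xi>) + b]\<close>. If \<open>R(\<xi>)\<close> is the point of \<open>R(closed disc)\<close> nearest to some target \<open>w\<close>, and
  \<open>b\<close> points from \<open>R(\<xi>)\<close> towards \<open>w\<close>, then this disc touches \<open>R(closed disc)\<close> from outside and the
  sum stays univalent for small \<open>s\<close>. Iterating with discs of diameter at most \<open>1 / (n + 1)\<close>, whose
  total area is finite while their total length is infinite, and with targets running through a
  dense subset of the disc of radius 10, each recurring infinitely often, gives a limit \<open>f\<close> whose
  image is dense in that disc but has smaller area. So the frontier has positive area; the
  accessible points are dense in it, and closed squares covering them cover the whole frontier,
  hence their Minkowski dimension is 2. Since the \<open>s\<close> may shrink as fast as we like, the poles form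
  a Carleson sequence, and at almost every point of the circle the series, the associated
  Blaschke products, and their products with the reflected series converge uniformly on Stolz
  regions, which gives the Nevanlinna property.
\<close>

section \<open>Attaching a tangent disc preserves univalence\<close>

text \<open>The attached disc touches the old image, so there is no slack to first order and the
  second-order contact must decide. Taking the nearest point gives more than tangency: a disc of
  twice the diameter is free of old values, which leaves a definite margin in the curvature
  condition. To make this iterable, injectivity is carried as nonvanishing of the divided difference
  on the closed bidisc; compactness then bounds it below at every stage. The Nevanlinna property has
  an algebraic source: on the unit circle the conjugate of c / (1 - cnj a z) is rational in z with
  its pole at a, inside the disc, and a Blaschke factor vanishing at a cancels that pole without
  changing moduli on the circle. The radius 10 is dictated by area: the attached discs, enlarged to
  absorb all errors, cover at most 36 pi, while the targets are dense in a disc of area 100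
  pi.\<close>

lemma cball11_iff: "t \<in> cball (1::complex) 1 \<longleftrightarrow> (cmod t)\<^sup>2 \<le> 2 * Re t"
proof -
  have "t \<in> cball (1::complex) 1 \<longleftrightarrow> (cmod (1 - t))\<^sup>2 \<le> 1\<^sup>2"
    using power_mono_iff[of "cmod (1 - t)" 1 2] by (simp add: dist_norm)
  also have "(cmod (1 - t))\<^sup>2 = 1 - 2 * Re t + (cmod t)\<^sup>2"
    unfolding cmod_power2 by (simp add: power2_eq_square algebra_simps)
  finally show ?thesis by simp
qed

text \<open>
  The coordinate \<open>t = 1 - cnj \<xi> z\<close> maps the closed unit disc to \<open>cball 1 1\<close> and \<open>\<xi>\<close> to 0. Two points
  close to \<open>\<xi>\<close> can only collide in the neck between the old domain and the attached disc, where
  \<open>t\<close> and \<open>u\<close> are of size \<open>sqrt s\<close> and nearly imaginary. There \<open>Re t \<ge> |t|\<^sup>2 / 2\<close> competes with the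
  second Taylor coefficient of \<open>R\<close>, so the curvature of the boundary at \<open>R(\<xi>)\<close> decides.
\<close>
lemma neck_estimate:
  fixes t u \<nu> \<mu> :: complex and s lam A B :: real
  assumes s: "s > 0" and lam: "lam > 0"
    and t: "t \<in> cball 1 1" and u: "u \<in> cball 1 1"
    and eq: "(s + t) * (s + u) = - (of_real (s / lam) * (1 + \<nu>))"
    and nu1: "cmod \<nu> \<le> 1/4" and nu2: "cmod \<nu> \<le> A * (cmod t + cmod u)"
    and nu3: "cmod (\<nu> - \<mu> * (t + u)) \<le> B * (cmod t + cmod u)\<^sup>2" and B: "B \<ge> 0"
  shows "lam + 1/2 + Re \<mu> \<le> (A + 2 * A * cmod \<mu> + 2 * B) * (cmod t + cmod u)"
proof -
  define X X' Y Y' q l where "X = s + Re t" "X' = s + Re u" "Y = Im t" "Y' = Im u" "q = s / lam"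
    "l = cmod t + cmod u"
  note defs = this
  have q: "q > 0" and sq: "s = lam * q" using s lam by (auto simp: defs)
  have Ret: "(cmod t)\<^sup>2 \<le> 2 * Re t" "(cmod u)\<^sup>2 \<le> 2 * Re u" using t u unfolding cball11_iff by auto
  have Yt: "Y\<^sup>2 \<le> (cmod t)\<^sup>2" "Y'\<^sup>2 \<le> (cmod u)\<^sup>2" by (auto simp: defs cmod_power2)
  have Ret0: "Re t \<ge> 0" "Re u \<ge> 0" using Ret by (smt (verit) zero_le_power2)+
  have XY: "X \<ge> s + Y\<^sup>2 / 2" "X' \<ge> s + Y'\<^sup>2/2" using Ret Yt by (auto simp: defs)
  have X0: "X > 0" "X' > 0" using Ret0 s by (auto simp: defs)
  have re: "X * X' - Y * Y' = - (q * (1 + Re \<nu>))" using arg_cong[OF eq, of Re] by (simp add: defs)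
  have im: "X * Y' + X' * Y = - (q * Im \<nu>)" using arg_cong[OF eq, of Im] by (simp add: defs algebra_simps)
  have renu: "\<bar>Re \<nu>\<bar> \<le> cmod \<nu>" "\<bar>Im \<nu>\<bar> \<le> cmod \<nu>" by (auto simp: abs_Re_le_cmod abs_Im_le_cmod)
  have "q * (1 - cmod \<nu>) \<le> q * (1 + Re \<nu>)" using renu q by (intro mult_left_mono) auto
  moreover have "X * X' > 0" using X0 by simp
  ultimately have YY1: "Y * Y' \<ge> q * (1 - cmod \<nu>)" using re by linarith
  moreover have "q * (1 - cmod \<nu>) \<ge> q * (3/4)" using nu1 q by (intro mult_left_mono) auto
  ultimately have YY2: "Y * Y' \<ge> q * (3/4)" by linarith
  moreover have "q * (3/4) > 0" using q by simp
  ultimately have YYp: "Y * Y' > 0" by linarith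
  \<comment> \<open>The real part of the equation forces \<open>Y * Y' > 0\<close>, so both
    imaginary parts have a common sign \<open>sg\<close>, and it suffices to work with
    \<open>y, y' > 0\<close>.\<close>
  obtain sg :: real where sg: "sg = 1 \<or> sg = -1" "\<bar>Y\<bar> = sg * Y" "\<bar>Y'\<bar> = sg * Y'"
  proof (cases "Y > 0")
    case True
    with YYp have "Y' > 0" by (simp add: zero_less_mult_iff)
    with True show ?thesis by (intro that[of 1]) simp_all
  next
    case False
    with YYp have "Y < 0 \<and> Y' < 0" by (simp add: zero_less_mult_iff)
    thus ?thesis by (intro that[of "-1"]) simp_all
  qed
  define y y' where "y = \<bar>Y\<bar>" "y' = \<bar>Y'\<bar>"
  note ydefs = this
  have yy: "Y * Y' = y * y'" "Y\<^sup>2 = y\<^sup>2" "Y'\<^sup>2 = y'\<^sup>2" using YYp by (auto simp: ydefs abs_mult[symmetric])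
  have yp: "y > 0" "y' > 0" using YYp by (auto simp: ydefs)
  have im': "X * y' + X' * y = - (q * (sg * Im \<nu>))"
    using arg_cong[OF im, of "\<lambda>x. sg * x"] sg by (simp add: ydefs algebra_simps)
  have sgim: "- (sg * Im \<nu>) \<le> cmod \<nu>" using sg(1) renu by auto
  \<comment> \<open>The imaginary part of the equation shows that \<open>X\<close> and
    \<open>X'\<close> are smaller than \<open>y\<close> and \<open>y'\<close> by a factor of order
    \<open>\<nu>\<close>: both points are nearly imaginary.\<close>
  have "X * y' + X' * y \<le> q * cmod \<nu>" using im' mult_left_mono[OF sgim, of q] q by simp
  also have "\<dots> \<le> (4/3 * (y * y')) * cmod \<nu>" using YY2 yy by (intro mult_right_mono) auto
  finally have key: "X * y' + X' * y \<le> 4/3 * cmod \<nu> * y * y'" by (simp add: algebra_simps)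
  have "X * y' \<le> (4/3 * cmod \<nu> * y) * y'" using key X0 yp by (smt (verit) mult_pos_pos)
  hence Xs: "X \<le> 4/3 * cmod \<nu> * y" using yp by (simp only: mult_le_cancel_right)
  have "X' * y \<le> (4/3 * cmod \<nu> * y') * y" using key X0 yp
    by (smt (verit) mult_pos_pos mult.commute mult.assoc)
  hence Xs': "X' \<le> 4/3 * cmod \<nu> * y'" using yp by (simp only: mult_le_cancel_right)
  have half: "4/3 * cmod \<nu> * y \<le> 1 * y" "4/3 * cmod \<nu> * y' \<le> 1 * y'"
    using nu1 yp by (intro mult_right_mono; simp)+
  have tl: "cmod t \<le> 2 * y" "cmod u \<le> 2 * y'"
    using cmod_le[of t] cmod_le[of u] Ret0 Xs Xs' half s by (auto simp: ydefs defs)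
  define L where "L = y + y'"
  have L: "L > 0" using yp by (simp add: L_def)
  have lL: "l \<le> 2 * L" "l \<ge> 0" using tl by (auto simp: defs L_def)
  have nul: "cmod \<nu> \<le> A * l" using nu2 by (simp add: defs)
  have XX: "X + X' \<le> 4/3 * cmod \<nu> * L" using Xs Xs' by (simp add: L_def algebra_simps)
  \<comment> \<open>The same expression is now bounded from below by the curvature of the circle
    (\<open>XY\<close>). Dividing by \<open>q\<close> removes \<open>s\<close> and leaves an
    inequality that is linear in \<open>L\<close>.\<close>
  have "(s + y\<^sup>2/2) * y' + (s + y'\<^sup>2/2) * y \<le> X * y' + X' * y"
    using XY yp yy by (intro add_mono mult_right_mono) auto
  hence "s * L + (y * y') * L / 2 \<le> - (q * (sg * Im \<nu>))"
    unfolding im' L_def by (simp add: algebra_simps power2_eq_square add_divide_distrib)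
  moreover have "(q * (1 - cmod \<nu>)) * L / 2 \<le> (y * y') * L / 2" using YY1 yy L by simp
  ultimately have "q * (lam * L + (1 - cmod \<nu>) * L / 2) \<le> q * (- (sg * Im \<nu>))"
    unfolding sq by (simp add: algebra_simps diff_divide_distrib)
  hence main: "lam * L + (1 - cmod \<nu>) * L / 2 \<le> - (sg * Im \<nu>)"
    using mult_le_cancel_left_pos[OF q] by blast
  have "- (sg * Im \<nu>) = - (sg * Im (\<nu> - \<mu> * (t + u))) - sg * Im (\<mu> * (t + u))"
    by (simp add: algebra_simps)
  also have "sg * Im (\<mu> * (t + u)) = Re \<mu> * L + sg * Im \<mu> * (Re t + Re u)"
    using sg by (simp add: L_def ydefs defs algebra_simps)
  also have "- (sg * Im (\<nu> - \<mu> * (t + u))) \<le> cmod (\<nu> - \<mu> * (t + u))"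
    using sg(1) abs_Im_le_cmod[of "\<nu> - \<mu> * (t + u)"] by auto
  also have "\<dots> \<le> B * l\<^sup>2" using nu3 by (simp add: defs)
  also have "B * l\<^sup>2 \<le> B * (2 * L * l)" using lL B
    by (intro mult_left_mono) (auto simp: power2_eq_square mult_right_mono)
  finally have m2: "- (sg * Im \<nu>) \<le> B * (2 * L * l) - (Re \<mu> * L + sg * Im \<mu> * (Re t + Re u))"
    by linarith
  have "- (sg * Im \<mu> * (Re t + Re u)) \<le> cmod \<mu> * (Re t + Re u)"
    using sg(1) abs_Im_le_cmod[of \<mu>] Ret0
    by (metis (no_types, opaque_lifting) add_nonneg_nonneg abs_le_D1 abs_le_D2 minus_mult_left mult_1 mult_minus_left mult_right_mono minus_minus)
  also have "\<dots> \<le> cmod \<mu> * (X + X')" using s by (intro mult_left_mono) (auto simp: defs)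
  also have "\<dots> \<le> cmod \<mu> * (4/3 * cmod \<nu> * L)" using XX by (intro mult_left_mono) auto
  finally have m3: "- (sg * Im \<mu> * (Re t + Re u)) \<le> cmod \<mu> * (4/3 * cmod \<nu> * L)" .
  have "L * (lam + 1/2 + Re \<mu>) \<le> L * (cmod \<nu> / 2 + 2 * B * l + cmod \<mu> * 4/3 * cmod \<nu>)"
    using main m2 m3 by (simp add: algebra_simps diff_divide_distrib)
  hence "lam + 1/2 + Re \<mu> \<le> cmod \<nu> / 2 + 2 * B * l + cmod \<mu> * 4/3 * cmod \<nu>" using L by simp
  also have "\<dots> \<le> (A * l) + 2 * B * l + 2 * cmod \<mu> * (A * l)"
  proof -
    have "cmod \<mu> * 4/3 * cmod \<nu> \<le> 2 * cmod \<mu> * cmod \<nu>" by simp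
    also have "\<dots> \<le> 2 * cmod \<mu> * (A * l)" using nul by (intro mult_left_mono) auto
    finally show ?thesis using nul by (smt (verit) norm_ge_zero field_sum_of_halves)
  qed
  finally show ?thesis by (simp add: defs algebra_simps)
qed

text \<open>If \<open>- M\<close> is the divided difference of \<open>P\<close>, the excluded
  equation says that the divided difference of \<open>P t + s / (s + t)\<close> vanishes. Writing
  \<open>lam / M = 1 + \<nu>\<close> brings it into the form of \<open>neck_estimate\<close>, whose
  error is linear in \<open>cmod t + cmod u\<close>; hence one radius \<open>r\<close> serves all
  \<open>s\<close>. That estimate is contradicted near 0 once
  \<open>2 * lam\<^sup>2 + lam + 2 * Re kap > 0\<close>; the curvature hypothesis leaves the margin
  \<open>lam\<^sup>2\<close>.\<close>

lemma near_nonvanishing: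
  fixes M :: "complex \<Rightarrow> complex \<Rightarrow> complex" and lam C :: real and kap :: complex
  assumes lam: "lam > 0" and curv: "lam\<^sup>2 + lam + 2 * Re kap \<ge> 0"
    and tay: "\<And>t u. t \<in> cball 1 1 \<Longrightarrow> u \<in> cball 1 1 \<Longrightarrow>
        cmod (M t u - (lam - kap * (t + u))) \<le> C * (cmod t + cmod u)\<^sup>2"
  shows "\<exists>r>0. \<forall>s>0. \<forall>t\<in>cball 1 1. \<forall>u\<in>cball 1 1. cmod t \<le> r \<longrightarrow> cmod u \<le> r \<longrightarrow>
           (of_real s + t) * (of_real s + u) * M t u \<noteq> - of_real s"
proof -
  have "0 \<le> C * (cmod 1 + cmod 1)\<^sup>2" using tay[of 1 1] by (smt (verit) centre_in_cball norm_ge_zero)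
  hence C: "C \<ge> 0" by (simp add: zero_le_mult_iff)
  define k where "k = cmod kap"
  define A where "A = 2 / lam * (k + C)"
  define B where "B = 2 / lam * (C + k * (k + C) / lam)"
  define \<mu> where "\<mu> = kap / lam"
  have k: "k \<ge> 0" by (simp add: k_def)
  have A: "A \<ge> 0" and B: "B \<ge> 0" using lam C k by (auto simp: A_def B_def)
  define D where "D = A + 2 * A * cmod \<mu> + 2 * B"
  have D: "D \<ge> 0" using A B by (simp add: D_def)
  \<comment> \<open>The three bounds give \<open>l \<le> 1\<close>,
    \<open>cmod \<nu> \<le> 1/4\<close> and a neck error of at most \<open>lam / 4\<close>, to be
    set against the lower bound \<open>lam / 2\<close> from the curvature.\<close>
  define r where "r = min (1/2) (min (1 / (8 * (A + 1))) (lam / (8 * (D + 1))))"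
  have r0: "r > 0" using A D lam by (simp add: r_def)
  have r1: "2 * r \<le> 1" by (simp add: r_def)
  have "r * (8 * (A + 1)) \<le> 1" using A by (simp add: pos_le_divide_eq[symmetric]) (simp add: r_def)
  hence r2: "A * (2 * r) \<le> 1/4" using r0 by (simp add: algebra_simps)
  have "r * (8 * (D + 1)) \<le> lam" using D by (simp add: pos_le_divide_eq[symmetric]) (simp add: r_def)
  hence r3: "D * (2 * r) \<le> lam / 4" using r0 by (simp add: algebra_simps)
  have "(of_real s + t) * (of_real s + u) * M t u \<noteq> - of_real s"
    if s: "s > 0" and t: "t \<in> cball 1 1" and u: "u \<in> cball 1 1" and tr: "cmod t \<le> r" "cmod u \<le> r" for s t u
  proof
    assume eq: "(of_real s + t) * (of_real s + u) * M t u = - of_real s"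
    define l where "l = cmod t + cmod u"
    have l: "0 \<le> l" "l \<le> 2 * r" "l \<le> 1" using tr r1 by (auto simp: l_def)
    have T: "cmod (M t u - (lam - kap * (t + u))) \<le> C * l\<^sup>2" using tay[OF t u] by (simp add: l_def)
    have ll: "l\<^sup>2 \<le> l" using l by (simp add: power2_eq_square mult_left_le)
    have kt: "cmod (kap * (t + u)) \<le> k * l" unfolding norm_mult k_def l_def
      by (intro mult_left_mono norm_triangle_ineq) auto
    have "cmod (M t u - lam) = cmod ((M t u - (lam - kap * (t + u))) - kap * (t+u))" by (simp add: algebra_simps)
    also have "\<dots> \<le> C * l\<^sup>2 + k * l" using T kt norm_triangle_ineq4 by (meson add_mono order_trans)
    also have "\<dots> \<le> (k + C) * l" using ll C mult_left_mono[OF ll C] by (simp add: algebra_simps)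
    finally have Ml: "cmod (M t u - lam) \<le> (k + C) * l" .
    have "(k + C) * l = lam / 2 * (A * l)" using lam by (simp add: A_def)
    also have "A * l \<le> A * (2 * r)" using l A by (intro mult_left_mono) auto
    hence "lam / 2 * (A * l) \<le> lam / 2 * (1/4)" using r2 lam by (intro mult_left_mono) auto
    finally have "cmod (M t u - lam) \<le> lam / 2" using Ml lam by linarith
    moreover have "lam = cmod (M t u - (M t u - lam))" using lam by simp
    moreover have "\<dots> \<le> cmod (M t u) + cmod (M t u - lam)" by (rule norm_triangle_ineq4)
    ultimately have Mb: "cmod (M t u) \<ge> lam / 2" by linarith
    hence M0: "M t u \<noteq> 0" using lam by auto
    define \<nu> where "\<nu> = (lam - M t u) / M t u"
    have nuM: "cmod (x / M t u) \<le> 2 / lam * cmod x" for x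
    proof -
      have "cmod (x / M t u) = cmod x / cmod (M t u)" by (simp add: norm_divide)
      also have "\<dots> \<le> cmod x / (lam / 2)" using Mb lam M0 by (intro divide_left_mono) auto
      finally show ?thesis by (simp add: field_simps)
    qed
    have "cmod \<nu> \<le> 2 / lam * cmod (lam - M t u)" unfolding \<nu>_def by (rule nuM)
    also have "\<dots> \<le> 2 / lam * ((k + C) * l)" using Ml lam by (intro mult_left_mono) (auto simp: norm_minus_commute)
    finally have nu2: "cmod \<nu> \<le> A * l" unfolding A_def by (simp only: mult.assoc)
    have nu1: "cmod \<nu> \<le> 1/4" using nu2 \<open>A * l \<le> A * (2*r)\<close> r2 by linarith
    have "\<nu> - \<mu> * (t + u) = ((lam - M t u - kap * (t+u)) + kap * (t+u) * (lam - M t u) / lam) / M t u"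
      using M0 lam by (simp add: \<nu>_def \<mu>_def field_simps)
    also have "cmod \<dots> \<le> 2 / lam * cmod ((lam - M t u - kap * (t+u)) + kap * (t+u) * (lam - M t u) / lam)"
      by (rule nuM)
    also have "\<dots> \<le> 2 / lam * (C * l\<^sup>2 + k * (k + C) / lam * l\<^sup>2)"
    proof (intro mult_left_mono order_trans[OF norm_triangle_ineq] add_mono)
      show "cmod (lam - M t u - kap * (t + u)) \<le> C * l\<^sup>2" using T by (simp add: norm_minus_commute algebra_simps)
      have "cmod (kap * (t+u) * (lam - M t u) / lam) = cmod (kap * (t+u)) * cmod (M t u - lam) / lam"
        using lam by (simp add: norm_mult norm_divide norm_minus_commute)
      also have "\<dots> \<le> (k * l) * ((k + C) * l) / lam" using kt Ml lam k l C
        by (intro divide_right_mono mult_mono) auto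
      finally show "cmod (kap * (t+u) * (lam - M t u) / lam) \<le> k * (k + C) / lam * l\<^sup>2"
        by (simp add: power2_eq_square algebra_simps)
    qed (use lam in auto)
    also have "\<dots> = B * l\<^sup>2" by (simp add: B_def algebra_simps)
    finally have nu3: "cmod (\<nu> - \<mu> * (t+u)) \<le> B * l\<^sup>2" .
    have "(of_real s + t) * (of_real s + u) = - of_real s / M t u" using eq M0 by (simp add: field_simps)
    also have "\<dots> = - (of_real (s / lam) * (1 + \<nu>))" using M0 lam by (simp add: \<nu>_def field_simps)
    finally have "lam + 1/2 + Re \<mu> \<le> (A + 2 * A * cmod \<mu> + 2 * B) * (cmod t + cmod u)"
      using neck_estimate[OF s lam t u _ nu1 _ _ B] nu2 nu3 by (simp add: l_def)
    also have "\<dots> = D * l" by (simp add: D_def l_def)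
    also have "\<dots> \<le> D * (2 * r)" using l D by (intro mult_left_mono) auto
    finally have "lam + 1/2 + Re \<mu> \<le> lam / 4" using r3 by linarith
    moreover have "lam + 1/2 + Re \<mu> \<ge> lam / 2"
    proof -
      have "lam * (lam + 1 + 2 * Re \<mu>) \<ge> 0" using curv lam
        by (simp add: \<mu>_def power2_eq_square algebra_simps)
      hence "lam + 1 + 2 * Re \<mu> \<ge> 0" using lam by (simp add: zero_le_mult_iff)
      thus ?thesis by linarith
    qed
    ultimately show False using lam by linarith
  qed
  thus ?thesis using r0 by blast
qed

lemma nonpos_if_le_linear:
  fixes a K :: real
  assumes "\<delta> > 0" and "\<And>y. 0 < y \<Longrightarrow> y \<le> \<delta> \<Longrightarrow> a \<le> K * y"
  shows "a \<le> 0"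
proof (rule tendsto_le[OF trivial_limit_at_right_real])
  show "((\<lambda>y. K * y) \<longlongrightarrow> 0) (at_right 0)" by (auto intro!: tendsto_eq_intros)
  show "((\<lambda>y. a) \<longlongrightarrow> a) (at_right 0)" by simp
  show "\<forall>\<^sub>F y in at_right 0. a \<le> K * y"
    using eventually_at_right_real[OF assms(1)] by eventually_elim (use assms(2) in auto)
qed

text \<open>
  In the normalisation \<open>P = (R - R(\<xi>)) / b\<close> the attached disc is \<open>cball (1/2) (1/2)\<close>. That the twice
  larger disc \<open>ball 1 1\<close> is free of values of \<open>P\<close> bounds the curvature with room to spare.
\<close>
lemma tangency_curvature:
  fixes P :: "complex \<Rightarrow> complex" and lamc kap :: complex
  assumes P: "\<And>t. t \<in> cball 1 1 \<Longrightarrow> cmod (P t + lamc * t - kap * t\<^sup>2) \<le> C * cmod t ^ 3"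
    and P1: "\<And>t. t \<in> cball 1 1 \<Longrightarrow> cmod (P t - 1) \<ge> 1" and nz: "lamc \<noteq> 0"
  shows "\<exists>lam>0. lamc = of_real lam \<and> lam\<^sup>2 + lam + 2 * Re kap \<ge> 0"
proof -
  have "0 \<le> C * cmod 1 ^ 3" using P[of 1] by (meson centre_in_cball norm_ge_zero order_trans zero_le_one)
  hence C: "C \<ge> 0" by simp
  define k where "k = cmod kap"
  have k: "k \<ge> 0" by (simp add: k_def)
  have PR: "2 * Re (P t) \<le> (cmod (P t))\<^sup>2" if "t \<in> cball 1 1" for t
  proof -
    have "1 \<le> (cmod (P t - 1))\<^sup>2" using P1[OF that] by (simp add: one_le_power)
    also have "\<dots> = (cmod (P t))\<^sup>2 - 2 * Re (P t) + 1"
      unfolding cmod_power2 by (simp add: power2_eq_square algebra_simps)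
    finally show ?thesis by simp
  qed
  have t2: "cmod t \<le> 2" if "t \<in> cball 1 1" for t :: complex
    using that norm_triangle_ineq4[of 1 "1 - t"] by (simp add: dist_norm)
  define K where "K = k + 2 * C"
  have K: "K \<ge> 0" using k C by (simp add: K_def)
  have Plin: "cmod (P t + lamc * t) \<le> K * (cmod t)\<^sup>2" if t: "t \<in> cball 1 1" for t
  proof -
    have "cmod (P t + lamc * t) = cmod ((P t + lamc * t - kap * t\<^sup>2) + kap * t\<^sup>2)" by simp
    also have "\<dots> \<le> C * cmod t ^ 3 + k * (cmod t)\<^sup>2"
      using P[OF t] by (intro order_trans[OF norm_triangle_ineq] add_mono) (auto simp: norm_mult norm_power k_def)
    also have "C * cmod t ^ 3 \<le> C * (2 * (cmod t)\<^sup>2)" using mult_right_mono[OF t2[OF t], of "(cmod t)\<^sup>2"] C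
      by (intro mult_left_mono) (auto simp: power3_eq_cube power2_eq_square algebra_simps)
    finally show ?thesis by (simp add: K_def algebra_simps)
  qed
  define B where "B = cmod lamc + 2 * K"
  have Pb: "cmod (P t) \<le> B * cmod t" if t: "t \<in> cball 1 1" for t
  proof -
    have "cmod (P t) \<le> cmod (P t + lamc * t) + cmod (lamc * t)"
      using norm_triangle_ineq4[of "P t + lamc * t" "lamc * t"] by simp
    also have "\<dots> \<le> K * (cmod t)\<^sup>2 + cmod lamc * cmod t" using Plin[OF t] by (simp add: norm_mult)
    also have "K * (cmod t)\<^sup>2 \<le> K * (2 * cmod t)" using t2[OF t] K
      by (intro mult_left_mono) (auto simp: power2_eq_square intro!: mult_right_mono)
    finally show ?thesis by (simp add: B_def algebra_simps)
  qed
  \<comment> \<open>A segment from 0 in direction \<open>w\<close> starts inside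
    \<open>cball 1 1\<close>. If \<open>Re (lamc * w)\<close> were negative,
    \<open>P t = - lamc * t + O(t\<^sup>2)\<close> would enter \<open>ball 1 1\<close> along
    it.\<close>
  have dir: "Re (lamc * w) \<ge> 0" if w: "Re w > 0" for w
  proof -
    have wn: "cmod w > 0" using w by auto
    define \<delta> where "\<delta> = 2 * Re w / (cmod w)\<^sup>2"
    have "- Re (lamc * w) \<le> 0"
    proof (rule nonpos_if_le_linear)
      show "\<delta> > 0" using w wn by (simp add: \<delta>_def)
      fix y :: real assume y: "0 < y" "y \<le> \<delta>"
      define t where "t = of_real y * w"
      have "y * (cmod w)\<^sup>2 \<le> 2 * Re w" using y wn by (simp add: \<delta>_def field_simps)
      hence "y * (y * (cmod w)\<^sup>2) \<le> y * (2 * Re w)" using y by (intro mult_left_mono) auto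
      hence t: "t \<in> cball 1 1" unfolding cball11_iff using y
        by (simp add: t_def norm_mult power2_eq_square algebra_simps)
      have "- Re (lamc * t) = Re (P t) - Re (P t + lamc * t)" by simp
      also have "\<dots> \<le> (B * cmod t)\<^sup>2 / 2 + K * (cmod t)\<^sup>2"
      proof -
        have "2 * Re (P t) \<le> (B * cmod t)\<^sup>2"
          using PR[OF t] power_mono[OF Pb[OF t], of 2] by simp
        moreover have "- Re (P t + lamc * t) \<le> K * (cmod t)\<^sup>2"
          using Plin[OF t] abs_Re_le_cmod[of "P t + lamc * t"] by linarith
        ultimately show ?thesis by linarith
      qed
      finally have "y * (- Re (lamc * w)) \<le> y * (((B * cmod w)\<^sup>2 / 2 + K * (cmod w)\<^sup>2) * y)"
        using y by (simp add: t_def norm_mult power2_eq_square algebra_simps)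
      thus "- Re (lamc * w) \<le> ((B * cmod w)\<^sup>2 / 2 + K * (cmod w)\<^sup>2) * y" using y by simp
    qed
    thus ?thesis by simp
  qed
  have Imz: "Im lamc = 0"
  proof (rule ccontr)
    assume ne: "Im lamc \<noteq> 0"
    \<comment> \<open>This direction would give real part -1.\<close>
    have "Re (lamc * Complex 1 ((Re lamc + 1) / Im lamc)) \<ge> 0" by (rule dir) simp
    thus False using ne by simp
  qed
  define lam where "lam = Re lamc"
  have lamc: "lamc = of_real lam" using Imz by (simp add: complex_eq_iff lam_def)
  have "lam \<ge> 0" using dir[of 1] by (simp add: lam_def)
  hence lam: "lam > 0" using nz lamc by (cases "lam = 0") auto
  define K3 where "K3 = lam + 4 * K"
  have K3: "K3 \<ge> 0" using lam K by (simp add: K3_def)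
  define K4 where "K4 = (2 * lam * K3 + K3\<^sup>2) + lam + 6 * k + 16 * C"
  have "- (lam\<^sup>2 + lam + 2 * Re kap) \<le> 0"
  proof (rule nonpos_if_le_linear)
    show "(1::real) > 0" by simp
    fix y :: real assume y: "0 < y" "y \<le> 1"
    \<comment> \<open>The circle bounding \<open>cball 1 1\<close> is
      \<open>x = y\<^sup>2 / 2 + O(y ^ 4)\<close>; the added \<open>y ^ 4 / 2\<close> keeps the
      point inside without a square root. Comparing coefficients of \<open>y\<^sup>2\<close> in
      \<open>2 * Re (P t) \<le> (cmod (P t))\<^sup>2\<close> yields the curvature
      inequality.\<close>
    define x where "x = (y\<^sup>2 + y ^ 4) / 2"
    define t where "t = Complex x y"
    have y42: "y ^ 4 \<le> y\<^sup>2" "y ^ 4 \<le> y ^ 3" "y ^ 3 \<le> y\<^sup>2" "y\<^sup>2 \<le> y" 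
      using y power_decreasing[of 2 4 y] power_decreasing[of 3 4 y] power_decreasing[of 2 3 y] power_decreasing[of 1 2 y] by auto
    have x: "0 \<le> x" "x \<le> y\<^sup>2" using y42 y by (auto simp: x_def)
    have "x\<^sup>2 \<le> (y\<^sup>2)\<^sup>2" using x by (intro power_mono) auto
    hence tn: "(cmod t)\<^sup>2 \<le> y\<^sup>2 + y ^ 4" by (simp add: t_def cmod_power2)
    hence t: "t \<in> cball 1 1" unfolding cball11_iff by (simp add: t_def x_def)
    have tn1: "cmod t \<le> y + y\<^sup>2" using cmod_le[of t] x y by (simp add: t_def)
    have tn2: "cmod t \<le> 2 * y" using tn1 y42 by linarith
    have "cmod (P t) \<le> cmod (P t + lamc * t) + cmod (lamc * t)"
      using norm_triangle_ineq4[of "P t + lamc * t" "lamc * t"] by simp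
    also have "\<dots> \<le> K * (cmod t)\<^sup>2 + lam * cmod t" using Plin[OF t] lam by (simp add: norm_mult lamc)
    also have "\<dots> \<le> K * (2 * y)\<^sup>2 + lam * (y + y\<^sup>2)" using tn1 tn2 K lam
      by (intro add_mono mult_left_mono power_mono) auto
    also have "\<dots> = lam * y + K3 * y\<^sup>2" by (simp add: K3_def power2_eq_square algebra_simps)
    finally have "(cmod (P t))\<^sup>2 \<le> (lam * y + K3 * y\<^sup>2)\<^sup>2" by (intro power_mono) auto
    also have "\<dots> = lam\<^sup>2 * y\<^sup>2 + 2 * lam * K3 * y ^ 3 + K3\<^sup>2 * y ^ 4"
      by (simp add: power2_eq_square power3_eq_cube power4_eq_xxxx algebra_simps)
    also have "K3\<^sup>2 * y ^ 4 \<le> K3\<^sup>2 * y ^ 3" using y42 by (intro mult_left_mono) auto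
    finally have up: "2 * Re (P t) \<le> lam\<^sup>2 * y\<^sup>2 + (2 * lam * K3 + K3\<^sup>2) * y ^ 3"
      using PR[OF t] by (simp add: algebra_simps)
    have "cmod (P t + lamc * t - kap * t\<^sup>2) \<le> C * (2 * y) ^ 3" using P[OF t] tn2 C
      by (meson order_trans mult_left_mono power_mono norm_ge_zero)
    hence e1: "Re (P t + lamc * t - kap * t\<^sup>2) \<ge> - (8 * C * y ^ 3)"
      using abs_Re_le_cmod[of "P t + lamc * t - kap * t\<^sup>2"] by (simp add: power_mult_distrib)
    have "t\<^sup>2 + of_real (y\<^sup>2) = (t - \<i> * y) * (t + \<i> * y)" by (simp add: power2_eq_square algebra_simps)
    also have "t - \<i> * y = of_real x" by (simp add: t_def complex_eq_iff)
    finally have "cmod (t\<^sup>2 + of_real (y\<^sup>2)) = x * cmod (t + \<i> * y)" using x by (simp add: norm_mult)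
    also have "\<dots> \<le> y\<^sup>2 * (2 * y + y)" using x tn2 y
      by (intro mult_mono order_trans[OF norm_triangle_ineq] add_mono) (auto simp: norm_mult)
    finally have "cmod (kap * (t\<^sup>2 + of_real (y\<^sup>2))) \<le> k * (y\<^sup>2 * (2 * y + y))"
      unfolding norm_mult k_def by (intro mult_left_mono) auto
    hence "Re (kap * (t\<^sup>2 + of_real (y\<^sup>2))) \<ge> - (3 * k * y ^ 3)"
      using abs_Re_le_cmod[of "kap * (t\<^sup>2 + of_real (y\<^sup>2))"] by (simp add: power2_eq_square power3_eq_cube)
    hence e2: "Re (kap * t\<^sup>2) \<ge> - (3 * k * y ^ 3) - Re kap * y\<^sup>2" by (simp add: algebra_simps)
    have e3: "Re (lamc * t) = lam * x" by (simp add: lamc t_def)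
    have "lam * x \<le> lam * (y\<^sup>2 + y ^ 3) / 2" using y42 lam by (simp add: x_def)
    with e1 e2 e3 have "2 * Re (P t) \<ge> - lam * (y\<^sup>2 + y ^ 3) - 2 * Re kap * y\<^sup>2 - 6 * k * y ^ 3 - 16 * C * y ^ 3"
      by simp
    with up have "y\<^sup>2 * (- (lam\<^sup>2 + lam + 2 * Re kap)) \<le> y\<^sup>2 * (K4 * y)"
      by (simp add: K4_def power2_eq_square power3_eq_cube algebra_simps)
    thus "- (lam\<^sup>2 + lam + 2 * Re kap) \<le> K4 * y" using y by simp
  qed
  thus ?thesis using lam lamc by auto
qed

text \<open>When \<open>u\<close> stays away from 0, the equation forces \<open>s + t\<close> to be
  of order \<open>s\<close>. Then \<open>P t\<close> and \<open>s / (s + u)\<close> are of order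
  \<open>s\<close> as well, so \<open>P u\<close> is within \<open>K * s\<close> of
  \<open>s / (s + t)\<close>, a point of \<open>cball (1/2) (1/2)\<close>. But \<open>P\<close>
  meets that disc only at 0, so by compactness the values \<open>P u\<close> keep a distance
  \<open>d\<close> from it.\<close>

lemma far_nonvanishing:
  fixes M :: "complex \<Rightarrow> complex \<Rightarrow> complex" and P :: "complex \<Rightarrow> complex"
  assumes dif: "\<And>t u. t \<in> cball 1 1 \<Longrightarrow> u \<in> cball 1 1 \<Longrightarrow> P t - P u = - M t u * (t - u)"
    and P0: "P 0 = 0" and P1: "\<And>t. t \<in> cball 1 1 \<Longrightarrow> cmod (P t - 1) \<ge> 1"
    and c: "c > 0" and Mc: "\<And>t u. t \<in> cball 1 1 \<Longrightarrow> u \<in> cball 1 1 \<Longrightarrow> cmod (M t u) \<ge> c"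
    and MB: "\<And>t u. t \<in> cball 1 1 \<Longrightarrow> u \<in> cball 1 1 \<Longrightarrow> cmod (M t u) \<le> B"
    and r: "r > 0"
  shows "\<exists>s0>0. \<forall>s. 0 < s \<longrightarrow> s < s0 \<longrightarrow> (\<forall>t\<in>cball 1 1. \<forall>u\<in>cball 1 1. cmod u \<ge> r \<longrightarrow>
           (of_real s + t) * (of_real s + u) * M t u \<noteq> - of_real s)"
proof -
  have z0: "(0::complex) \<in> cball 1 1" by simp
  have B: "B \<ge> 0" using MB[OF z0 z0] norm_ge_zero order_trans by blast
  have lip: "dist (P t) (P u) \<le> B * dist t u" if "t \<in> cball 1 1" "u \<in> cball 1 1" for t u
    using dif[OF that] MB[OF that] by (simp add: dist_norm norm_mult mult_right_mono)
  have "continuous_on (cball 1 1) P"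
    using lip B by (intro lipschitz_on_continuous_on[of B]) (auto intro!: lipschitz_onI)
  hence cont: "continuous_on (cball 1 1 - ball 0 r) P" by (rule continuous_on_subset) auto
  have "compact (P ` (cball 1 1 - ball 0 r))"
    by (intro compact_continuous_image cont compact_diff) auto
  moreover have "P ` (cball 1 1 - ball 0 r) \<inter> cball (1/2) (1/2) = {}"
  proof (safe)
    fix u :: complex assume u: "u \<in> cball 1 1" "u \<notin> ball 0 r" and Pu: "P u \<in> cball (1/2) (1/2)"
    have "cmod (P u) = cmod (M u 0) * cmod u" using dif[OF u(1) z0] P0 by (simp add: norm_mult)
    moreover have "\<dots> > 0" using Mc[OF u(1) z0] c u(2) r by (intro mult_pos_pos) auto
    ultimately have "P u \<noteq> 0" by auto
    have "(cmod (P u - 1/2))\<^sup>2 \<le> (1/2)\<^sup>2" using Pu by (intro power_mono) (auto simp: dist_norm norm_minus_commute)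
    hence "(cmod (P u))\<^sup>2 \<le> Re (P u)" unfolding cmod_power2 by (simp add: power2_eq_square algebra_simps)
    moreover have "1 \<le> (cmod (P u - 1))\<^sup>2" using P1[OF u(1)] by (simp add: one_le_power)
    hence "2 * Re (P u) \<le> (cmod (P u))\<^sup>2" unfolding cmod_power2 by (simp add: power2_eq_square algebra_simps)
    ultimately have "(cmod (P u))\<^sup>2 \<le> 0" by linarith
    thus "P u \<in> {}" using \<open>P u \<noteq> 0\<close> by simp
  qed
  ultimately obtain d where d: "d > 0" and dd: "\<And>x y. x \<in> P ` (cball 1 1 - ball 0 r) \<Longrightarrow> y \<in> cball (1/2) (1/2) \<Longrightarrow> d \<le> dist x y"
    using separate_compact_closed[of "P ` (cball 1 1 - ball 0 r)" "cball (1/2) (1/2)"] by (metis closed_cball)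
  define K where "K = B / (c * r) + 1 / r"
  have K: "K > 0" using B c r by (simp add: K_def add_nonneg_pos)
  have "(of_real s + t) * (of_real s + u) * M t u \<noteq> - of_real s"
    if s: "0 < s" "s < d / K" and t: "t \<in> cball 1 1" and u: "u \<in> cball 1 1" and ur: "cmod u \<ge> r" for s t u
  proof
    assume eq: "(of_real s + t) * (of_real s + u) * M t u = - of_real s"
    have Re0: "Re t \<ge> 0" "Re u \<ge> 0" using t u unfolding cball11_iff by (smt (verit) zero_le_power2)+
    have ge: "cmod v \<le> cmod (of_real s + v)" "s \<le> cmod (of_real s + v)" if "Re v \<ge> 0" for v
    proof -
      have "(cmod v)\<^sup>2 \<le> (cmod (of_real s + v))\<^sup>2" unfolding cmod_power2 using that s(1)
        by (auto intro!: power_mono)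
      thus "cmod v \<le> cmod (of_real s + v)" by (rule power2_le_imp_le) simp
      show "s \<le> cmod (of_real s + v)" using complex_Re_le_cmod[of "of_real s + v"] that by simp
    qed
    define T U where "T = of_real s + t" "U = of_real s + u"
    note TU = this
    have T: "cmod T \<ge> cmod t" "cmod T \<ge> s" "T \<noteq> 0" using ge[OF Re0(1)] s by (auto simp: TU)
    have U: "cmod U \<ge> cmod u" "cmod U \<ge> r" "U \<noteq> 0" using ge[OF Re0(2)] ur r by (auto simp: TU)
    have M: "M t u = - of_real s / (T * U)" 
    proof -
      have "T * U * M t u = - of_real s" using eq by (simp add: TU)
      thus ?thesis using T(3) U(3) by (simp add: field_simps)
    qed
    have "cmod T * (r * c) \<le> cmod T * (cmod U * cmod (M t u))"
      using U(2) Mc[OF t u] c r by (intro mult_left_mono mult_mono) auto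
    also have "\<dots> = s" using arg_cong[OF eq, of cmod] s by (simp add: TU norm_mult mult.assoc)
    finally have Ts: "cmod T \<le> s / (c * r)" using c r by (simp add: field_simps)
    have "P t - P u = of_real s * (t - u) / (T * U)" using dif[OF t u] M by simp
    also have "t - u = T - U" by (simp add: TU)
    also have "of_real s * (T - U) / (T * U) = of_real s / U - of_real s / T" using T U by (simp add: field_simps)
    finally have Pu: "P u - of_real s / T = P t - of_real s / U" by (simp add: algebra_simps)
    have "cmod (P t) \<le> B * cmod t" using lip[OF t z0] P0 by simp
    also have "\<dots> \<le> B * (s / (c * r))" using T(1) Ts B by (intro mult_left_mono) auto
    finally have a: "cmod (P t) \<le> B * (s / (c * r))" .
    have b: "cmod (of_real s / U) \<le> s / r" using s r U(2) by (auto simp: norm_divide intro!: divide_left_mono mult_pos_pos)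
    have "cmod (P u - of_real s / T) \<le> B * (s / (c * r)) + s / r" unfolding Pu
      using a b norm_triangle_ineq4 by (meson add_mono order_trans)
    also have "\<dots> = K * s" by (simp add: K_def algebra_simps)
    finally have "dist (P u) (of_real s / T) \<le> K * s" by (simp add: dist_norm)
    also have "\<dots> < d" using s K by (simp add: field_simps)
    finally have "dist (P u) (of_real s / T) < d" .
    moreover have "of_real s / T \<in> cball (1/2) (1/2)"
    proof -
      have "cmod (T - 2 * of_real s) \<le> cmod T"
      proof (rule power2_le_imp_le)
        have "Re T \<ge> s" using Re0 by (simp add: TU)
        hence "s * s \<le> s * Re T" using s by simp
        thus "(cmod (T - 2 * of_real s))\<^sup>2 \<le> (cmod T)\<^sup>2"
          unfolding cmod_power2 by (simp add: power2_eq_square algebra_simps)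
      qed simp
      moreover have "1/2 - of_real s / T = (T - 2 * of_real s) / (2 * T)" using T by (simp add: field_simps)
      ultimately show ?thesis using T(3) by (simp add: dist_norm norm_divide norm_mult)
    qed
    ultimately show False using dd[of "P u" "of_real s / T"] u ur by force
  qed
  thus ?thesis using d K by (intro exI[of _ "d / K"]) auto
qed

text \<open>The order of choices matters: the radius \<open>r\<close> of the near region does not
  depend on \<open>s\<close>, so the threshold for \<open>s\<close> in the far region may depend on
  \<open>r\<close>. The expansion of \<open>P\<close> to second order is read off from
  \<open>M t 0\<close>.\<close>

lemma attach_nonvanishing:
  fixes M :: "complex \<Rightarrow> complex \<Rightarrow> complex" and P :: "complex \<Rightarrow> complex" and lamc kap :: complex
  assumes dif: "\<And>t u. t \<in> cball 1 1 \<Longrightarrow> u \<in> cball 1 1 \<Longrightarrow> P t - P u = - M t u * (t - u)"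
    and P0: "P 0 = 0" and P1: "\<And>t. t \<in> cball 1 1 \<Longrightarrow> cmod (P t - 1) \<ge> 1"
    and c: "c > 0" and Mc: "\<And>t u. t \<in> cball 1 1 \<Longrightarrow> u \<in> cball 1 1 \<Longrightarrow> cmod (M t u) \<ge> c"
    and tay: "\<And>t u. t \<in> cball 1 1 \<Longrightarrow> u \<in> cball 1 1 \<Longrightarrow>
        cmod (M t u - (lamc - kap * (t + u))) \<le> C * (cmod t + cmod u)\<^sup>2"
  shows "\<exists>s0>0. \<forall>s. 0 < s \<longrightarrow> s < s0 \<longrightarrow> (\<forall>t\<in>cball 1 1. \<forall>u\<in>cball 1 1.
           (of_real s + t) * (of_real s + u) * M t u \<noteq> - of_real s)"
proof -
  have z0: "(0::complex) \<in> cball 1 1" by simp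
  have "0 \<le> C * (cmod 1 + cmod 1)\<^sup>2" using tay[of 1 1] by (smt (verit) centre_in_cball norm_ge_zero)
  hence C: "C \<ge> 0" by (simp add: zero_le_mult_iff)
  have t2: "cmod t \<le> 2" if "t \<in> cball 1 1" for t :: complex
    using that norm_triangle_ineq4[of 1 "1 - t"] by (simp add: dist_norm)
  define B where "B = cmod lamc + cmod kap * 4 + C * 16"
  have MB: "cmod (M t u) \<le> B" if tu: "t \<in> cball 1 1" "u \<in> cball 1 1" for t u
  proof -
    have l: "cmod t + cmod u \<le> 4" using tu[THEN t2] by simp
    have "cmod (M t u) = cmod ((M t u - (lamc - kap * (t + u))) + (lamc - kap * (t + u)))" by simp
    also have "\<dots> \<le> C * (cmod t + cmod u)\<^sup>2 + (cmod lamc + cmod kap * (cmod t + cmod u))"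
      by (intro order_trans[OF norm_triangle_ineq] add_mono order_trans[OF norm_triangle_ineq4] tay[OF tu])
         (auto simp: norm_mult intro!: mult_left_mono norm_triangle_ineq)
    also have "\<dots> \<le> C * 4\<^sup>2 + (cmod lamc + cmod kap * 4)"
      using l C by (intro add_mono mult_left_mono power_mono order_refl) auto
    finally show ?thesis by (simp add: B_def)
  qed
  have "lamc = M 0 0" using tay[OF z0 z0] by simp
  hence "lamc \<noteq> 0" using Mc[OF z0 z0] c by auto
  moreover have "cmod (P t + lamc * t - kap * t\<^sup>2) \<le> C * cmod t ^ 3" if t: "t \<in> cball 1 1" for t
  proof -
    have "P t + lamc * t - kap * t\<^sup>2 = - (M t 0 - (lamc - kap * (t + 0))) * t"
      using dif[OF t z0] P0 by (simp add: power2_eq_square algebra_simps)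
    also have "cmod \<dots> \<le> (C * (cmod t + cmod 0)\<^sup>2) * cmod t"
      unfolding norm_mult norm_minus_cancel by (intro mult_right_mono tay t z0) auto
    finally show ?thesis by (simp add: power2_eq_square power3_eq_cube algebra_simps)
  qed
  ultimately obtain lam where lam: "lam > 0" "lamc = of_real lam" "lam\<^sup>2 + lam + 2 * Re kap \<ge> 0"
    using tangency_curvature[of P lamc kap C] P1 by blast
  obtain r where r: "r > 0" and near: "\<And>s t u. s > 0 \<Longrightarrow> t \<in> cball 1 1 \<Longrightarrow> u \<in> cball 1 1 \<Longrightarrow> cmod t \<le> r \<Longrightarrow> cmod u \<le> r \<Longrightarrow>
      (of_real s + t) * (of_real s + u) * M t u \<noteq> - of_real s"
    using near_nonvanishing[OF lam(1) lam(3), of M C] tay lam(2) by metis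
  obtain s1 where s1: "s1 > 0" "\<And>s t u. 0 < s \<Longrightarrow> s < s1 \<Longrightarrow> t \<in> cball 1 1 \<Longrightarrow> u \<in> cball 1 1 \<Longrightarrow> cmod u \<ge> r \<Longrightarrow>
      (of_real s + t) * (of_real s + u) * M t u \<noteq> - of_real s"
    using far_nonvanishing[of P M c B r, OF dif P0 P1 c Mc MB r] by metis
  \<comment> \<open>The far estimate for the transpose of \<open>M\<close> covers the case where
    \<open>t\<close> is the distant point.\<close>
  obtain s2 where s2: "s2 > 0" "\<And>s t u. 0 < s \<Longrightarrow> s < s2 \<Longrightarrow> t \<in> cball 1 1 \<Longrightarrow> u \<in> cball 1 1 \<Longrightarrow> cmod u \<ge> r \<Longrightarrow>
      (of_real s + t) * (of_real s + u) * M u t \<noteq> - of_real s"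
  proof -
    have dif': "P t - P u = - M u t * (t - u)" if "t \<in> cball 1 1" "u \<in> cball 1 1" for t u
      using dif[OF that(2) that(1)] by (simp add: algebra_simps)
    show ?thesis using that far_nonvanishing[of P "\<lambda>t u. M u t" c B r, OF dif' P0 P1 c Mc MB r] by metis
  qed
  show ?thesis
  proof (intro exI[of _ "min s1 s2"] conjI allI impI ballI)
    fix s :: real and t u :: complex
    assume s: "0 < s" "s < min s1 s2" and t: "t \<in> cball 1 1" and u: "u \<in> cball 1 1"
    consider "cmod t \<le> r \<and> cmod u \<le> r" | "cmod u \<ge> r" | "cmod t \<ge> r" by linarith
    thus "(of_real s + t) * (of_real s + u) * M t u \<noteq> - of_real s"
    proof cases
      case 3
      thus ?thesis using s2(2)[of s u t] s t u by (simp add: mult.commute)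
    qed (use near s1 s t u in auto)
  qed (use s1 s2 in auto)
qed

section \<open>Rational bumps, their finite sums and divided differences\<close>

definition bump :: "complex \<Rightarrow> real \<Rightarrow> complex \<Rightarrow> complex" where
  "bump \<zeta> s z = of_real s / (of_real s + 1 - cnj \<zeta> * z)"

text \<open>
  The divided difference of \<open>bump\<close>. Nonvanishing of the divided difference of a sum of bumps on the
  closed bidisc expresses at once injectivity and nonvanishing of the derivative.
\<close>
definition bump_dd :: "complex \<Rightarrow> real \<Rightarrow> complex \<Rightarrow> complex \<Rightarrow> complex" where
  "bump_dd \<zeta> s z w = cnj \<zeta> * of_real s / ((of_real s + 1 - cnj \<zeta> * z) * (of_real s + 1 - cnj \<zeta> * w))"

definition bump_sum :: "(nat \<Rightarrow> complex) \<Rightarrow> (nat \<Rightarrow> complex) \<Rightarrow> (nat \<Rightarrow> real) \<Rightarrow> nat \<Rightarrow> complex \<Rightarrow> complex" where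
  "bump_sum \<zeta> \<beta> s n z = (\<Sum>k<n. \<beta> k * bump (\<zeta> k) (s k) z)"

definition dd_sum :: "(nat \<Rightarrow> complex) \<Rightarrow> (nat \<Rightarrow> complex) \<Rightarrow> (nat \<Rightarrow> real) \<Rightarrow> nat \<Rightarrow> complex \<Rightarrow> complex \<Rightarrow> complex" where
  "dd_sum \<zeta> \<beta> s n z w = (\<Sum>k<n. \<beta> k * bump_dd (\<zeta> k) (s k) z w)"

text \<open>Everything rests on \<open>Re (cnj \<zeta> * z) \<le> 1\<close>: adding \<open>s\<close>
  only moves \<open>1 - cnj \<zeta> * z\<close> away from 0. The first bound controls size and
  Lipschitz constants everywhere; the next two give decay away from \<open>\<zeta>\<close> and in
  the interior.\<close>

lemma bump_denom:
  assumes "cmod \<zeta> = 1" "s > 0" "z \<in> cball 0 1"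
  shows "cmod (of_real s + 1 - cnj \<zeta> * z) \<ge> s" "cmod (of_real s + 1 - cnj \<zeta> * z) \<ge> cmod (z - \<zeta>)"
    "cmod (of_real s + 1 - cnj \<zeta> * z) \<ge> 1 - cmod z"
    "of_real s + 1 - cnj \<zeta> * z \<noteq> 0"
proof -
  have "cmod (cnj \<zeta> * z) \<le> 1" using assms by (simp add: norm_mult)
  hence re: "Re (cnj \<zeta> * z) \<le> 1" using complex_Re_le_cmod order_trans by blast
  show 1: "cmod (of_real s + 1 - cnj \<zeta> * z) \<ge> s"
    using complex_Re_le_cmod[of "of_real s + 1 - cnj \<zeta> * z"] re by (simp del: times_complex.sel)
  show "of_real s + 1 - cnj \<zeta> * z \<noteq> 0" using 1 assms by auto
  have "\<zeta> * cnj \<zeta> = 1" using assms by (simp add: complex_norm_square[symmetric] flip: of_real_power)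
  hence "z - \<zeta> = - \<zeta> * (1 - cnj \<zeta> * z)" by (simp add: algebra_simps)
  hence "cmod (z - \<zeta>) = cmod (1 - cnj \<zeta> * z)" using assms by (simp add: norm_mult)
  also have "\<dots> \<le> cmod (of_real s + 1 - cnj \<zeta> * z)"
  proof (rule power2_le_imp_le)
    have "(1 - Re (cnj \<zeta> * z))\<^sup>2 \<le> (s + 1 - Re (cnj \<zeta> * z))\<^sup>2" using re assms by (intro power_mono) auto
    thus "(cmod (1 - cnj \<zeta> * z))\<^sup>2 \<le> (cmod (of_real s + 1 - cnj \<zeta> * z))\<^sup>2"
      unfolding cmod_power2 by (simp del: times_complex.sel)
  qed simp
  finally show "cmod (of_real s + 1 - cnj \<zeta> * z) \<ge> cmod (z - \<zeta>)" .
  have "1 - cmod z \<le> cmod (z - \<zeta>)" using assms norm_triangle_ineq3[of z \<zeta>] by simp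
  thus "cmod (of_real s + 1 - cnj \<zeta> * z) \<ge> 1 - cmod z" using \<open>cmod (z - \<zeta>) \<le> _\<close> by linarith
qed

lemma bump_diff:
  assumes "cmod \<zeta> = 1" "s > 0" "z \<in> cball 0 1" "w \<in> cball 0 1"
  shows "bump \<zeta> s z - bump \<zeta> s w = bump_dd \<zeta> s z w * (z - w)"
  using bump_denom(4)[OF assms(1-3)] bump_denom(4)[OF assms(1,2,4)]
  by (simp add: bump_def bump_dd_def divide_simps) (simp add: algebra_simps)

lemma bump_dd_bound:
  assumes "cmod \<zeta> = 1" "s > 0" "z \<in> cball 0 1" "w \<in> cball 0 1"
  shows "cmod (bump_dd \<zeta> s z w) \<le> 1 / s"
proof -
  have "s * s \<le> cmod ((of_real s + 1 - cnj \<zeta> * z) * (of_real s + 1 - cnj \<zeta> * w))"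
    unfolding norm_mult using bump_denom(1)[OF assms(1-3)] bump_denom(1)[OF assms(1,2,4)] assms(2)
    by (intro mult_mono) auto
  hence "s / cmod ((of_real s + 1 - cnj \<zeta> * z) * (of_real s + 1 - cnj \<zeta> * w)) \<le> s / (s * s)"
    using assms(2) bump_denom(4)[OF assms(1-3)] bump_denom(4)[OF assms(1,2,4)]
    by (intro divide_left_mono mult_pos_pos) simp_all
  thus ?thesis using assms by (simp add: bump_dd_def norm_divide norm_mult)
qed

lemma continuous_on_bump_dd:
  assumes "cmod \<zeta> = 1" "s > 0"
  shows "continuous_on (cball 0 1 \<times> cball 0 1) (\<lambda>p. bump_dd \<zeta> s (fst p) (snd p))"
  unfolding bump_dd_def using bump_denom(4)[OF assms] by (intro continuous_intros) auto

lemma bump_sum_diff: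
  assumes "\<And>k. k < n \<Longrightarrow> cmod (\<zeta> k) = 1 \<and> s k > 0" "z \<in> cball 0 1" "w \<in> cball 0 1"
  shows "bump_sum \<zeta> \<beta> s n z - bump_sum \<zeta> \<beta> s n w = dd_sum \<zeta> \<beta> s n z w * (z - w)"
proof -
  have "bump_sum \<zeta> \<beta> s n z - bump_sum \<zeta> \<beta> s n w = (\<Sum>k<n. \<beta> k * (bump (\<zeta> k) (s k) z - bump (\<zeta> k) (s k) w))"
    by (simp add: bump_sum_def sum_subtractf right_diff_distrib)
  also have "\<dots> = (\<Sum>k<n. \<beta> k * (bump_dd (\<zeta> k) (s k) z w * (z - w)))"
    using assms by (intro sum.cong refl arg_cong2[of _ _ _ _ "(*)"] bump_diff) auto
  finally show ?thesis by (simp add: dd_sum_def sum_distrib_right mult.assoc)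
qed

lemma dd_sum_bound:
  assumes "\<And>k. k < n \<Longrightarrow> cmod (\<zeta> k) = 1 \<and> s k > 0" "z \<in> cball 0 1" "w \<in> cball 0 1"
  shows "cmod (dd_sum \<zeta> \<beta> s n z w) \<le> (\<Sum>k<n. cmod (\<beta> k) / s k)"
  unfolding dd_sum_def
proof (rule sum_norm_le)
  fix k assume "k \<in> {..<n}"
  hence "cmod (bump_dd (\<zeta> k) (s k) z w) \<le> 1 / s k" using assms by (intro bump_dd_bound) auto
  hence "cmod (\<beta> k) * cmod (bump_dd (\<zeta> k) (s k) z w) \<le> cmod (\<beta> k) * (1 / s k)" by (intro mult_left_mono) auto
  thus "cmod (\<beta> k * bump_dd (\<zeta> k) (s k) z w) \<le> cmod (\<beta> k) / s k" by (simp add: norm_mult)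
qed

lemma bump_holomorphic: "cmod \<zeta> = 1 \<Longrightarrow> s > 0 \<Longrightarrow> bump \<zeta> s holomorphic_on ball 0 (1 + s)"
  unfolding bump_def
proof (intro holomorphic_intros)
  fix z :: complex assume a: "cmod \<zeta> = 1" "s > 0" "z \<in> ball 0 (1 + s)"
  hence "cmod (cnj \<zeta> * z) < 1 + s" by (simp add: norm_mult)
  hence "Re (cnj \<zeta> * z) < 1 + s" using complex_Re_le_cmod le_less_trans by blast
  hence "Re (of_real s + 1 - cnj \<zeta> * z) > 0" by (simp del: times_complex.sel)
  thus "of_real s + 1 - cnj \<zeta> * z \<noteq> 0" by (metis less_irrefl zero_complex.sel(1))
qed

lemma bump_sum_holomorphic:
  assumes "\<And>k. k < n \<Longrightarrow> cmod (\<zeta> k) = 1 \<and> s k > 0"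
  shows "bump_sum \<zeta> \<beta> s n holomorphic_on ball 0 1" "continuous_on (cball 0 1) (bump_sum \<zeta> \<beta> s n)"
proof -
  have "bump (\<zeta> k) (s k) holomorphic_on cball 0 1" if "k < n" for k
    using bump_holomorphic[of "\<zeta> k" "s k"] assms[OF that] by (elim holomorphic_on_subset conjE) auto
  hence "(\<lambda>z. \<Sum>k<n. \<beta> k * bump (\<zeta> k) (s k) z) holomorphic_on cball 0 1"
    by (intro holomorphic_intros) auto
  hence h: "bump_sum \<zeta> \<beta> s n holomorphic_on cball 0 1" by (simp add: bump_sum_def[abs_def])
  show "bump_sum \<zeta> \<beta> s n holomorphic_on ball 0 1" using h by (rule holomorphic_on_subset) auto
  show "continuous_on (cball 0 1) (bump_sum \<zeta> \<beta> s n)" using h by (rule holomorphic_on_imp_continuous_on)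
qed

text \<open>An expansion to first order at the origin of the bidisc, with quadratic error on all of
  it. The linear part is symmetric, as for any divided difference. Hiding the constants makes the
  property stable under linear combinations, so it passes from one bump to a sum.\<close>

definition taylor2 :: "(complex \<Rightarrow> complex \<Rightarrow> complex) \<Rightarrow> bool" where
  "taylor2 F \<longleftrightarrow> (\<exists>lam kap C. \<forall>t\<in>cball 1 1. \<forall>u\<in>cball 1 1.
     cmod (F t u - (lam - kap * (t + u))) \<le> C * (cmod t + cmod u)\<^sup>2)"

lemma taylor2_cmult: "taylor2 F \<Longrightarrow> taylor2 (\<lambda>t u. c * F t u)"
proof -
  assume "taylor2 F"
  then obtain lam kap C where *: "\<And>t u. t\<in>cball 1 1 \<Longrightarrow> u\<in>cball 1 1 \<Longrightarrow>
     cmod (F t u - (lam - kap * (t + u))) \<le> C * (cmod t + cmod u)\<^sup>2" unfolding taylor2_def by blast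
  show ?thesis unfolding taylor2_def
  proof (rule exI[of _ "c * lam"], rule exI[of _ "c * kap"], rule exI[of _ "cmod c * C"], intro ballI)
    fix t u :: complex assume tu: "t\<in>cball 1 1" "u\<in>cball 1 1"
    have "cmod (c * F t u - (c * lam - c * kap * (t + u))) = cmod c * cmod (F t u - (lam - kap * (t + u)))"
      by (simp flip: norm_mult add: algebra_simps)
    also have "\<dots> \<le> cmod c * (C * (cmod t + cmod u)\<^sup>2)" using * tu by (intro mult_left_mono) auto
    finally show "cmod (c * F t u - (c * lam - c * kap * (t + u))) \<le> cmod c * C * (cmod t + cmod u)\<^sup>2"
      by (simp add: mult.assoc)
  qed
qed

lemma taylor2_add: "taylor2 F \<Longrightarrow> taylor2 G \<Longrightarrow> taylor2 (\<lambda>t u. F t u + G t u)"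
proof -
  assume "taylor2 F" "taylor2 G"
  then obtain lam kap C lam' kap' C' where *: "\<And>t u. t\<in>cball 1 1 \<Longrightarrow> u\<in>cball 1 1 \<Longrightarrow>
     cmod (F t u - (lam - kap * (t + u))) \<le> C * (cmod t + cmod u)\<^sup>2"
    "\<And>t u. t\<in>cball 1 1 \<Longrightarrow> u\<in>cball 1 1 \<Longrightarrow>
     cmod (G t u - (lam' - kap' * (t + u))) \<le> C' * (cmod t + cmod u)\<^sup>2" unfolding taylor2_def by blast
  show ?thesis unfolding taylor2_def
  proof (rule exI[of _ "lam + lam'"], rule exI[of _ "kap + kap'"], rule exI[of _ "C + C'"], intro ballI)
    fix t u :: complex assume tu: "t\<in>cball 1 1" "u\<in>cball 1 1"
    have "F t u + G t u - (lam + lam' - (kap + kap') * (t + u)) =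
        (F t u - (lam - kap * (t + u))) + (G t u - (lam' - kap' * (t + u)))" by (simp add: algebra_simps)
    also have "cmod \<dots> \<le> C * (cmod t + cmod u)\<^sup>2 + C' * (cmod t + cmod u)\<^sup>2"
      using * tu by (intro order_trans[OF norm_triangle_ineq] add_mono) auto
    finally show "cmod (F t u + G t u - (lam + lam' - (kap + kap') * (t + u))) \<le> (C + C') * (cmod t + cmod u)\<^sup>2"
      by (simp add: algebra_simps)
  qed
qed

lemma taylor2_zero: "taylor2 (\<lambda>t u. 0)"
  unfolding taylor2_def by (intro exI[of _ 0]) auto

lemma taylor2_inverse_prod:
  fixes A B :: complex
  assumes s: "s > 0" and low: "\<And>t. t \<in> cball 1 1 \<Longrightarrow> cmod (A + B * t) \<ge> s"
  shows "taylor2 (\<lambda>t u. 1 / ((A + B * t) * (A + B * u)))"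
  unfolding taylor2_def
proof (rule exI[of _ "1 / A\<^sup>2"], rule exI[of _ "B / A ^ 3"],
    rule exI[of _ "(2 * cmod A * (cmod B)\<^sup>2 + 4 * cmod B ^ 3) / (cmod A ^ 3 * (s * s))"], intro ballI)
  fix t u :: complex assume t: "t \<in> cball 1 1" and u: "u \<in> cball 1 1"
  have t2: "cmod t \<le> 2" if "t \<in> cball 1 1" for t :: complex
    using that norm_triangle_ineq4[of 1 "1 - t"] by (simp add: dist_norm)
  have A: "A \<noteq> 0" using low[of 0] s by auto
  have nz: "A + B * t \<noteq> 0" "A + B * u \<noteq> 0" using low[OF t] low[OF u] s by auto
  define l where "l = cmod t + cmod u"
  have l: "l \<le> 4" "l \<ge> 0" using t2[OF t] t2[OF u] by (auto simp: l_def)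
  have tu: "cmod (t * u) \<le> l\<^sup>2" by (simp add: l_def norm_mult power2_eq_square algebra_simps)
  have sg: "cmod (t + u) \<le> l" by (simp add: l_def norm_triangle_ineq)
  \<comment> \<open>The remainder is computed exactly; every term of its numerator is at least
    quadratic in \<open>t, u\<close>, and the cubic one is reduced by
    \<open>l \<le> 4\<close>.\<close>
  have "1 / ((A + B * t) * (A + B * u)) - (1 / A\<^sup>2 - B / A ^ 3 * (t + u)) =
     (A * B\<^sup>2 * ((t + u)\<^sup>2 - t * u) + B ^ 3 * (t + u) * (t * u)) / (A ^ 3 * ((A + B * t) * (A + B * u)))"
    using nz A by (simp add: divide_simps) (simp add: eval_nat_numeral algebra_simps)
  also have "cmod \<dots> \<le> ((2 * cmod A * (cmod B)\<^sup>2 + 4 * cmod B ^ 3) * l\<^sup>2) / (cmod A ^ 3 * (s * s))"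
    unfolding norm_divide
  proof (rule frac_le)
    have "cmod ((t + u)\<^sup>2 - t * u) \<le> l\<^sup>2 + l\<^sup>2" using tu sg
      by (intro order_trans[OF norm_triangle_ineq4] add_mono) (auto simp: norm_power intro: power_mono)
    hence a: "cmod (A * B\<^sup>2 * ((t + u)\<^sup>2 - t * u)) \<le> cmod A * (cmod B)\<^sup>2 * (l\<^sup>2 + l\<^sup>2)"
      unfolding norm_mult norm_power by (intro mult_left_mono) auto
    have "cmod ((t + u) * (t * u)) \<le> 4 * l\<^sup>2" unfolding norm_mult[of "t + u"] using sg l tu by (intro mult_mono) auto
    hence b: "cmod (B ^ 3 * ((t + u) * (t * u))) \<le> cmod B ^ 3 * (4 * l\<^sup>2)"
      unfolding norm_mult[of "B ^ 3"] norm_power by (intro mult_left_mono) auto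
    show "cmod (A * B\<^sup>2 * ((t + u)\<^sup>2 - t * u) + B ^ 3 * (t + u) * (t * u)) \<le> (2 * cmod A * (cmod B)\<^sup>2 + 4 * cmod B ^ 3) * l\<^sup>2"
      using norm_triangle_le[OF add_mono[OF a b]] by (simp add: algebra_simps)
    show "cmod A ^ 3 * (s * s) \<le> cmod (A ^ 3 * ((A + B * t) * (A + B * u)))"
      unfolding norm_mult norm_power using low[OF t] low[OF u] s by (intro mult_left_mono mult_mono) auto
  qed (use A s in auto)
  finally show "cmod (1 / ((A + B * t) * (A + B * u)) - (1 / A\<^sup>2 - B / A ^ 3 * (t + u)))
       \<le> (2 * cmod A * (cmod B)\<^sup>2 + 4 * cmod B ^ 3) / (cmod A ^ 3 * (s * s)) * (cmod t + cmod u)\<^sup>2"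
    by (simp add: l_def)
qed

lemma rotate_mem:
  assumes "cmod \<zeta> = 1" "t \<in> cball 1 1" shows "\<zeta> * (1 - t) \<in> cball 0 1"
  using assms by (simp add: norm_mult dist_norm)

lemma taylor2_dd_sum:
  assumes "\<And>k. k < n \<Longrightarrow> cmod (\<zeta> k) = 1 \<and> s k > 0" "cmod \<xi> = 1"
  shows "taylor2 (\<lambda>t u. dd_sum \<zeta> \<beta> s n (\<xi> * (1 - t)) (\<xi> * (1 - u)))"
  using assms(1)
proof (induction n)
  case 0
  thus ?case using taylor2_zero by (simp add: dd_sum_def)
next
  case (Suc n)
  have z: "cmod (\<zeta> n) = 1" "s n > 0" using Suc.prems[of n] by auto
  let ?B = "cnj (\<zeta> n) * \<xi>"
  have "taylor2 (\<lambda>t u. 1 / (((of_real (s n) + 1 - ?B) + ?B * t) * ((of_real (s n) + 1 - ?B) + ?B * u)))"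
  proof (rule taylor2_inverse_prod[OF z(2)])
    fix t :: complex assume "t \<in> cball 1 1"
    from bump_denom(1)[OF z rotate_mem[OF assms(2) this]]
    show "cmod (of_real (s n) + 1 - ?B + ?B * t) \<ge> s n" by (simp add: algebra_simps)
  qed
  from taylor2_cmult[OF this, of "\<beta> n * (cnj (\<zeta> n) * of_real (s n))"]
  have "taylor2 (\<lambda>t u. \<beta> n * bump_dd (\<zeta> n) (s n) (\<xi> * (1 - t)) (\<xi> * (1 - u)))"
    by (rule back_subst[of taylor2]) (auto simp: bump_dd_def fun_eq_iff algebra_simps)
  from taylor2_add[OF Suc.IH this] Suc.prems show ?case by (simp add: dd_sum_def)
qed

text \<open>A minimum of the distance at an interior point is impossible: by the open mapping
  theorem the values of \<open>R\<close> near it include one slightly closer to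
  \<open>w\<close>.\<close>

lemma nearest_boundary_point:
  assumes hol: "R holomorphic_on ball 0 1" and cont: "continuous_on (cball 0 1) R" and inj: "inj_on R (ball 0 1)"
    and w: "w \<notin> R ` cball 0 1"
  obtains \<xi> where "cmod \<xi> = 1" "\<And>z. z \<in> cball 0 1 \<Longrightarrow> cmod (w - R \<xi>) \<le> cmod (w - R z)"
proof -
  have "continuous_on (cball 0 1) (\<lambda>z. cmod (w - R z))" using cont by (intro continuous_intros)
  then obtain \<xi> where x: "\<xi> \<in> cball 0 1" "\<And>z. z \<in> cball 0 1 \<Longrightarrow> cmod (w - R \<xi>) \<le> cmod (w - R z)"
    using continuous_attains_inf[of "cball 0 1" "\<lambda>z. cmod (w - R z)"] by auto
  have "cmod \<xi> = 1"
  proof (rule ccontr)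
    assume "cmod \<xi> \<noteq> 1"
    hence xb: "\<xi> \<in> ball 0 1" using x(1) by auto
    have "open (R ` ball 0 1)" using open_mapping_thm3[OF hol _ inj] by auto
    then obtain e where e: "e > 0" "ball (R \<xi>) e \<subseteq> R ` ball 0 1" using xb by (meson image_eqI open_contains_ball)
    define D where "D = cmod (w - R \<xi>)"
    have D: "D > 0" using w x(1) by (auto simp: D_def)
    define \<eta> where "\<eta> = min 1 (e / (2 * D))"
    have eta: "0 < \<eta>" "\<eta> \<le> 1" "\<eta> * D < e" using D e by (auto simp: \<eta>_def min_def field_simps)
    have "R \<xi> + of_real \<eta> * (w - R \<xi>) \<in> ball (R \<xi>) e"
      using eta by (simp add: dist_norm norm_mult D_def)
    then obtain z where z: "z \<in> ball 0 1" "R z = R \<xi> + of_real \<eta> * (w - R \<xi>)" using e by (metis (no_types) imageE subsetD)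
    have "w - R z = of_real (1 - \<eta>) * (w - R \<xi>)" unfolding z(2) by (simp add: algebra_simps)
    hence "cmod (w - R z) = (1 - \<eta>) * D" using eta by (simp add: norm_mult D_def del: of_real_diff)
    also have "\<dots> < D" using eta D by (simp add: algebra_simps)
    finally show False using x(2)[of z] z(1) by (auto simp: D_def)
  qed
  thus ?thesis using that x(2) by blast
qed

text \<open>The distance to the target drops by \<open>d\<close>, or to 0, and nonvanishing survives
  for all small \<open>s'\<close>, so that the scale can still be chosen later. The comparison with
  \<open>R 0\<close> is recorded because it keeps the attachment point in a bounded region.\<close>

lemma attach_step:
  assumes par: "\<And>k. k < n \<Longrightarrow> cmod (\<zeta> k) = 1 \<and> s k > 0"
    and nz: "\<And>x y. x \<in> cball 0 1 \<Longrightarrow> y \<in> cball 0 1 \<Longrightarrow> dd_sum \<zeta> \<beta> s n x y \<noteq> 0"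
    and d: "d > 0"
  defines "R \<equiv> bump_sum \<zeta> \<beta> s n"
  shows "\<exists>\<xi> b. cmod \<xi> = 1 \<and> cmod b \<le> d \<and>
     (b = 0 \<and> w \<in> R ` cball 0 1 \<or>
      cmod (w - R \<xi>) \<le> cmod (w - R 0) \<and> cmod (w - (R \<xi> + b)) \<le> max 0 (infdist w (R ` cball 0 1) - d)) \<and>
     (\<exists>s0>0. \<forall>s'. 0 < s' \<longrightarrow> s' < s0 \<longrightarrow> (\<forall>x\<in>cball 0 1. \<forall>y\<in>cball 0 1.
         dd_sum \<zeta> \<beta> s n x y + b * bump_dd \<xi> s' x y \<noteq> 0))"
proof (cases "w \<in> R ` cball 0 1")
  case True
  \<comment> \<open>A target already covered calls for no disc: the coefficient is 0, and 1 is an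
    arbitrary point of the circle.\<close>
  thus ?thesis using nz d by (intro exI[of _ 1] exI[of _ 0]) (auto intro: exI[of _ 1])
next
  case False
  have dif: "R x - R y = dd_sum \<zeta> \<beta> s n x y * (x - y)" if "x \<in> cball 0 1" "y \<in> cball 0 1" for x y
    unfolding R_def using bump_sum_diff[OF par that] by simp
  have inj: "inj_on R (cball 0 1)"
  proof (rule inj_onI)
    fix x y assume xy: "x \<in> cball 0 1" "y \<in> cball 0 1" "R x = R y"
    thus "x = y" using dif[OF xy(1,2)] nz[OF xy(1,2)] by simp
  qed
  have cont: "continuous_on (cball 0 1) R" and hol: "R holomorphic_on ball 0 1"
    unfolding R_def using bump_sum_holomorphic[of n \<zeta> s] par by auto
  obtain \<xi> where xi: "cmod \<xi> = 1" "\<And>z. z \<in> cball 0 1 \<Longrightarrow> cmod (w - R \<xi>) \<le> cmod (w - R z)"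
    using nearest_boundary_point[OF hol cont inj_on_subset[OF inj] False] by (metis ball_subset_cball)
  have xib: "\<xi> \<in> cball 0 1" using xi by simp
  define D where "D = cmod (w - R \<xi>)"
  have D: "D > 0" using False xib by (auto simp: D_def)
  have ID: "infdist w (R ` cball 0 1) = D"
  proof (rule antisym)
    show "infdist w (R ` cball 0 1) \<le> D" unfolding D_def dist_norm[symmetric] using xib by (intro infdist_le) auto
    show "D \<le> infdist w (R ` cball 0 1)" unfolding infdist_def using xi(2)
      by (auto simp: D_def dist_norm intro!: cINF_greatest)
  qed
  \<comment> \<open>Capping the length at \<open>D\<close> prevents overshooting
    \<open>w\<close>.\<close>
  define m where "m = min d D"
  have m: "0 < m" "m \<le> d" "m \<le> D" using d D by (auto simp: m_def)
  define b where "b = of_real (m / D) * (w - R \<xi>)"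
  have nb: "cmod b = m" using D m by (simp add: b_def norm_mult norm_divide D_def[symmetric])
  hence b0: "b \<noteq> 0" using m by auto
  have "w - (R \<xi> + b) = of_real (1 - m / D) * (w - R \<xi>)" by (simp add: b_def algebra_simps)
  hence "cmod (w - (R \<xi> + b)) = \<bar>1 - m / D\<bar> * D" by (simp only: norm_mult norm_of_real D_def)
  also have "\<dots> = D - m" using m D by (simp add: abs_if field_simps)
  finally have wb: "cmod (w - (R \<xi> + b)) = D - m" .
  \<comment> \<open>The disc of radius \<open>cmod b\<close> about \<open>R \<xi> + b\<close> lies
    in the disc of radius \<open>D\<close> about \<open>w\<close>, which contains no value of
    \<open>R\<close>. In the coordinate \<open>P\<close> it becomes \<open>ball 1 1\<close>.\<close>
  have out: "cmod (R z - (R \<xi> + b)) \<ge> cmod b" if "z \<in> cball 0 1" for z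
  proof -
    have "D \<le> cmod (w - R z)" using xi(2)[OF that] by (simp add: D_def)
    also have "\<dots> \<le> cmod (w - (R \<xi> + b)) + cmod (R z - (R \<xi> + b))"
      using norm_triangle_ineq4[of "w - (R \<xi> + b)" "R z - (R \<xi> + b)"] by simp
    finally show ?thesis using wb nb by simp
  qed
  define P where "P t = (R (\<xi> * (1 - t)) - R \<xi>) / b" for t
  define M where "M t u = \<xi> / b * dd_sum \<zeta> \<beta> s n (\<xi> * (1 - t)) (\<xi> * (1 - u))" for t u
  note mem = rotate_mem[OF xi(1)]
  have "taylor2 M" unfolding M_def by (intro taylor2_cmult taylor2_dd_sum par xi(1))
  then obtain lamc kap C where tay: "\<And>t u. t\<in>cball 1 1 \<Longrightarrow> u\<in>cball 1 1 \<Longrightarrow>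
     cmod (M t u - (lamc - kap * (t + u))) \<le> C * (cmod t + cmod u)\<^sup>2" unfolding taylor2_def by blast
  \<comment> \<open>Compactness of the closed bidisc turns nonvanishing of the divided difference
    into the lower bound \<open>c\<close>.\<close>
  have "continuous_on (cball 0 1 \<times> cball 0 1) (\<lambda>p. cmod (dd_sum \<zeta> \<beta> s n (fst p) (snd p)))"
    unfolding dd_sum_def using par by (intro continuous_intros continuous_on_bump_dd) auto
  hence "\<exists>p\<in>cball 0 1 \<times> cball 0 1. \<forall>q\<in>cball 0 1 \<times> cball 0 1.
     cmod (dd_sum \<zeta> \<beta> s n (fst p) (snd p)) \<le> cmod (dd_sum \<zeta> \<beta> s n (fst q) (snd q))"
    by (intro continuous_attains_inf compact_Times) auto
  then obtain p where p: "p \<in> cball 0 1 \<times> cball 0 1" "\<And>q. q \<in> cball 0 1 \<times> cball 0 1 \<Longrightarrow>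
     cmod (dd_sum \<zeta> \<beta> s n (fst p) (snd p)) \<le> cmod (dd_sum \<zeta> \<beta> s n (fst q) (snd q))" by blast
  define c where "c = cmod (dd_sum \<zeta> \<beta> s n (fst p) (snd p)) / m"
  have c: "c > 0" using nz[of "fst p" "snd p"] p(1) m by (auto simp: c_def)
  have "\<exists>s0>0. \<forall>s. 0 < s \<longrightarrow> s < s0 \<longrightarrow> (\<forall>t\<in>cball 1 1. \<forall>u\<in>cball 1 1.
           (of_real s + t) * (of_real s + u) * M t u \<noteq> - of_real s)"
  proof (rule attach_nonvanishing[of P M c lamc kap C])
    fix t u :: complex assume t: "t \<in> cball 1 1" and u: "u \<in> cball 1 1"
    have "P t - P u = (R (\<xi> * (1 - t)) - R (\<xi> * (1 - u))) / b" by (simp add: P_def diff_divide_distrib)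
    also have "\<dots> = - M t u * (t - u)" unfolding dif[OF mem[OF t] mem[OF u]] by (simp add: M_def algebra_simps diff_divide_distrib)
    finally show "P t - P u = - M t u * (t - u)" .
    show "cmod (M t u) \<ge> c" using p(2)[of "(\<xi> * (1 - t), \<xi> * (1 - u))"] mem[OF t] mem[OF u] xi(1) m
      by (simp add: M_def c_def norm_mult norm_divide nb divide_right_mono)
  next
    fix t :: complex assume t: "t \<in> cball 1 1"
    have "P t - 1 = (R (\<xi> * (1 - t)) - (R \<xi> + b)) / b" using b0 by (simp add: P_def field_simps)
    thus "cmod (P t - 1) \<ge> 1" using out[OF mem[OF t]] b0 by (simp add: norm_divide)
  qed (use c tay in \<open>auto simp: P_def\<close>)
  then obtain s0 where s0: "s0 > 0" "\<And>s t u. 0 < s \<Longrightarrow> s < s0 \<Longrightarrow> t\<in>cball 1 1 \<Longrightarrow> u\<in>cball 1 1 \<Longrightarrow>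
           (of_real s + t) * (of_real s + u) * M t u \<noteq> - of_real s" by blast
  have xx: "\<xi> * cnj \<xi> = 1" using xi(1) by (simp add: complex_norm_square[symmetric] flip: of_real_power)
  have nz': "dd_sum \<zeta> \<beta> s n x y + b * bump_dd \<xi> s' x y \<noteq> 0"
    if s': "0 < s'" "s' < s0" and x: "x \<in> cball 0 1" and y: "y \<in> cball 0 1" for s' x y
  proof
    assume eq: "dd_sum \<zeta> \<beta> s n x y + b * bump_dd \<xi> s' x y = 0"
    define t u where "t = 1 - cnj \<xi> * x" "u = 1 - cnj \<xi> * y"
    note tu = this
    have mem': "t \<in> cball 1 1" "u \<in> cball 1 1" using x y xi(1) by (auto simp: tu dist_norm norm_mult)
    have xy: "\<xi> * (1 - t) = x" "\<xi> * (1 - u) = y" using xx by (auto simp: tu mult.assoc[symmetric])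
    have T: "of_real s' + t = of_real s' + 1 - cnj \<xi> * x" "of_real s' + u = of_real s' + 1 - cnj \<xi> * y" by (auto simp: tu)
    have T0: "of_real s' + t \<noteq> 0" "of_real s' + u \<noteq> 0" unfolding T
      using bump_denom(4)[OF xi(1) s'(1) x] bump_denom(4)[OF xi(1) s'(1) y] by auto
    have "dd_sum \<zeta> \<beta> s n x y = - b * bump_dd \<xi> s' x y" using eq by (simp add: eq_neg_iff_add_eq_0)
    hence "M t u = \<xi> / b * (- b * bump_dd \<xi> s' x y)" unfolding M_def xy by simp
    also have "\<dots> = - (\<xi> * cnj \<xi>) * of_real s' / ((of_real s' + t) * (of_real s' + u))"
      using b0 by (simp add: bump_dd_def T)
    finally have "(of_real s' + t) * (of_real s' + u) * M t u = - of_real s'" using T0 xx by simp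
    thus False using s0(2)[OF s' mem'] by simp
  qed
  show ?thesis
  proof (rule exI[of _ \<xi>], rule exI[of _ b], intro conjI disjI2)
    show "cmod (w - R \<xi>) \<le> cmod (w - R 0)" using xi(2)[of 0] by simp
    show "cmod (w - (R \<xi> + b)) \<le> max 0 (infdist w (R ` cball 0 1) - d)" unfolding wb ID m_def by simp
    show "cmod b \<le> d" using nb m by simp
    show "\<exists>s0>0. \<forall>s'. 0 < s' \<longrightarrow> s' < s0 \<longrightarrow> (\<forall>x\<in>cball 0 1. \<forall>y\<in>cball 0 1.
         dd_sum \<zeta> \<beta> s n x y + b * bump_dd \<xi> s' x y \<noteq> 0)" using s0(1) nz' by blast
  qed (fact xi(1))
qed

section \<open>The sequence of attachments and its limit\<close>

text \<open>
  \<open>\<Sum>k<n. |\<beta> k| / s k\<close> is a Lipschitz constant of the \<open>n\<close>-th partial sum, which therefore varies by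
  at most \<open>1 / 2 ^ n\<close> over distances up to \<open>rho \<beta> s n\<close>; and if \<open>s n \<le> (rho \<beta> s n)\<^sup>2\<close>, then the \<open>n\<close>-th
  bump is at most \<open>1 / 2 ^ n\<close> at distance at least \<open>rho \<beta> s n\<close> from \<open>\<zeta> n\<close>.
\<close>
definition rho :: "(nat \<Rightarrow> complex) \<Rightarrow> (nat \<Rightarrow> real) \<Rightarrow> nat \<Rightarrow> real" where
  "rho \<beta> s n = (1 / 2 ^ n) / (1 + (\<Sum>k<n. cmod (\<beta> k) / s k))"

text \<open>
  \<open>b * bump \<zeta> s z = c / (1 - cnj a * z)\<close> with \<open>a = pole \<zeta> s\<close> and \<open>c = b * s / (1 + s)\<close>.
\<close>
definition pole :: "complex \<Rightarrow> real \<Rightarrow> complex" where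
  "pole \<zeta> s = \<zeta> / of_real (1 + s)"

text \<open>The pseudohyperbolic distance, whose values are the factors in the Carleson
  product.\<close>

definition pdist :: "complex \<Rightarrow> complex \<Rightarrow> real" where
  "pdist a b = cmod ((a - b) / (1 - a * cnj b))"

text \<open>All requirements on entry \<open>n\<close> refer only to entries below \<open>n\<close>,
  as needed for recursive choice. The empty sum is constant and offers nothing to attach to, so step
  0 is prescribed: \<open>2 * bump 1 1 z = 2 / (2 - z)\<close>. The last two clauses make the new
  bump tiny away from \<open>\<xi>\<close> and its pole nearly orthogonal to the earlier
  ones.\<close>

definition step_ok :: "(nat \<Rightarrow> complex) \<Rightarrow> (nat \<Rightarrow> complex) \<Rightarrow> (nat \<Rightarrow> complex) \<Rightarrow> (nat \<Rightarrow> real) \<Rightarrow> nat \<Rightarrow>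
    complex \<Rightarrow> complex \<Rightarrow> real \<Rightarrow> bool" where
  "step_ok w \<zeta> \<beta> s n \<xi> b \<sigma> \<longleftrightarrow>
     cmod \<xi> = 1 \<and> \<sigma> > 0 \<and>
     (\<forall>x\<in>cball 0 1. \<forall>y\<in>cball 0 1. dd_sum \<zeta> \<beta> s n x y + b * bump_dd \<xi> \<sigma> x y \<noteq> 0) \<and>
     (if n = 0 then \<xi> = 1 \<and> b = 2 \<and> \<sigma> = 1 else
       cmod b \<le> 1 / real (n + 1) \<and>
       (b = 0 \<and> w n \<in> bump_sum \<zeta> \<beta> s n ` cball 0 1 \<or>
         cmod (w n - bump_sum \<zeta> \<beta> s n \<xi>) \<le> cmod (w n - bump_sum \<zeta> \<beta> s n 0) \<and>
         cmod (w n - (bump_sum \<zeta> \<beta> s n \<xi> + b)) \<le> max 0 (infdist (w n) (bump_sum \<zeta> \<beta> s n ` cball 0 1) - 1 / real (n + 1))) \<and>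
       \<sigma> \<le> (rho \<beta> s n)\<^sup>2 \<and>
       (\<forall>k<n. 1 - pdist (pole \<xi> \<sigma>) (pole (\<zeta> k) (s k)) \<le> 1 / 8 ^ n))"

lemma step_ok_cong:
  assumes "\<And>k. k < n \<Longrightarrow> \<zeta> k = \<zeta>' k \<and> \<beta> k = \<beta>' k \<and> s k = s' k"
  shows "step_ok w \<zeta> \<beta> s n \<xi> b \<sigma> = step_ok w \<zeta>' \<beta>' s' n \<xi> b \<sigma>"
proof -
  have "bump_sum \<zeta> \<beta> s n = bump_sum \<zeta>' \<beta>' s' n" "dd_sum \<zeta> \<beta> s n = dd_sum \<zeta>' \<beta>' s' n"
    "rho \<beta> s n = rho \<beta>' s' n"
    using assms by (auto simp: fun_eq_iff bump_sum_def dd_sum_def rho_def)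
  thus ?thesis unfolding step_ok_def using assms by auto
qed

lemma rho_pos:
  assumes "\<And>k. k < n \<Longrightarrow> s k > 0" shows "rho \<beta> s n > 0"
  unfolding rho_def using assms
  by (intro divide_pos_pos add_pos_nonneg sum_nonneg) (auto intro!: divide_nonneg_pos)

lemma norm_pole: "cmod \<zeta> = 1 \<Longrightarrow> s > 0 \<Longrightarrow> cmod (pole \<zeta> s) = 1 / (1 + s)"
  by (simp add: pole_def norm_divide del: of_real_add)

text \<open>As \<open>\<sigma>\<close> tends to 0 the pole tends to the circle, where the
  pseudohyperbolic distance to any interior point is 1.\<close>

lemma pdist_pole_eventually:
  assumes "cmod \<xi> = 1" "cmod a < 1" "e > 0"
  shows "\<forall>\<^sub>F \<sigma> in at_right 0. 1 - pdist (pole \<xi> \<sigma>) a \<le> e"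
proof -
  have nz: "1 - \<xi> * cnj a \<noteq> 0"
  proof
    assume "1 - \<xi> * cnj a = 0"
    hence "cmod (\<xi> * cnj a) = 1" by simp
    thus False using assms by (simp add: norm_mult)
  qed
  have xx: "\<xi> * cnj \<xi> = 1" using assms(1) by (simp add: complex_norm_square[symmetric] flip: of_real_power)
  have "((\<lambda>\<sigma>. pdist (pole \<xi> \<sigma>) a) \<longlongrightarrow> pdist (\<xi> / of_real (1 + 0)) a) (at_right 0)"
    unfolding pdist_def pole_def using nz by (intro tendsto_intros) auto
  also have "pdist (\<xi> / of_real (1 + 0)) a = 1"
  proof -
    have "1 - \<xi> * cnj a = \<xi> * cnj (\<xi> - a)" using xx by (simp add: algebra_simps)
    hence "cmod (1 - \<xi> * cnj a) = cmod (\<xi> - a)" using assms(1) by (simp only: norm_mult complex_mod_cnj)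
    moreover have "cmod (1 - \<xi> * cnj a) \<noteq> 0" using nz by simp
    ultimately show ?thesis by (simp add: pdist_def norm_divide)
  qed
  finally have "\<forall>\<^sub>F \<sigma> in at_right 0. dist (pdist (pole \<xi> \<sigma>) a) 1 < e" using assms(3) by (rule tendstoD)
  thus ?thesis by eventually_elim (auto simp: dist_real_def)
qed

lemma step_exists:
  assumes "\<And>k. k < n \<Longrightarrow> step_ok w \<zeta> \<beta> s k (\<zeta> k) (\<beta> k) (s k)"
  shows "\<exists>\<xi> b \<sigma>. step_ok w \<zeta> \<beta> s n \<xi> b \<sigma>"
proof (cases n)
  case 0
  have "step_ok w \<zeta> \<beta> s n 1 2 1" unfolding step_ok_def
    using bump_denom(4)[of 1 1] by (auto simp: 0 dd_sum_def bump_dd_def)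
  thus ?thesis by blast
next
  case (Suc m)
  have par: "cmod (\<zeta> k) = 1 \<and> s k > 0" if "k < n" for k using assms[OF that] by (simp add: step_ok_def)
  \<comment> \<open>With \<open>n = Suc m\<close>, the sum of the first \<open>n\<close> terms is
    the one certified in step \<open>m\<close>.\<close>
  have nz: "dd_sum \<zeta> \<beta> s n x y \<noteq> 0" if "x \<in> cball 0 1" "y \<in> cball 0 1" for x y
    using assms[of m] that Suc by (simp add: step_ok_def dd_sum_def)
  have d: "1 / real (n + 1) > 0" by simp
  obtain \<xi> b s0 where st: "cmod \<xi> = 1" "cmod b \<le> 1 / real (n + 1)"
     "b = 0 \<and> w n \<in> bump_sum \<zeta> \<beta> s n ` cball 0 1 \<or>
         cmod (w n - bump_sum \<zeta> \<beta> s n \<xi>) \<le> cmod (w n - bump_sum \<zeta> \<beta> s n 0) \<and>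
         cmod (w n - (bump_sum \<zeta> \<beta> s n \<xi> + b)) \<le> max 0 (infdist (w n) (bump_sum \<zeta> \<beta> s n ` cball 0 1) - 1 / real (n + 1))"
    and s0: "s0 > 0" "\<forall>s'. 0 < s' \<longrightarrow> s' < s0 \<longrightarrow> (\<forall>x\<in>cball 0 1. \<forall>y\<in>cball 0 1.
         dd_sum \<zeta> \<beta> s n x y + b * bump_dd \<xi> s' x y \<noteq> 0)"
  proof (rule exE[OF attach_step[of n \<zeta> s \<beta> "1 / real (n + 1)" "w n", OF par nz d]])
  qed (assumption | elim exE conjE, rule that)+
  \<comment> \<open>Every condition on \<open>\<sigma>\<close> holds for all sufficiently small
    positive values, so the conditions can be met together.\<close>
  have "\<forall>\<^sub>F \<sigma> in at_right 0. \<forall>k\<in>{..<n}. 1 - pdist (pole \<xi> \<sigma>) (pole (\<zeta> k) (s k)) \<le> 1 / 8 ^ n"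
  proof (intro eventually_ball_finite ballI pdist_pole_eventually st(1))
    fix k assume "k \<in> {..<n}"
    thus "cmod (pole (\<zeta> k) (s k)) < 1" using par[of k] norm_pole[of "\<zeta> k" "s k"] by auto
  qed auto
  moreover have "\<forall>\<^sub>F \<sigma> in at_right 0. \<sigma> \<in> {0<..<min s0 ((rho \<beta> s n)\<^sup>2)}"
    using rho_pos[of n s \<beta>] par s0(1) by (intro eventually_at_right_real) (auto simp: zero_less_power)
  ultimately have "\<forall>\<^sub>F \<sigma> in at_right 0. step_ok w \<zeta> \<beta> s n \<xi> b \<sigma>"
  proof eventually_elim
    case (elim \<sigma>)
    thus ?case using st s0(2) Suc unfolding step_ok_def by simp
  qed
  hence "\<exists>\<sigma>. step_ok w \<zeta> \<beta> s n \<xi> b \<sigma>" using eventually_happens' trivial_limit_at_right_real by blast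
  thus ?thesis by blast
qed

lemma sequence_exists:
  obtains \<zeta> \<beta> :: "nat \<Rightarrow> complex" and s :: "nat \<Rightarrow> real"
  where "\<And>n. step_ok w \<zeta> \<beta> s n (\<zeta> n) (\<beta> n) (s n)"
proof -
  let ?P = "\<lambda>f n r. step_ok w (\<lambda>k. fst (f k)) (\<lambda>k. fst (snd (f k))) (\<lambda>k. snd (snd (f k))) n (fst r) (fst (snd r)) (snd (snd r))"
  have "\<exists>f. \<forall>n. ?P f n (f n)"
  proof (rule dependent_wf_choice[of "less_than"])
    show "wf less_than" by simp
  next
    fix f g :: "nat \<Rightarrow> complex \<times> complex \<times> real" and n r
    assume "\<And>k. (k, n) \<in> less_than \<Longrightarrow> f k = g k"
    thus "?P f n r = ?P g n r" by (intro step_ok_cong) auto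
  next
    fix n and f :: "nat \<Rightarrow> complex \<times> complex \<times> real"
    assume *: "\<And>k. (k, n) \<in> less_than \<Longrightarrow> ?P f k (f k)"
    obtain \<xi> b \<sigma> where "step_ok w (\<lambda>k. fst (f k)) (\<lambda>k. fst (snd (f k))) (\<lambda>k. snd (snd (f k))) n \<xi> b \<sigma>"
      using step_exists[of n w "\<lambda>k. fst (f k)" "\<lambda>k. fst (snd (f k))" "\<lambda>k. snd (snd (f k))"] * by auto
    thus "\<exists>r. ?P f n r" by (intro exI[of _ "(\<xi>, b, \<sigma>)"]) simp
  qed
  then obtain f where "\<And>n. ?P f n (f n)" by blast
  thus ?thesis using that by blast
qed

text \<open>The limit is the pointwise \<open>lim\<close>, which does not refer to \<open>X\<close>.
  Limits on compact subsets of the disc and on Stolz regions with their vertex are thus values of a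
  single function.\<close>

lemma uniform_limit_telescope:
  fixes F :: "nat \<Rightarrow> 'a \<Rightarrow> complex"
  assumes bd: "\<And>n z. n \<ge> n0 \<Longrightarrow> z \<in> X \<Longrightarrow> cmod (F (Suc n) z - F n z) \<le> g n" and g: "summable g"
  shows "uniform_limit X F (\<lambda>z. lim (\<lambda>n. F n z)) sequentially"
proof -
  have "uniform_limit X (\<lambda>n z. \<Sum>i<n. F (Suc i) z - F i z) (\<lambda>z. \<Sum>i. F (Suc i) z - F i z) sequentially"
    using bd by (intro Weierstrass_m_test_ev[OF _ g]) (auto simp: eventually_at_top_linorder)
  moreover have "uniform_limit X (\<lambda>n. F 0) (F 0) sequentially" by (rule uniform_limit_const)
  ultimately have "uniform_limit X (\<lambda>n z. (\<Sum>i<n. F (Suc i) z - F i z) + F 0 z)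
      (\<lambda>z. (\<Sum>i. F (Suc i) z - F i z) + F 0 z) sequentially" by (rule uniform_limit_add)
  also have "(\<lambda>n z. (\<Sum>i<n. F (Suc i) z - F i z) + F 0 z) = F"
    using sum_lessThan_telescope[of "\<lambda>i. F i _"] by (simp add: fun_eq_iff)
  finally have *: "uniform_limit X F (\<lambda>z. (\<Sum>i. F (Suc i) z - F i z) + F 0 z) sequentially" .
  have "(\<Sum>i. F (Suc i) z - F i z) + F 0 z = lim (\<lambda>n. F n z)" if "z \<in> X" for z
    using tendsto_uniform_limitI[OF * that] by (simp add: limI)
  thus ?thesis using * by (subst uniform_limit_cong'[OF refl]) (auto intro: sym)
qed

text \<open>The selected \<open>n + 1\<close> are the numbers \<open>2 ^ J * (2 * i + 1)\<close>, an
  arithmetic progression. Each target therefore receives steps of infinite total length.\<close>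

lemma not_summable_multiplicity_harmonic:
  "\<not> summable (\<lambda>n. if multiplicity 2 (n + 1) = J then 1 / real (n + 1) else 0)"
proof
  let ?h = "\<lambda>n. if multiplicity 2 (n + 1) = J then 1 / real (n + 1) else 0"
  define \<phi> where "\<phi> i = 2 ^ J * (2 * i + 1) - (1::nat)" for i
  have phi: "\<phi> i + 1 = 2 ^ J * (2 * i + 1)" for i by (simp add: \<phi>_def)
  assume "summable ?h"
  moreover have "inj \<phi>"
  proof (rule injI)
    fix i j assume "\<phi> i = \<phi> j"
    hence "2 ^ J * (2 * i + 1) = 2 ^ J * (2 * j + 1)" using phi by metis
    thus "i = j" by simp
  qed
  ultimately have "summable (?h \<circ> \<phi>)" by (intro summable_reindex) auto
  also have "?h \<circ> \<phi> = (\<lambda>i. 1 / (2 ^ J * real (2 * i + 1)))"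
  proof
    fix i :: nat
    have "multiplicity 2 (2 ^ J * (2 * i + 1)) = J"
    proof (rule multiplicity_eqI)
      show "\<not> 2 ^ Suc J dvd 2 ^ J * (2 * i + 1)"
        unfolding power_Suc2 by (subst dvd_times_left_cancel_iff) auto
    qed auto
    thus "(?h \<circ> \<phi>) i = 1 / (2 ^ J * real (2 * i + 1))" unfolding comp_def phi by (simp add: algebra_simps)
  qed
  finally have A: "summable (\<lambda>i. 2 ^ J * 2 * (1 / (2 ^ J * real (2 * i + 1))))" by (rule summable_mult)
  have B: "inverse (real (Suc i)) \<le> 2 ^ J * 2 * (1 / (2 ^ J * real (2 * i + 1)))" for i
  proof -
    have "inverse (real (Suc i)) \<le> 2 / real (2 * i + 1)" by (simp add: field_simps)
    also have "\<dots> = 2 ^ J * 2 * (1 / (2 ^ J * real (2 * i + 1)))" by simp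
    finally show ?thesis .
  qed
  have "summable (\<lambda>i. inverse (real (Suc i)))"
  proof (rule summable_comparison_test'[OF A, of 0])
    fix i
    have "norm (inverse (real (Suc i))) = inverse (real (Suc i))" by simp
    thus "norm (inverse (real (Suc i))) \<le> 2 ^ J * 2 * (1 / (2 ^ J * real (2 * i + 1)))" using B[of i] by (simp only:)
  qed
  hence "summable (\<lambda>i. inverse (real i))" by (rule iffD1[OF summable_Suc_iff])
  thus False using not_summable_harmonic[where 'a = real] by simp
qed

text \<open>If \<open>x\<close> stayed above \<open>e\<close>, each distinguished step would lower
  it by a full \<open>1 / (n + 1)\<close> up to a summable error. Telescoping against
  \<open>x \<ge> 0\<close> would make a divergent series converge.\<close>

lemma recurrent_decrease:
  fixes x :: "nat \<Rightarrow> real"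
  assumes pos: "\<And>n. x n \<ge> 0"
    and up: "\<And>n. n \<ge> 1 \<Longrightarrow> x (Suc n) \<le> x n + 2 / 2 ^ n"
    and down: "\<And>n. n \<ge> 1 \<Longrightarrow> multiplicity 2 (n + 1) = J \<Longrightarrow> x (Suc n) \<le> max 0 (x n - 1 / real (n + 1)) + 2 / 2 ^ n"
    and e: "e > 0"
  shows "\<exists>n\<ge>N. x n < e"
proof (rule ccontr)
  assume "\<not> ?thesis"
  hence ge: "x n \<ge> e" if "n \<ge> N" for n using that by force
  define h where "h n = (if multiplicity 2 (n + 1) = J then 1 / real (n + 1) else 0)" for n
  have "(\<lambda>n. 2 / 2 ^ n :: real) \<longlonglongrightarrow> 0" by real_asymp
  from order_tendstoD(2)[OF this e] obtain N' where N': "\<And>n. n \<ge> N' \<Longrightarrow> (2 / 2 ^ n :: real) < e"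
    unfolding eventually_at_top_linorder by blast
  \<comment> \<open>Beyond \<open>M\<close> the case in which the maximum is 0 cannot occur: it
    would give \<open>x (Suc n) \<le> 2 / 2 ^ n < e\<close>.\<close>
  define M where "M = max (max N N') 1"
  have hle: "h n \<le> x n - x (Suc n) + 2 / 2 ^ n" if "n \<ge> M" for n
  proof -
    have n: "n \<ge> N" "n \<ge> N'" "n \<ge> 1" using that by (auto simp: M_def)
    have "x (Suc n) \<ge> e" using ge[of "Suc n"] n by auto
    thus ?thesis using up[OF n(3)] down[OF n(3)] N'[OF n(2)] by (auto simp: h_def max_def split: if_splits)
  qed
  have "summable (\<lambda>n. h (n + M))"
  proof (rule summableI_nonneg_bounded)
    show "h (n + M) \<ge> 0" for n by (simp add: h_def)
    fix n
    have "(\<Sum>i<n. h (i + M)) \<le> (\<Sum>i<n. x (i + M) - x (Suc i + M) + 2 / 2 ^ i)"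
    proof (rule sum_mono)
      fix i
      have "(2::real) / 2 ^ (i + M) \<le> 2 / 2 ^ i" by (intro divide_left_mono power_increasing) auto
      thus "h (i + M) \<le> x (i + M) - x (Suc i + M) + 2 / 2 ^ i" using hle[of "i + M"] by simp
    qed
    also have "\<dots> = (x (0 + M) - x (n + M)) + (\<Sum>i<n. 2 / 2 ^ i)"
      using sum_lessThan_telescope'[of "\<lambda>i. x (i + M)" n] by (simp add: sum.distrib)
    also have "(\<Sum>i<n. 2 / 2 ^ i :: real) = 2 * (\<Sum>i<n. (1/2) ^ i)" by (simp add: sum_distrib_left power_divide)
    also have "(\<Sum>i<n. (1/2) ^ i :: real) \<le> 2" using geometric_sum[of "1/2::real" n] by simp
    finally show "(\<Sum>i<n. h (i + M)) \<le> x M + 4" using pos[of "n + M"] by simp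
  qed
  hence "summable h" by (simp only: summable_iff_shift)
  thus False using not_summable_multiplicity_harmonic[of J] by (simp add: h_def[abs_def])
qed

section \<open>Estimates for the partial sums and convergence in the open disc\<close>

locale bump_chain =
  fixes w \<zeta> \<beta> :: "nat \<Rightarrow> complex" and s :: "nat \<Rightarrow> real"
  assumes step: "step_ok w \<zeta> \<beta> s n (\<zeta> n) (\<beta> n) (s n)"
begin

abbreviation "R \<equiv> bump_sum \<zeta> \<beta> s"
abbreviation "K n \<equiv> R n ` cball 0 1"
abbreviation "r \<equiv> rho \<beta> s"
abbreviation "bp n \<equiv> bump (\<zeta> n) (s n)"

lemma par: "cmod (\<zeta> n) = 1" "s n > 0"
  using step[of n] by (auto simp: step_ok_def)

lemma init: "\<zeta> 0 = 1" "\<beta> 0 = 2" "s 0 = 1"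
  using step[of 0] by (auto simp: step_ok_def)

lemma beta_le: "n \<ge> 1 \<Longrightarrow> cmod (\<beta> n) \<le> 1 / real (n + 1)"
  using step[of n] by (auto simp: step_ok_def)

lemma beta_le1: "n \<ge> 1 \<Longrightarrow> cmod (\<beta> n) \<le> 1"
  using beta_le[of n] by (rule order_trans) auto

lemma beta_le2: "cmod (\<beta> n) \<le> 2"
  using beta_le1[of n] init by (cases "n = 0") auto

lemma dd_nz: "x \<in> cball 0 1 \<Longrightarrow> y \<in> cball 0 1 \<Longrightarrow> dd_sum \<zeta> \<beta> s (Suc n) x y \<noteq> 0"
  using step[of n] by (auto simp: step_ok_def dd_sum_def)

lemma R_Suc: "R (Suc n) z = R n z + \<beta> n * bp n z"
  by (simp add: bump_sum_def)

lemma R_diff: "x \<in> cball 0 1 \<Longrightarrow> y \<in> cball 0 1 \<Longrightarrow> R n x - R n y = dd_sum \<zeta> \<beta> s n x y * (x - y)"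
  by (intro bump_sum_diff) (auto simp: par)

lemma R_inj: "inj_on (R (Suc n)) (cball 0 1)"
proof (rule inj_onI)
  fix x y assume xy: "x \<in> cball 0 1" "y \<in> cball 0 1" "R (Suc n) x = R (Suc n) y"
  thus "x = y" using R_diff[OF xy(1,2), of "Suc n"] dd_nz[OF xy(1,2)] by simp
qed

lemma R_hol: "R n holomorphic_on ball 0 1" and R_cont: "continuous_on (cball 0 1) (R n)"
  by (intro bump_sum_holomorphic; simp add: par)+

lemma L_nonneg: "(\<Sum>k<n. cmod (\<beta> k) / s k) \<ge> 0"
  using par by (intro sum_nonneg divide_nonneg_pos) auto

lemma r_pos: "r n > 0" by (rule rho_pos) (auto simp: par)

lemma r_le: "r n \<le> 1 / 2 ^ n"
  unfolding rho_def using L_nonneg[of n] by (simp add: divide_le_eq)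

lemma r_antimono: "m \<le> n \<Longrightarrow> r n \<le> r m"
proof -
  assume "m \<le> n"
  have "(\<Sum>k<m. cmod (\<beta> k) / s k) \<le> (\<Sum>k<n. cmod (\<beta> k) / s k)"
    using par \<open>m \<le> n\<close> by (intro sum_mono2) (auto intro!: divide_nonneg_pos)
  thus ?thesis unfolding rho_def using L_nonneg[of m] \<open>m \<le> n\<close>
    by (intro frac_le divide_left_mono power_increasing) auto
qed

lemma s_le: "n \<ge> 1 \<Longrightarrow> s n \<le> (r n)\<^sup>2"
  using step[of n] by (auto simp: step_ok_def)

lemma s_le4: "s n \<le> 1 / 4 ^ n"
proof (cases "n = 0")
  case False
  hence "s n \<le> (r n)\<^sup>2" by (intro s_le) auto
  also have "\<dots> \<le> (1 / 2 ^ n)\<^sup>2" using r_le[of n] r_pos[of n] by (intro power_mono) auto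
  also have "\<dots> = 1 / 4 ^ n" using power_mult[of "2::real" n 2] power_mult[of "2::real" 2 n] by (simp add: power_divide mult.commute)
  finally show ?thesis .
qed (use init in auto)

lemma bp_le: "z \<in> cball 0 1 \<Longrightarrow> c > 0 \<Longrightarrow> c \<le> cmod (of_real (s n) + 1 - cnj (\<zeta> n) * z) \<Longrightarrow> cmod (bp n z) \<le> s n / c"
  using par[of n] bump_denom(4)[OF par(1) par(2), of z]
  by (auto simp: bump_def norm_divide intro!: divide_left_mono mult_pos_pos)

lemma bp_small: "n \<ge> 1 \<Longrightarrow> z \<in> cball 0 1 \<Longrightarrow> cmod (z - \<zeta> n) \<ge> r n \<or> cmod z \<le> 1 - r n \<Longrightarrow> cmod (bp n z) \<le> 1 / 2 ^ n"
proof -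
  assume n: "n \<ge> 1" and z: "z \<in> cball 0 1" and d: "cmod (z - \<zeta> n) \<ge> r n \<or> cmod z \<le> 1 - r n"
  have "cmod (bp n z) \<le> s n / r n"
    using d bump_denom(2,3)[OF par(1)[of n] par(2)[of n] z] r_pos[of n] by (intro bp_le z) linarith+
  also have "\<dots> \<le> (r n)\<^sup>2 / r n" using s_le[OF n] r_pos[of n] by (intro divide_right_mono) auto
  also have "\<dots> = r n" using r_pos[of n] by (simp add: power2_eq_square)
  finally show ?thesis using r_le[of n] by simp
qed

lemma R_step_small: "n \<ge> 1 \<Longrightarrow> z \<in> cball 0 1 \<Longrightarrow> cmod (z - \<zeta> n) \<ge> r n \<or> cmod z \<le> 1 - r n \<Longrightarrow> cmod (R (Suc n) z - R n z) \<le> 1 / 2 ^ n"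
proof -
  assume a: "n \<ge> 1" "z \<in> cball 0 1" "cmod (z - \<zeta> n) \<ge> r n \<or> cmod z \<le> 1 - r n"
  have "cmod (\<beta> n) * cmod (bp n z) \<le> 1 * (1 / 2 ^ n)"
    using bp_small[OF a] beta_le1[OF a(1)] by (intro mult_mono) auto
  thus ?thesis by (simp add: R_Suc norm_mult)
qed

lemma R_lip: "x \<in> cball 0 1 \<Longrightarrow> y \<in> cball 0 1 \<Longrightarrow> cmod (x - y) \<le> r n \<Longrightarrow> cmod (R n x - R n y) \<le> 1 / 2 ^ n"
proof -
  assume a: "x \<in> cball 0 1" "y \<in> cball 0 1" "cmod (x - y) \<le> r n"
  define L where "L = (\<Sum>k<n. cmod (\<beta> k) / s k)"
  have L: "L \<ge> 0" using L_nonneg by (simp add: L_def)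
  have "cmod (dd_sum \<zeta> \<beta> s n x y) \<le> L" unfolding L_def using a par by (intro dd_sum_bound) auto
  hence "cmod (R n x - R n y) \<le> L * r n" unfolding R_diff[OF a(1,2)] norm_mult using a(3) L
    by (intro mult_mono) auto
  also have "\<dots> = (L / (1 + L)) * (1 / 2 ^ n)" by (simp add: rho_def L_def)
  also have "\<dots> \<le> 1 * (1 / 2 ^ n)" using L by (intro mult_right_mono) auto
  finally show ?thesis by simp
qed

lemma mem_cball_r: "cmod z \<le> 1 - r n \<Longrightarrow> z \<in> cball 0 1"
  using r_pos[of n] by simp

lemma shrink: "z \<in> cball 0 1 \<Longrightarrow> of_real (1 - r n) * z \<in> cball 0 (1 - r n)" "z \<in> cball 0 1 \<Longrightarrow> cmod (z - of_real (1 - r n) * z) \<le> r n"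
proof -
  assume z: "z \<in> cball 0 1"
  have r: "0 < r n" "r n \<le> 1" using r_pos[of n] r_le[of n] by (auto intro: order_trans)
  show "of_real (1 - r n) * z \<in> cball 0 (1 - r n)"
    using z r by (simp add: norm_mult mult_left_le del: of_real_diff)
  have "z - of_real (1 - r n) * z = of_real (r n) * z" by (simp add: algebra_simps)
  thus "cmod (z - of_real (1 - r n) * z) \<le> r n" using z r by (simp add: norm_mult mult_left_le)
qed

text \<open>Radial contraction by \<open>1 - r n\<close> costs only \<open>1 / 2 ^ n\<close> by the
  Lipschitz bound, and lands where the new term and all later ones are negligible.\<close>

lemma R_approx: "n \<ge> 1 \<Longrightarrow> z \<in> cball 0 1 \<Longrightarrow> \<exists>z'\<in>cball 0 (1 - r n). cmod (R n z' - R n z) \<le> 1 / 2 ^ n"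
proof -
  assume n: "n \<ge> 1" and z: "z \<in> cball 0 1"
  have "of_real (1 - r n) * z \<in> cball 0 1" using shrink(1)[OF z, of n] mem_cball_r by auto
  from R_lip[OF z this shrink(2)[OF z]] show ?thesis
    using shrink(1)[OF z] by (intro bexI[of _ "of_real (1 - r n) * z"]) (auto simp: norm_minus_commute)
qed

lemma K_props: "compact (K n)" "closed (K n)" "K n \<noteq> {}"
  using compact_continuous_image[OF R_cont compact_cball, of n] by (auto intro: compact_imp_closed)

text \<open>The images \<open>K n\<close> need not increase, since values near
  \<open>\<zeta> n\<close> are displaced by the new term. One error \<open>1 / 2 ^ n\<close> pays
  for contracting the argument, the other for the new term there.\<close>

lemma infdist_up: "n \<ge> 1 \<Longrightarrow> infdist p (K (Suc n)) \<le> infdist p (K n) + 2 / 2 ^ n"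
proof -
  assume n: "n \<ge> 1"
  obtain y where "y \<in> K n" "infdist p (K n) = dist p y" using infdist_attains_inf[OF K_props(2,3)] by blast
  then obtain z where z: "z \<in> cball 0 1" "infdist p (K n) = dist p (R n z)" by blast
  obtain z' where z': "z' \<in> cball 0 (1 - r n)" "cmod (R n z' - R n z) \<le> 1 / 2 ^ n" using R_approx[OF n z(1)] by blast
  have zc: "z' \<in> cball 0 1" using z'(1) mem_cball_r by auto
  have "infdist p (K (Suc n)) \<le> dist p (R (Suc n) z')" using zc by (intro infdist_le) auto
  also have "\<dots> \<le> dist p (R n z) + dist (R n z) (R (Suc n) z')" by (rule dist_triangle)
  also have "dist (R n z) (R (Suc n) z') \<le> dist (R n z) (R n z') + dist (R n z') (R (Suc n) z')" by (rule dist_triangle)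
  also have "dist (R n z) (R n z') \<le> 1 / 2 ^ n" using z'(2) by (simp add: dist_norm norm_minus_commute)
  also have "dist (R n z') (R (Suc n) z') \<le> 1 / 2 ^ n" using R_step_small[OF n zc] z'(1) by (simp add: dist_norm norm_minus_commute)
  finally show ?thesis using z(2) by simp
qed

text \<open>The bump equals 1 at \<open>\<zeta> n\<close>, so the tip
  \<open>R n (\<zeta> n) + \<beta> n\<close> of the attached disc is a value of the next
  sum.\<close>

lemma infdist_down: "n \<ge> 1 \<Longrightarrow> infdist (w n) (K (Suc n)) \<le> max 0 (infdist (w n) (K n) - 1 / real (n + 1)) + 2 / 2 ^ n"
proof -
  assume n: "n \<ge> 1"
  have "w n \<in> K n \<or> cmod (w n - (R n (\<zeta> n) + \<beta> n)) \<le> max 0 (infdist (w n) (K n) - 1 / real (n + 1))"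
    using step[of n] n by (auto simp: step_ok_def)
  thus ?thesis
  proof
    assume "w n \<in> K n"
    thus ?thesis using infdist_up[OF n, of "w n"] by (auto simp: max_def)
  next
    assume *: "cmod (w n - (R n (\<zeta> n) + \<beta> n)) \<le> max 0 (infdist (w n) (K n) - 1 / real (n + 1))"
    have "\<zeta> n * cnj (\<zeta> n) = 1" using par by (simp add: complex_norm_square[symmetric] flip: of_real_power)
    hence "R (Suc n) (\<zeta> n) = R n (\<zeta> n) + \<beta> n" using par(2)[of n] by (simp add: R_Suc bump_def mult.commute)
    moreover have "R (Suc n) (\<zeta> n) \<in> K (Suc n)" using par(1)[of n] by (intro imageI) simp
    ultimately have "R n (\<zeta> n) + \<beta> n \<in> K (Suc n)" by simp
    hence "infdist (w n) (K (Suc n)) \<le> dist (w n) (R n (\<zeta> n) + \<beta> n)" by (rule infdist_le)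
    also have "\<dots> \<le> max 0 (infdist (w n) (K n) - 1 / real (n + 1))" using * by (simp add: dist_norm)
    finally show ?thesis by (simp add: add_increasing2)
  qed
qed

text \<open>The pointwise limit also supplies values at those points of the unit circle where the
  sums converge; almost everywhere these turn out to be the angular limits.\<close>

definition f :: "complex \<Rightarrow> complex" where "f z = lim (\<lambda>n. R n z)"

lemma summable_half: "summable (\<lambda>n. 1 / 2 ^ n :: real)"
  using summable_geometric[of "1/2::real"] by (simp add: power_divide)

lemma f_uniform: "m \<ge> 1 \<Longrightarrow> uniform_limit (cball 0 (1 - r m)) R f sequentially"
  unfolding f_def
proof (rule uniform_limit_telescope[OF _ summable_half])
  fix n and z :: complex assume "m \<ge> 1" "n \<ge> m" "z \<in> cball 0 (1 - r m)"
  thus "cmod (R (Suc n) z - R n z) \<le> 1 / 2 ^ n" using r_antimono[of m n] mem_cball_r[of z m]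
    by (intro R_step_small) auto
qed

lemma f_close: "m \<ge> 1 \<Longrightarrow> z \<in> cball 0 (1 - r m) \<Longrightarrow> cmod (f z - R m z) \<le> 2 / 2 ^ m"
proof -
  assume m: "m \<ge> 1" and z: "z \<in> cball 0 (1 - r m)"
  have lim: "(\<lambda>n. R n z) \<longlonglongrightarrow> f z" using tendsto_uniform_limitI[OF f_uniform[OF m] z] .
  have part: "cmod (R n z - R m z) \<le> 2 / 2 ^ m - 2 / 2 ^ n" if "n \<ge> m" for n
    using that
  proof (induction n rule: dec_induct)
    case (step n)
    have "cmod (R (Suc n) z - R n z) \<le> 1 / 2 ^ n" using r_antimono[of m n] step m z mem_cball_r[of z m]
      by (intro R_step_small) auto
    moreover have "cmod (R (Suc n) z - R m z) \<le> cmod (R (Suc n) z - R n z) + cmod (R n z - R m z)"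
      using norm_triangle_ineq[of "R (Suc n) z - R n z" "R n z - R m z"] by simp
    moreover have "(2::real) / 2 ^ Suc n = 1 / 2 ^ n" "(2::real) / 2 ^ n = 1 / 2 ^ n + 1 / 2 ^ n" by simp_all
    ultimately show ?case using step.IH by linarith
  qed simp
  show ?thesis
  proof (rule tendsto_upperbound)
    show "(\<lambda>n. cmod (R n z - R m z)) \<longlonglongrightarrow> cmod (f z - R m z)" by (intro tendsto_intros lim)
    show "\<forall>\<^sub>F n in sequentially. cmod (R n z - R m z) \<le> 2 / 2 ^ m"
      unfolding eventually_at_top_linorder
    proof (intro exI[of _ m] allI impI)
      fix n assume "n \<ge> m"
      moreover have "(0::real) \<le> 2 / 2 ^ n" by simp
      ultimately show "cmod (R n z - R m z) \<le> 2 / 2 ^ m" using part[of n] by linarith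
    qed
  qed auto
qed

lemma compact_exhaust:
  fixes C :: "complex set"
  shows "compact C \<Longrightarrow> C \<subseteq> ball 0 1 \<Longrightarrow> \<exists>m\<ge>N. m \<ge> 1 \<and> C \<subseteq> cball 0 (1 - r m)"
proof -
  assume C: "compact C" "C \<subseteq> ball 0 1"
  have "\<exists>b<1. C \<subseteq> cball 0 b"
  proof (cases "C = {}")
    case False
    have "continuous_on C cmod" by (intro continuous_intros)
    from continuous_attains_sup[OF C(1) False this] obtain x where "x \<in> C" "\<And>y. y \<in> C \<Longrightarrow> cmod y \<le> cmod x" by blast
    thus ?thesis using C(2) by (intro exI[of _ "cmod x"]) auto
  qed (auto intro: exI[of _ 0])
  then obtain b where b: "b < 1" "C \<subseteq> cball 0 b" by blast
  have "(\<lambda>n. 1 / 2 ^ n :: real) \<longlonglongrightarrow> 0" by real_asymp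
  from order_tendstoD(2)[OF this, of "1 - b"] b(1)
  obtain M where M: "\<And>n. n \<ge> M \<Longrightarrow> (1 / 2 ^ n :: real) < 1 - b"
    unfolding eventually_at_top_linorder by auto
  have mm: "M \<le> max (max M N) 1" by simp
  have "r (max (max M N) 1) < 1 - b" using r_le[of "max (max M N) 1"] M[OF mm] by linarith
  thus ?thesis using b(2) by (intro exI[of _ "max (max M N) 1"]) auto
qed

lemma ball_exhaust:
  fixes z :: complex
  shows "z \<in> ball 0 1 \<Longrightarrow> \<exists>m\<ge>N. m \<ge> 1 \<and> z \<in> cball 0 (1 - r m)"
  using compact_exhaust[of "{z}" N] by auto

lemma f_uniform_compact:
  assumes "compact C" "C \<subseteq> ball 0 1" shows "uniform_limit C R f sequentially"
proof -
  obtain m where m: "m \<ge> 1" "C \<subseteq> cball 0 (1 - r m)" using compact_exhaust[OF assms, of 0] by blast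
  show ?thesis by (rule uniform_limit_on_subset[OF f_uniform[OF m(1)] m(2)])
qed

lemma f_hol: "f holomorphic_on ball 0 1"
proof (rule holomorphic_uniform_sequence[OF _ R_hol])
  fix x :: complex assume "x \<in> ball 0 1"
  then obtain d where "d > 0" "cball x d \<subseteq> ball 0 1" using open_contains_cball[of "ball (0::complex) 1"] by blast
  thus "\<exists>d>0. cball x d \<subseteq> ball 0 1 \<and> uniform_limit (cball x d) R f sequentially"
    using f_uniform_compact[OF compact_cball] by (intro exI[of _ d] conjI)
qed auto

end

section \<open>Density and area of the image\<close>

text \<open>Mere recurrence of a target would not suffice, since the step lengths tend to 0. The
  exponent of 2 in \<open>n + 1\<close> selects each \<open>q J\<close> along an arithmetic
  progression.\<close>

locale bump_filling = bump_chain +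
  fixes q :: "nat \<Rightarrow> complex"
  assumes w_q: "w n = q (multiplicity 2 (n + 1))"
    and q_range: "range q \<subseteq> cball 0 10"
    and q_dense: "cball 0 10 \<subseteq> closure (range q)"
begin

abbreviation "G \<equiv> f ` ball 0 1"

lemma target_in_closure: "q J \<in> closure G"
  unfolding closure_approachable
proof (intro allI impI)
  fix e :: real assume e: "e > 0"
  \<comment> \<open>The 3 is 1 for contracting the argument plus 2 for passing from
    \<open>R n\<close> to \<open>f\<close>.\<close>
  have "(\<lambda>n. 3 / 2 ^ n :: real) \<longlonglongrightarrow> 0" by real_asymp
  from order_tendstoD(2)[OF this, of "e / 2"] e
  obtain M where M: "\<And>n. n \<ge> M \<Longrightarrow> (3 / 2 ^ n :: real) < e / 2"
    unfolding eventually_at_top_linorder by auto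
  have "\<exists>n\<ge>max M 1. infdist (q J) (K n) < e / 2"
  proof (rule recurrent_decrease[where J = J])
    fix n :: nat assume n: "n \<ge> 1"
    show "infdist (q J) (K (Suc n)) \<le> infdist (q J) (K n) + 2 / 2 ^ n" by (rule infdist_up[OF n])
    assume "multiplicity 2 (n + 1) = J"
    thus "infdist (q J) (K (Suc n)) \<le> max 0 (infdist (q J) (K n) - 1 / real (n + 1)) + 2 / 2 ^ n"
      using infdist_down[OF n] w_q[of n] by simp
  qed (use e in \<open>auto simp: infdist_nonneg\<close>)
  then obtain n where n: "n \<ge> M" "n \<ge> 1" "infdist (q J) (K n) < e / 2" by auto
  obtain y where "y \<in> K n" "infdist (q J) (K n) = dist (q J) y" using infdist_attains_inf[OF K_props(2,3)] by blast
  then obtain z where z: "z \<in> cball 0 1" "dist (q J) (R n z) < e / 2" using n(3) by auto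
  obtain z' where z': "z' \<in> cball 0 (1 - r n)" "cmod (R n z' - R n z) \<le> 1 / 2 ^ n" using R_approx[OF n(2) z(1)] by blast
  have "dist (f z') (q J) \<le> dist (f z') (R n z') + dist (R n z') (R n z) + dist (R n z) (q J)"
    using dist_triangle[of "f z'" "q J" "R n z'"] dist_triangle[of "R n z'" "q J" "R n z"] by linarith
  also have "dist (f z') (R n z') \<le> 2 / 2 ^ n" using f_close[OF n(2) z'(1)] by (simp add: dist_norm)
  also have "dist (R n z') (R n z) \<le> 1 / 2 ^ n" using z'(2) by (simp add: dist_norm)
  finally have "dist (f z') (q J) < e" using M[OF n(1)] z(2) by (simp add: dist_commute)
  moreover have "z' \<in> ball 0 1" using z'(1) r_pos[of n] by simp
  ultimately show "\<exists>y\<in>G. dist y (q J) < e" by blast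
qed

lemma cball_subset_closure: "cball 0 10 \<subseteq> closure G"
proof -
  have "range q \<subseteq> closure G" using target_in_closure by auto
  hence "closure (range q) \<subseteq> closure G" by (rule closure_minimal) simp
  thus ?thesis using q_dense by blast
qed

text \<open>Hurwitz's theorem allows a constant limit; density of the image excludes it.\<close>

lemma f_nonconstant: "\<not> f constant_on ball 0 1"
proof
  assume "f constant_on ball 0 1"
  then obtain c where "G \<subseteq> {c}" unfolding constant_on_def by auto
  hence "closure G \<subseteq> {c}" by (rule closure_minimal) simp
  moreover have "0 \<in> cball (0::complex) 10" "1 \<in> cball (0::complex) 10" by auto
  ultimately have "0 = c" "1 = c" using cball_subset_closure by blast+
  thus False by simp
qed

lemma f_inj: "inj_on f (ball 0 1)"
proof (rule Hurwitz_injective[of _ "\<lambda>n. R (Suc n)"])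
  \<comment> \<open>The index is shifted because the empty sum \<open>R 0\<close> is not
    injective.\<close>
  show "uniform_limit C (\<lambda>n. R (Suc n)) f sequentially" if "compact C" "C \<subseteq> ball 0 1" for C
    using f_uniform_compact[OF that] by (rule filterlim_compose[OF _ filterlim_Suc])
  show "inj_on (R (Suc n)) (ball 0 1)" for n by (rule inj_on_subset[OF R_inj]) auto
qed (use R_hol f_hol f_nonconstant in auto)

text \<open>At 0 each new term is negligible, so this value is controlled before any bound on the
  whole sums is known; the bound on the attachment points, and through it the one on the sums,
  starts from here.\<close>

lemma R0_bound: "n \<ge> 1 \<Longrightarrow> cmod (R n 0) \<le> 2 - 2 / 2 ^ n"
proof (induction n rule: dec_induct)
  case base
  show ?case using init by (simp add: bump_sum_def bump_def)
next
  case (step n)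
  have "r n \<le> 1" using r_le[of n] by (rule order_trans) auto
  hence "cmod (R (Suc n) 0 - R n 0) \<le> 1 / 2 ^ n" using step by (intro R_step_small) auto
  moreover have "cmod (R (Suc n) 0) \<le> cmod (R (Suc n) 0 - R n 0) + cmod (R n 0)"
    using norm_triangle_ineq[of "R (Suc n) 0 - R n 0" "R n 0"] by simp
  moreover have "(2::real) / 2 ^ Suc n = 1 / 2 ^ n" "(2::real) / 2 ^ n = 1 / 2 ^ n + 1 / 2 ^ n" by simp_all
  ultimately show ?case using step.IH by linarith
qed

text \<open>The value 0 stands in for step 0 and for steps without a disc, where no nearest-point
  property locates \<open>\<zeta> n\<close>.\<close>

definition center :: "nat \<Rightarrow> complex" where "center n = (if n = 0 \<or> \<beta> n = 0 then 0 else R n (\<zeta> n))"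

text \<open>A nearest point is no farther from the target than \<open>R n 0\<close>, which gives
  \<open>10 + (10 + 2)\<close>.\<close>

lemma center_bound: "cmod (center n) \<le> 22"
proof (cases "n = 0 \<or> \<beta> n = 0")
  case False
  hence n: "n \<ge> 1" by auto
  have "cmod (w n - R n (\<zeta> n)) \<le> cmod (w n - R n 0)" using step[of n] False by (auto simp: step_ok_def)
  also have "\<dots> \<le> cmod (w n) + cmod (R n 0)" by (rule norm_triangle_ineq4)
  also have "cmod (R n 0) \<le> 2 - 2 / 2 ^ n" by (rule R0_bound[OF n])
  also have "\<dots> \<le> 2" by simp
  finally have "cmod (w n - R n (\<zeta> n)) \<le> cmod (w n) + 2" by simp
  moreover have "cmod (R n (\<zeta> n)) \<le> cmod (w n) + cmod (w n - R n (\<zeta> n))"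
    using norm_triangle_ineq4[of "w n" "w n - R n (\<zeta> n)"] by simp
  moreover have "cmod (w n) \<le> 10" using subsetD[OF q_range rangeI, of "multiplicity 2 (n + 1)"] by (simp add: w_q)
  ultimately show ?thesis using False by (simp add: center_def)
qed (simp add: center_def)

text \<open>The radius \<open>3 / (n + 1)\<close> allows for the attached disc, of diameter at most
  \<open>1 / (n + 1)\<close>, and two errors \<open>1 / 2 ^ n \<le> 1 / (n + 1)\<close>. The radius
  3 is the bound 2 for \<open>R 1\<close> plus the initial tolerance 1.\<close>

definition region :: "complex set" where
  "region = cball 0 3 \<union> (\<Union>n. cball (center n) (3 / real (n + 1)))"

lemma bp_le1: "z \<in> cball 0 1 \<Longrightarrow> cmod (bp n z) \<le> 1"
  using bp_le[of z "s n" n] bump_denom(1)[OF par(1)[of n] par(2)[of n]] par(2)[of n] by simp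

text \<open>The tolerance is tuned to the induction: away from \<open>\<zeta> n\<close> the change
  \<open>1 / 2 ^ n\<close> and the tolerance \<open>2 / 2 ^ Suc n\<close> add up to
  \<open>2 / 2 ^ n\<close>. Near \<open>\<zeta> n\<close> the value is caught by the disc about
  \<open>center n\<close>.\<close>

lemma near_K_in_region:
  "n \<ge> 1 \<Longrightarrow> z \<in> cball 0 1 \<Longrightarrow> dist x (R n z) \<le> 2 / 2 ^ n \<Longrightarrow> x \<in> region"
proof (induction n arbitrary: z rule: dec_induct)
  case base
  have "cmod (R 1 z) \<le> 2" using bp_le1[OF base(1), of 0] init by (simp add: bump_sum_def norm_mult)
  hence "dist x 0 \<le> 3" using base(2) dist_triangle[of x 0 "R 1 z"] by simp
  thus ?case by (simp add: region_def dist_commute)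
next
  case (step n)
  have n: "n \<ge> 1" using step by simp
  have half: "(2::real) / 2 ^ Suc n = 1 / 2 ^ n" "(2::real) / 2 ^ n = 1 / 2 ^ n + 1 / 2 ^ n" by simp_all
  show ?case
  proof (cases "cmod (z - \<zeta> n) \<ge> r n \<or> \<beta> n = 0")
    case True
    hence "cmod (R (Suc n) z - R n z) \<le> 1 / 2 ^ n"
      using R_step_small[OF n step.prems(1)] by (auto simp: R_Suc)
    hence "dist x (R n z) \<le> 2 / 2 ^ n" using step.prems(2) half dist_triangle[of x "R n z" "R (Suc n) z"]
      by (simp add: dist_norm)
    thus ?thesis using step.IH step.prems(1) by blast
  next
    case False
    have zc: "\<zeta> n \<in> cball 0 1" using par(1)[of n] by simp
    have a: "cmod (R n z - R n (\<zeta> n)) \<le> 1 / 2 ^ n" using R_lip[OF step.prems(1) zc] False by simp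
    have "cmod (\<beta> n) * cmod (bp n z) \<le> (1 / real (n + 1)) * 1"
      using beta_le[OF n] bp_le1[OF step.prems(1)] by (intro mult_mono) auto
    hence b: "cmod (R (Suc n) z - R n z) \<le> 1 / real (n + 1)" by (simp add: R_Suc norm_mult)
    have "real (n + 1) \<le> 2 ^ n" using less_exp[of n] by (metis Suc_eq_plus1 Suc_leI of_nat_le_iff of_nat_numeral of_nat_power)
    hence "(1::real) / 2 ^ n \<le> 1 / real (n + 1)" by (intro divide_left_mono) auto
    moreover have "dist x (R n (\<zeta> n)) \<le> dist x (R (Suc n) z) + dist (R (Suc n) z) (R n z) + dist (R n z) (R n (\<zeta> n))"
      using dist_triangle[of x "R n (\<zeta> n)" "R (Suc n) z"] dist_triangle[of "R (Suc n) z" "R n (\<zeta> n)" "R n z"] by linarith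
    ultimately have "dist x (R n (\<zeta> n)) \<le> 3 * (1 / real (n + 1))"
      using a b step.prems(2) half unfolding dist_norm[of "R n z"] dist_norm[of "R (Suc n) z"] by linarith
    hence "dist x (R n (\<zeta> n)) \<le> 3 / real (n + 1)" by simp
    moreover have "center n = R n (\<zeta> n)" using False n by (simp add: center_def)
    ultimately have "x \<in> cball (center n) (3 / real (n + 1))" by (simp add: dist_commute)
    thus ?thesis unfolding region_def by blast
  qed
qed

lemma G_subset_region: "G \<subseteq> region"
proof safe
  fix z :: complex assume "z \<in> ball 0 1"
  then obtain m where m: "m \<ge> 1" "z \<in> cball 0 (1 - r m)" using ball_exhaust by blast
  have "dist (f z) (R m z) \<le> 2 / 2 ^ m" using f_close[OF m] by (simp add: dist_norm)
  thus "f z \<in> region" using near_K_in_region[OF m(1)] mem_cball_r[of z m] m(2) by simp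
qed

lemma region_bounded: "region \<subseteq> cball 0 25"
proof -
  have "cball (center n) (3 / real (n + 1)) \<subseteq> cball 0 25" for n
  proof
    fix x assume "x \<in> cball (center n) (3 / real (n + 1))"
    hence "dist (center n) x \<le> 3 / real (n + 1)" by simp
    also have "\<dots> \<le> 3" by (simp add: divide_le_eq)
    finally show "x \<in> cball 0 25" using center_bound[of n] dist_triangle[of 0 x "center n"] by simp
  qed
  thus ?thesis unfolding region_def by (auto simp: subset_iff)
qed

lemma G_bounded: "bounded G"
  using G_subset_region region_bounded bounded_cball bounded_subset by blast

lemma R_bounded: "z \<in> cball 0 1 \<Longrightarrow> cmod (R n z) \<le> 25"
proof (cases "n = 0")
  case False
  assume "z \<in> cball 0 1"
  hence "R n z \<in> region" using near_K_in_region[of n z "R n z"] False by simp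
  thus ?thesis using region_bounded by auto
qed (simp add: bump_sum_def)

lemma region_measurable: "region \<in> sets lborel"
  unfolding region_def by (intro sets.Un sets.countable_UN) auto

lemma emeasure_region: "emeasure lborel region \<le> ennreal (36 * pi)"
proof -
  have disc: "emeasure lborel (cball (c::complex) x) = ennreal (pi * x\<^sup>2)" if "x \<ge> 0" for c x
    using emeasure_cball[OF that, of c] by (simp add: unit_ball_vol_2)
  have sq: "(\<lambda>n. 9 * pi * (1 / real (n + 1) ^ 2)) sums (9 * pi * (pi\<^sup>2 / 6))"
    using inverse_squares_sums by (intro sums_mult) (simp add: add.commute)
  have "emeasure lborel (\<Union>n. cball (center n) (3 / real (n + 1))) \<le> (\<Sum>n. emeasure lborel (cball (center n) (3 / real (n + 1))))"
    by (intro emeasure_subadditive_countably) auto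
  also have "\<dots> = (\<Sum>n. ennreal (9 * pi * (1 / real (n + 1) ^ 2)))"
    by (intro suminf_cong) (simp add: disc power_divide)
  also have "\<dots> = ennreal (\<Sum>n. 9 * pi * (1 / real (n + 1) ^ 2))"
    by (intro suminf_ennreal2 sums_summable[OF sq]) simp
  also have "(\<Sum>n. 9 * pi * (1 / real (n + 1) ^ 2)) = 9 * pi * (pi\<^sup>2 / 6)"
    by (rule sums_unique[OF sq, symmetric])
  also have "ennreal (9 * pi * (pi\<^sup>2 / 6)) \<le> ennreal (9 * pi * 3)"
  proof (intro ennreal_leI mult_left_mono)
    have "pi\<^sup>2 \<le> 4\<^sup>2" using pi_less_4 by (intro power_mono) auto
    thus "pi\<^sup>2 / 6 \<le> 3" by simp
  qed auto
  finally have U: "emeasure lborel (\<Union>n. cball (center n) (3 / real (n + 1))) \<le> ennreal (27 * pi)" by simp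
  have "emeasure lborel region \<le> emeasure lborel (cball (0::complex) 3) + emeasure lborel (\<Union>n. cball (center n) (3 / real (n + 1)))"
    unfolding region_def by (intro emeasure_subadditive) auto
  also have "\<dots> \<le> ennreal (9 * pi) + ennreal (27 * pi)"
    using U by (intro add_mono) (auto simp: disc mult.commute)
  also have "\<dots> = ennreal (36 * pi)" by (subst ennreal_plus[symmetric]) auto
  finally show ?thesis .
qed

lemma G_open: "open G"
  by (rule open_mapping_thm3[OF f_hol _ f_inj]) auto

lemma frontier_positive: "emeasure lborel (frontier G) > 0"
proof (rule ccontr)
  assume "\<not> ?thesis"
  hence z: "emeasure lborel (frontier G) = 0" by (simp add: zero_less_iff_neq_zero)
  have "cball 0 10 \<subseteq> frontier G \<union> region"
    using cball_subset_closure G_subset_region by (auto simp: frontier_def interior_open[OF G_open])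
  hence "emeasure lborel (cball (0::complex) 10) \<le> emeasure lborel (frontier G \<union> region)"
    using region_measurable by (intro emeasure_mono) auto
  also have "\<dots> \<le> emeasure lborel (frontier G) + emeasure lborel region"
    using region_measurable by (intro emeasure_subadditive) auto
  also have "\<dots> \<le> ennreal (36 * pi)" using emeasure_region by (simp add: z)
  finally have "ennreal (pi * 100) \<le> ennreal (36 * pi)"
    using emeasure_cball[of 10 "0::complex"] by (simp add: unit_ball_vol_2)
  thus False by simp
qed

end

section \<open>Boundary values\<close>

lemma sin_ge_third:
  fixes x :: real
  assumes "0 \<le> x" "x \<le> pi / 2"
  shows "sin x \<ge> x / 3"
proof -
  have "x \<le> 2" using assms pi_less_4 by simp
  hence "x\<^sup>2 \<le> 2\<^sup>2" using assms by (intro power_mono) auto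
  hence "x * x\<^sup>2 \<le> x * 4" using assms by (intro mult_left_mono) auto
  moreover have "\<bar>sin x - x\<bar> \<le> x ^ 3 / 6"
    using Maclaurin_sin_bound[of x 3] assms by (simp add: eval_nat_numeral sin_coeff_def)
  ultimately show ?thesis by (simp add: power2_eq_square power3_eq_cube mult.assoc abs_if split: if_splits)
qed

text \<open>The chord is twice the sine of half the angle, and \<open>sin_ge_third\<close> turns it
  into an angle at the cost of a factor 3. The shifted intervals account for wrapping at
  \<open>2 * pi\<close>.\<close>

lemma cis_close:
  assumes t: "t \<in> {0..<2 * pi}" and th: "\<theta> \<in> {0..<2 * pi}" and d: "cmod (cis t - cis \<theta>) < \<eta>"
  shows "t \<in> {\<theta> - 3 * \<eta>..\<theta> + 3 * \<eta>} \<union> {\<theta> + 2 * pi - 3 * \<eta>..\<theta> + 2 * pi + 3 * \<eta>} \<union> {\<theta> - 2 * pi - 3 * \<eta>..\<theta> - 2 * pi + 3 * \<eta>}"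
proof -
  define x where "x = \<bar>t - \<theta>\<bar> / 2"
  have x: "0 \<le> x" "x < pi" using t th by (auto simp: x_def)
  have "cis \<theta> * exp (\<i> * of_real (t - \<theta>)) = cis t"
    by (simp add: cis_conv_exp[symmetric] cis_mult del: of_real_diff)
  hence "cis t - cis \<theta> = cis \<theta> * (exp (\<i> * of_real (t - \<theta>)) - 1)"
    by (simp only: right_diff_distrib mult_1_right)
  hence "cmod (cis t - cis \<theta>) = 2 * \<bar>sin ((t - \<theta>) / 2)\<bar>"
    using dist_exp_i_1[of "t - \<theta>"] by (simp only: norm_mult norm_cis mult_1)
  also have "\<bar>sin ((t - \<theta>) / 2)\<bar> = \<bar>sin x\<bar>"
  proof -
    have "x = (t - \<theta>) / 2 \<or> x = - ((t - \<theta>) / 2)" 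
      by (cases "t \<ge> \<theta>") (simp_all add: x_def abs_if field_simps)
    thus ?thesis by (elim disjE) (simp_all only: sin_minus abs_minus)
  qed
  also have "\<bar>sin x\<bar> = sin x" using x sin_ge_zero[of x] by simp
  finally have s: "2 * sin x < \<eta>" using d by simp
  show ?thesis
  proof (cases "x \<le> pi / 2")
    case True
    hence "x \<le> 3 * sin x" using sin_ge_third[of x] x by simp
    hence "\<bar>t - \<theta>\<bar> < 3 * \<eta>" using s by (simp add: x_def)
    thus ?thesis by auto
  next
    case False
    hence "pi - x \<le> 3 * sin (pi - x)" using sin_ge_third[of "pi - x"] x by simp
    hence "2 * pi - \<bar>t - \<theta>\<bar> < 3 * \<eta>" using s by (simp add: x_def)
    thus ?thesis using t th by (auto simp: abs_if split: if_splits)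
  qed
qed

text \<open>Borel-Cantelli: the exceptional parameters of index \<open>n\<close> lie in three
  intervals of length \<open>6 / 2 ^ n\<close>, which is summable.\<close>

lemma AE_eventually_far:
  fixes \<zeta> :: "nat \<Rightarrow> complex"
  assumes "\<And>n. cmod (\<zeta> n) = 1"
  shows "AE t in lborel. t \<in> {0..<2 * pi} \<longrightarrow> (\<forall>\<^sub>F n in sequentially. cmod (cis t - \<zeta> n) \<ge> 1 / 2 ^ n)"
proof -
  define \<theta> where "\<theta> n = Arg2pi (\<zeta> n)" for n
  have th: "\<theta> n \<in> {0..<2 * pi}" "\<zeta> n = cis (\<theta> n)" for n
    using Arg2pi_ge_0[of "\<zeta> n"] Arg2pi_lt_2pi[of "\<zeta> n"] Arg2pi_eq[of "\<zeta> n"] assms[of n]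
    by (auto simp: \<theta>_def cis_conv_exp)
  define \<eta> :: "nat \<Rightarrow> real" where "\<eta> n = 1 / 2 ^ n" for n :: nat
  have eta: "(0::real) < \<eta> n" for n by (simp add: \<eta>_def)
  define A where "A n = {\<theta> n - 3 * \<eta> n..\<theta> n + 3 * \<eta> n} \<union> {\<theta> n + 2 * pi - 3 * \<eta> n..\<theta> n + 2 * pi + 3 * \<eta> n}
     \<union> {\<theta> n - 2 * pi - 3 * \<eta> n..\<theta> n - 2 * pi + 3 * \<eta> n}" for n
  have Am: "A n \<in> sets lborel" for n by (simp add: A_def)
  have Ae: "emeasure lborel (A n) \<le> ennreal (18 * \<eta> n)" for n
  proof -
    have "emeasure lborel (A n) \<le> ennreal (6 * \<eta> n) + ennreal (6 * \<eta> n) + ennreal (6 * \<eta> n)"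
      unfolding A_def using eta[of n]
      by (intro order_trans[OF emeasure_subadditive] add_mono) auto
    also have "\<dots> = ennreal (18 * \<eta> n)" using eta[of n] by (simp flip: ennreal_plus)
    finally show ?thesis .
  qed
  have "AE t in lborel. eventually (\<lambda>n. t \<in> space lborel - A n) sequentially"
  proof (rule borel_cantelli_AE1[OF Am])
    show "emeasure lborel (A n) < \<infinity>" for n using Ae[of n] by (auto intro: le_less_trans)
    have "summable (\<lambda>n. 18 * \<eta> n)" unfolding \<eta>_def
      using summable_geometric[of "1/2::real"] by (intro summable_mult) (simp add: power_divide)
    thus "summable (\<lambda>n. measure lborel (A n))"
    proof (rule summable_comparison_test'[where N = 0])
      fix n
      show "norm (measure lborel (A n)) \<le> 18 * \<eta> n"
        using Ae[of n] eta[of n] by (simp add: measure_def enn2real_leI)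
    qed
  qed
  thus ?thesis
  proof eventually_elim
    case (elim t)
    show ?case
    proof
      assume t: "t \<in> {0..<2 * pi}"
      show "\<forall>\<^sub>F n in sequentially. cmod (cis t - \<zeta> n) \<ge> 1 / 2 ^ n"
        using elim
      proof eventually_elim
        case (elim n)
        thus ?case using cis_close[OF t th(1), of n "\<eta> n"] unfolding A_def \<eta>_def th(2)[of n] by force
      qed
    qed
  qed
qed

section \<open>Blaschke products and the reflected sums\<close>

context bump_filling
begin

text \<open>The Blaschke factor with zero \<open>\<zeta> n / (1 + s n)\<close>, normalised by a
  unimodular constant so that it tends to 1 as \<open>s n\<close> tends to 0. This makes the
  products converge wherever the bumps are summable.\<close>

definition bfac :: "nat \<Rightarrow> complex \<Rightarrow> complex" where
  "bfac n z = (1 - of_real (1 + s n) * (cnj (\<zeta> n) * z)) / (of_real (s n) + 1 - cnj (\<zeta> n) * z)"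

primrec V :: "nat \<Rightarrow> complex \<Rightarrow> complex" where
  "V 0 z = 1" | "V (Suc n) z = bfac n z * V n z"

text \<open>
  The recursion is chosen such that \<open>U n = V n * cnj (R n)\<close> on the unit circle.
\<close>
primrec U :: "nat \<Rightarrow> complex \<Rightarrow> complex" where
  "U 0 z = 0" | "U (Suc n) z = bfac n z * U n z - cnj (\<beta> n) * (cnj (\<zeta> n) * z) * V n z * bp n z"

lemma den_nz: "z \<in> cball 0 1 \<Longrightarrow> of_real (s n) + 1 - cnj (\<zeta> n) * z \<noteq> 0"
  by (rule bump_denom(4)[OF par])

lemma bfac_le1: "z \<in> cball 0 1 \<Longrightarrow> cmod (bfac n z) \<le> 1" and bfac_eq1: "cmod z = 1 \<Longrightarrow> cmod (bfac n z) = 1"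
proof -
  define y where "y = cnj (\<zeta> n) * z"
  have y: "cmod y = cmod z" by (simp add: y_def norm_mult par)
  have id: "(cmod (of_real (s n) + 1 - y))\<^sup>2 - (cmod (1 - of_real (1 + s n) * y))\<^sup>2 = ((1 + s n)\<^sup>2 - 1) * (1 - (cmod y)\<^sup>2)"
    unfolding cmod_power2 by (simp add: power2_eq_square algebra_simps)
  have sp: "(1 + s n)\<^sup>2 - 1 \<ge> 0" using par(2)[of n] by (simp add: power2_eq_square algebra_simps)
  { assume z: "z \<in> cball 0 1"
    have "(cmod y)\<^sup>2 \<le> 1" using z y by (simp add: power_le_one)
    hence "((1 + s n)\<^sup>2 - 1) * (1 - (cmod y)\<^sup>2) \<ge> 0" using sp by (intro mult_nonneg_nonneg) auto
    hence "(cmod (1 - of_real (1 + s n) * y))\<^sup>2 \<le> (cmod (of_real (s n) + 1 - y))\<^sup>2" using id by linarith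
    hence "cmod (1 - of_real (1 + s n) * y) \<le> cmod (of_real (s n) + 1 - y)" by (rule power2_le_imp_le) simp
    thus "cmod (bfac n z) \<le> 1" using den_nz[OF z, of n] unfolding bfac_def y_def[symmetric] norm_divide
      by (simp add: divide_le_eq) }
  { assume z: "cmod z = 1"
    hence "(cmod (1 - of_real (1 + s n) * y))\<^sup>2 = (cmod (of_real (s n) + 1 - y))\<^sup>2" using id y by simp
    hence "cmod (1 - of_real (1 + s n) * y) = cmod (of_real (s n) + 1 - y)" by (rule power2_eq_imp_eq) auto
    thus "cmod (bfac n z) = 1" using den_nz[of z n] z unfolding bfac_def y_def[symmetric] norm_divide by simp }
qed

lemma bfac_diff: "z \<in> cball 0 1 \<Longrightarrow> cmod (bfac n z - 1) \<le> 2 * cmod (bp n z)"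
proof -
  assume z: "z \<in> cball 0 1"
  have "bfac n z - 1 = - bp n z * (1 + cnj (\<zeta> n) * z)"
    using den_nz[OF z, of n] by (simp add: bfac_def bump_def field_simps)
  moreover have "cmod (1 + cnj (\<zeta> n) * z) \<le> 1 + 1"
    using z by (intro order_trans[OF norm_triangle_ineq] add_mono) (auto simp: norm_mult par)
  ultimately show ?thesis using mult_left_mono[of "cmod (1 + cnj (\<zeta> n) * z)" 2 "cmod (bp n z)"]
    by (simp add: norm_mult mult.commute[of 2])
qed

lemma V_le1: "z \<in> cball 0 1 \<Longrightarrow> cmod (V n z) \<le> 1"
  by (induction n) (auto simp: norm_mult intro!: mult_le_one bfac_le1)

lemma V_eq1: "cmod z = 1 \<Longrightarrow> cmod (V n z) = 1"
  by (induction n) (auto simp: norm_mult bfac_eq1)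

lemma bp_hol: "bp n holomorphic_on cball 0 1"
  by (rule holomorphic_on_subset[OF bump_holomorphic[OF par]]) (use par(2)[of n] in auto)

lemma bfac_hol: "bfac n holomorphic_on cball 0 1"
  unfolding bfac_def[abs_def] using den_nz by (intro holomorphic_intros) auto

lemma V_hol: "V n holomorphic_on cball 0 1"
proof (induction n)
  case (Suc n)
  have "(\<lambda>z. bfac n z * V n z) holomorphic_on cball 0 1" by (intro holomorphic_intros bfac_hol Suc)
  thus ?case by (simp add: fun_eq_iff[symmetric] cong: holomorphic_cong)
qed (simp add: cong: holomorphic_cong)

lemma U_hol: "U n holomorphic_on cball 0 1"
proof (induction n)
  case (Suc n)
  have "(\<lambda>z. bfac n z * U n z - cnj (\<beta> n) * (cnj (\<zeta> n) * z) * V n z * bp n z) holomorphic_on cball 0 1"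
    by (intro holomorphic_intros bfac_hol Suc V_hol bp_hol)
  thus ?case by (simp cong: holomorphic_cong)
qed (simp add: cong: holomorphic_cong)

lemma U_circle: "cmod z = 1 \<Longrightarrow> U n z = V n z * cnj (R n z)"
proof (induction n)
  case (Suc n)
  define y where "y = cnj (\<zeta> n) * z"
  have zc: "z \<in> cball 0 1" using Suc.prems by simp
  have y1: "cmod y = 1" using Suc.prems by (simp add: y_def norm_mult par)
  have yy: "y * cnj y = 1" using y1 by (simp add: complex_norm_square[symmetric] flip: of_real_power)
  have d: "of_real (s n) + 1 - y \<noteq> 0" using den_nz[OF zc] by (simp add: y_def)
  hence "cnj (of_real (s n) + 1 - y) \<noteq> 0" by (simp only: complex_cnj_zero_iff not_False_eq_True)
  hence d': "of_real (s n) + 1 - cnj y \<noteq> 0" by simp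
  \<comment> \<open>On the circle \<open>cnj y\<close> is the inverse of \<open>y\<close>, so the
    numerator of the factor cancels the denominator of the conjugated bump.\<close>
  have num: "1 - of_real (1 + s n) * y = - y * (of_real (s n) + 1 - cnj y)" using yy by (simp add: algebra_simps)
  have "bfac n z * cnj (bp n z) = - y * bp n z"
    unfolding bfac_def bump_def y_def[symmetric] num using d d' by simp
  hence "bfac n z * (V n z * cnj (R n z)) - cnj (\<beta> n) * y * V n z * bp n z =
      bfac n z * V n z * cnj (R n z) + cnj (\<beta> n) * V n z * (bfac n z * cnj (bp n z))" by simp
  also have "\<dots> = bfac n z * V n z * cnj (R (Suc n) z)" by (simp add: R_Suc algebra_simps)
  finally show ?case using Suc by (simp add: y_def)
qed (simp add: bump_sum_def)

text \<open>On the circle \<open>U n\<close> has the modulus of \<open>R n\<close>; the maximum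
  principle carries the bound, uniform in \<open>n\<close>, into the disc.\<close>

lemma U_bounded: "z \<in> cball 0 1 \<Longrightarrow> cmod (U n z) \<le> 25"
proof (rule maximum_modulus_frontier[of "U n" "cball 0 1"])
  show "U n holomorphic_on interior (cball 0 1)" by (rule holomorphic_on_subset[OF U_hol]) auto
  show "continuous_on (closure (cball 0 1)) (U n)" using holomorphic_on_imp_continuous_on[OF U_hol] by simp
  fix z :: complex assume "z \<in> frontier (cball 0 1)"
  hence "cmod z = 1" by simp
  thus "cmod (U n z) \<le> 25" using U_circle[of z n] V_eq1[of z n] R_bounded[of z n] by (simp add: norm_mult)
qed auto

definition V_lim :: "complex \<Rightarrow> complex" where "V_lim z = lim (\<lambda>n. V n z)"
definition U_lim :: "complex \<Rightarrow> complex" where "U_lim z = lim (\<lambda>n. U n z)"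

text \<open>The increments of all three sequences are dominated by multiples of the bump, so one
  summable majorant suffices. The largest constant, 52, is \<open>2 * 25 + 2\<close> from the two
  parts of the recursion for \<open>U\<close>.\<close>

lemma uniform_limits:
  assumes X: "X \<subseteq> cball 0 1" and b: "\<And>n z. n \<ge> n0 \<Longrightarrow> z \<in> X \<Longrightarrow> cmod (bp n z) \<le> g n" and g: "summable g"
  shows "uniform_limit X R f sequentially" "uniform_limit X V V_lim sequentially" "uniform_limit X U U_lim sequentially"
proof -
  have g2: "summable (\<lambda>n. 52 * g n)" using g by (rule summable_mult)
  have bd: "2 * cmod (bp n z) \<le> 52 * g n" "52 * cmod (bp n z) \<le> 52 * g n" if "n \<ge> n0" "z \<in> X" for n z
  proof -
    show "52 * cmod (bp n z) \<le> 52 * g n" using b[OF that] by simp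
    thus "2 * cmod (bp n z) \<le> 52 * g n" using norm_ge_zero[of "bp n z"] by linarith
  qed
  show "uniform_limit X R f sequentially" unfolding f_def
  proof (rule uniform_limit_telescope[OF order_trans[OF _ bd(1)] g2])
    fix n z
    show "cmod (R (Suc n) z - R n z) \<le> 2 * cmod (bp n z)"
      using beta_le2[of n] by (simp add: R_Suc norm_mult mult_right_mono)
  qed auto
  have Vd: "cmod (V (Suc n) z - V n z) \<le> 2 * cmod (bp n z)" if "z \<in> cball 0 1" for n z
  proof -
    have "V (Suc n) z - V n z = (bfac n z - 1) * V n z" by (simp add: algebra_simps)
    hence "cmod (V (Suc n) z - V n z) = cmod (bfac n z - 1) * cmod (V n z)" by (simp only: norm_mult)
    also have "\<dots> \<le> cmod (bfac n z - 1) * 1" using V_le1[OF that] by (intro mult_left_mono) auto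
    finally show ?thesis using bfac_diff[OF that, of n] by simp
  qed
  show "uniform_limit X V V_lim sequentially" unfolding V_lim_def
    using X by (intro uniform_limit_telescope[OF order_trans[OF Vd bd(1)] g2]) auto
  have Ud: "cmod (U (Suc n) z - U n z) \<le> 52 * cmod (bp n z)" if z: "z \<in> cball 0 1" for n z
  proof -
    have a: "cmod ((bfac n z - 1) * U n z) \<le> (2 * cmod (bp n z)) * 25" unfolding norm_mult
      using bfac_diff[OF z] U_bounded[OF z] by (intro mult_mono) auto
    have "cmod (cnj (\<beta> n) * (cnj (\<zeta> n) * z) * V n z) \<le> 2 * (1 * 1) * 1" unfolding norm_mult
      using beta_le2[of n] par(1)[of n] z V_le1[OF z] by (intro mult_mono) auto
    hence b: "cmod (cnj (\<beta> n) * (cnj (\<zeta> n) * z) * V n z * bp n z) \<le> 2 * cmod (bp n z)"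
      unfolding norm_mult[of _ "bp n z"] by (intro mult_right_mono) auto
    have "U (Suc n) z - U n z = (bfac n z - 1) * U n z - cnj (\<beta> n) * (cnj (\<zeta> n) * z) * V n z * bp n z"
      by (simp add: algebra_simps)
    hence "cmod (U (Suc n) z - U n z) \<le> cmod ((bfac n z - 1) * U n z) + cmod (cnj (\<beta> n) * (cnj (\<zeta> n) * z) * V n z * bp n z)"
      by (metis norm_triangle_ineq4)
    thus ?thesis using a b by linarith
  qed
  show "uniform_limit X U U_lim sequentially" unfolding U_lim_def
    using X by (intro uniform_limit_telescope[OF order_trans[OF Ud bd(2)] g2]) auto
qed

lemma VU_uniform_compact:
  assumes "compact C" "C \<subseteq> ball 0 1"
  shows "uniform_limit C V V_lim sequentially" "uniform_limit C U U_lim sequentially"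
proof -
  obtain m where m: "m \<ge> 1" "C \<subseteq> cball 0 (1 - r m)" using compact_exhaust[OF assms, of 0] by blast
  have "cmod (bp n z) \<le> 1 / 2 ^ n" if "n \<ge> m" "z \<in> C" for n z
  proof (rule bp_small)
    show "z \<in> cball 0 1" using that(2) assms(2) by auto
    show "r n \<le> cmod (z - \<zeta> n) \<or> cmod z \<le> 1 - r n" using r_antimono[OF that(1)] that(2) m(2) by auto
  qed (use that m in auto)
  moreover have "C \<subseteq> cball 0 1" using assms(2) by auto
  ultimately show "uniform_limit C V V_lim sequentially" "uniform_limit C U U_lim sequentially"
    using uniform_limits(2,3)[of C m "\<lambda>n. 1 / 2 ^ n"] summable_half by auto
qed

lemma V_lim_hol: "V_lim holomorphic_on ball 0 1" and U_lim_hol: "U_lim holomorphic_on ball 0 1"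
proof -
  have ex: "\<exists>d>0. cball x d \<subseteq> ball 0 1" if "x \<in> ball 0 1" for x :: complex
    using open_contains_cball[of "ball (0::complex) 1"] that by blast
  show "V_lim holomorphic_on ball 0 1"
  proof (rule holomorphic_uniform_sequence)
    show "V n holomorphic_on ball 0 1" for n by (rule holomorphic_on_subset[OF V_hol]) auto
    fix x :: complex assume "x \<in> ball 0 1"
    then obtain d where "d > 0" "cball x d \<subseteq> ball 0 1" using ex by blast
    thus "\<exists>d>0. cball x d \<subseteq> ball 0 1 \<and> uniform_limit (cball x d) V V_lim sequentially"
      using VU_uniform_compact(1)[OF compact_cball] by (intro exI[of _ d] conjI)
  qed auto
  show "U_lim holomorphic_on ball 0 1"
  proof (rule holomorphic_uniform_sequence)
    show "U n holomorphic_on ball 0 1" for n by (rule holomorphic_on_subset[OF U_hol]) auto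
    fix x :: complex assume "x \<in> ball 0 1"
    then obtain d where "d > 0" "cball x d \<subseteq> ball 0 1" using ex by blast
    thus "\<exists>d>0. cball x d \<subseteq> ball 0 1 \<and> uniform_limit (cball x d) U U_lim sequentially"
      using VU_uniform_compact(2)[OF compact_cball] by (intro exI[of _ d] conjI)
  qed auto
qed

lemma V_lim_bounded: "z \<in> ball 0 1 \<Longrightarrow> cmod (V_lim z) \<le> 1" and U_lim_bounded: "z \<in> ball 0 1 \<Longrightarrow> cmod (U_lim z) \<le> 25"
proof -
  assume z: "z \<in> ball 0 1"
  have "uniform_limit {z} V V_lim sequentially" "uniform_limit {z} U U_lim sequentially"
    using z by (intro VU_uniform_compact; simp)+
  hence l: "(\<lambda>n. V n z) \<longlonglongrightarrow> V_lim z" "(\<lambda>n. U n z) \<longlonglongrightarrow> U_lim z" by (auto dest: tendsto_uniform_limitI)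
  have zc: "z \<in> cball 0 1" using z by simp
  show "cmod (V_lim z) \<le> 1"
    by (rule tendsto_upperbound[OF tendsto_norm[OF l(1)]]) (auto intro!: always_eventually V_le1[OF zc])
  show "cmod (U_lim z) \<le> 25"
    by (rule tendsto_upperbound[OF tendsto_norm[OF l(2)]]) (auto intro!: always_eventually U_bounded[OF zc])
qed

definition good :: "complex \<Rightarrow> bool" where
  "good \<xi> \<longleftrightarrow> cmod \<xi> = 1 \<and> (\<forall>\<^sub>F n in sequentially. cmod (\<xi> - \<zeta> n) \<ge> 1 / 2 ^ n)"

text \<open>In a Stolz region \<open>cmod (z - \<xi>)\<close> is at most
  \<open>M * (1 - cmod z)\<close>, hence at most \<open>M * cmod (z - \<zeta> n)\<close>. So
  \<open>z\<close> is within a factor \<open>M + 1\<close> as far from \<open>\<zeta> n\<close> as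
  \<open>\<xi>\<close> is, and \<open>s n \<le> 1 / 4 ^ n\<close> beats the distance
  \<open>1 / 2 ^ n\<close>.\<close>

lemma good_uniform:
  assumes "good \<xi>" and M: "M > 1"
  defines "X \<equiv> insert \<xi> (stolz_region \<xi> M)"
  shows "uniform_limit X R f sequentially" "uniform_limit X V V_lim sequentially" "uniform_limit X U U_lim sequentially"
proof -
  have xi: "cmod \<xi> = 1" using assms by (simp add: good_def)
  obtain n0 where n0: "\<And>n. n \<ge> n0 \<Longrightarrow> cmod (\<xi> - \<zeta> n) \<ge> 1 / 2 ^ n"
    using assms(1) unfolding good_def eventually_at_top_linorder by blast
  have X: "X \<subseteq> cball 0 1" using xi by (auto simp: X_def stolz_region_def)
  have b: "cmod (bp n z) \<le> (M + 1) * (1 / 2 ^ n)" if n: "n \<ge> n0" and z: "z \<in> X" for n z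
  proof -
    have zc: "z \<in> cball 0 1" using X z by blast
    have "cmod (z - \<xi>) \<le> M * (1 - cmod z)" using z xi by (auto simp: X_def stolz_region_def)
    also have "1 - cmod z \<le> cmod (z - \<zeta> n)"
      using par(1)[of n] norm_triangle_ineq3[of z "\<zeta> n"] by simp
    finally have "cmod (z - \<xi>) \<le> M * cmod (z - \<zeta> n)" using M by simp
    moreover have "cmod (\<xi> - \<zeta> n) \<le> cmod (z - \<xi>) + cmod (z - \<zeta> n)"
      using norm_triangle_ineq4[of "z - \<zeta> n" "z - \<xi>"] by simp
    ultimately have "1 / 2 ^ n \<le> (M + 1) * cmod (z - \<zeta> n)" using n0[OF n] by (simp add: algebra_simps)
    hence c: "1 / (2 ^ n * (M + 1)) \<le> cmod (z - \<zeta> n)"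
      using M unfolding divide_divide_eq_left[symmetric] by (simp add: pos_divide_le_eq mult_ac)
    have "cmod (bp n z) \<le> s n / (1 / (2 ^ n * (M + 1)))"
      using M order_trans[OF c bump_denom(2)[OF par zc]] by (intro bp_le zc) auto
    also have "\<dots> = s n * 2 ^ n * (M + 1)" by simp
    also have "\<dots> \<le> (1 / 4 ^ n) * 2 ^ n * (M + 1)" using s_le4[of n] M by (intro mult_right_mono) auto
    also have "(1 / 4 ^ n) * 2 ^ n = (1 / 2 ^ n :: real)"
      using power_mult_distrib[of "2::real" 2 n] by (simp add: field_simps)
    finally show ?thesis by (simp add: mult.commute)
  qed
  have sm: "summable (\<lambda>n. (M + 1) * (1 / 2 ^ n))" by (intro summable_mult summable_half)
  show "uniform_limit X R f sequentially" "uniform_limit X V V_lim sequentially" "uniform_limit X U U_lim sequentially"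
    by (rule uniform_limits[OF X b sm]; assumption)+
qed

lemma good_continuous:
  assumes "good \<xi>" and "M > 1"
  shows "continuous_on (insert \<xi> (stolz_region \<xi> M)) f" "continuous_on (insert \<xi> (stolz_region \<xi> M)) V_lim"
    "continuous_on (insert \<xi> (stolz_region \<xi> M)) U_lim"
proof -
  have X: "insert \<xi> (stolz_region \<xi> M) \<subseteq> cball 0 1" using assms by (auto simp: stolz_region_def good_def)
  have c: "continuous_on (insert \<xi> (stolz_region \<xi> M)) (R n)" "continuous_on (insert \<xi> (stolz_region \<xi> M)) (V n)"
     "continuous_on (insert \<xi> (stolz_region \<xi> M)) (U n)" for n
    using continuous_on_subset[OF R_cont X] continuous_on_subset[OF holomorphic_on_imp_continuous_on[OF V_hol] X]
      continuous_on_subset[OF holomorphic_on_imp_continuous_on[OF U_hol] X] by auto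
  show "continuous_on (insert \<xi> (stolz_region \<xi> M)) f" "continuous_on (insert \<xi> (stolz_region \<xi> M)) V_lim"
    "continuous_on (insert \<xi> (stolz_region \<xi> M)) U_lim"
    by (rule uniform_limit_theorem[OF _ good_uniform(1)[OF assms]], simp_all add: c always_eventually)
       (rule uniform_limit_theorem[OF _ good_uniform(2)[OF assms]], simp_all add: c always_eventually,
        rule uniform_limit_theorem[OF _ good_uniform(3)[OF assms]], simp_all add: c always_eventually)
qed

lemma continuous_imp_angular:
  assumes "\<And>M. M > 1 \<Longrightarrow> continuous_on (insert \<xi> (stolz_region \<xi> M)) h"
  shows "has_angular_limit h \<xi> (h \<xi>)"
  unfolding has_angular_limit_def
proof (intro allI impI)
  fix M :: real assume "M > 1"
  hence "(h \<longlongrightarrow> h \<xi>) (at \<xi> within insert \<xi> (stolz_region \<xi> M))" using assms by (auto simp: continuous_on_def)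
  thus "(h \<longlongrightarrow> h \<xi>) (at \<xi> within stolz_region \<xi> M)" by (rule tendsto_within_subset) auto
qed

lemma good_values:
  assumes "good \<xi>"
  shows "cmod (V_lim \<xi>) = 1" "U_lim \<xi> = V_lim \<xi> * cnj (f \<xi>)"
proof -
  have l: "(\<lambda>n. R n \<xi>) \<longlonglongrightarrow> f \<xi>" "(\<lambda>n. V n \<xi>) \<longlonglongrightarrow> V_lim \<xi>" "(\<lambda>n. U n \<xi>) \<longlonglongrightarrow> U_lim \<xi>"
    using good_uniform[OF assms, of 2] by (auto dest!: tendsto_uniform_limitI)
  have xi: "cmod \<xi> = 1" using assms by (simp add: good_def)
  have "(\<lambda>n. cmod (V n \<xi>)) \<longlonglongrightarrow> cmod (V_lim \<xi>)" by (intro tendsto_intros l)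
  moreover have "(\<lambda>n. cmod (V n \<xi>)) \<longlonglongrightarrow> 1" by (simp add: V_eq1[OF xi])
  ultimately show "cmod (V_lim \<xi>) = 1" by (rule LIMSEQ_unique)
  have "(\<lambda>n. V n \<xi> * cnj (R n \<xi>)) \<longlonglongrightarrow> V_lim \<xi> * cnj (f \<xi>)" by (intro tendsto_intros l)
  hence "(\<lambda>n. U n \<xi>) \<longlonglongrightarrow> V_lim \<xi> * cnj (f \<xi>)" by (simp add: U_circle[OF xi])
  thus "U_lim \<xi> = V_lim \<xi> * cnj (f \<xi>)" using l(3) by (rule LIMSEQ_unique[rotated])
qed

lemma AE_good: "AE t in lborel. t \<in> {0..<2 * pi} \<longrightarrow> good (cis t)"
  using AE_eventually_far[of \<zeta>, OF par(1)] by eventually_elim (auto simp: good_def)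

lemma good_exists: "\<exists>t. good (cis t)"
proof (rule ccontr)
  assume no: "\<not> ?thesis"
  from AE_E[OF AE_good] obtain N where N: "{t \<in> space lborel. \<not> (t \<in> {0..<2 * pi} \<longrightarrow> good (cis t))} \<subseteq> N"
    "emeasure lborel N = 0" "N \<in> sets lborel" by blast
  have "{0..<2 * pi} \<subseteq> N" using N(1) no by auto
  hence "emeasure lborel {0..<2 * pi} \<le> emeasure lborel N" using N(3) by (rule emeasure_mono)
  thus False using N(2) by simp
qed

text \<open>If the limit vanished in the disc, continuity along the radius to a good point would
  give 0 there, against modulus 1. For the radius the Stolz region with constant 2 suffices.\<close>

lemma V_lim_nonzero: "\<exists>z\<in>ball 0 1. V_lim z \<noteq> 0"
proof (rule ccontr)
  assume "\<not> ?thesis"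
  hence z: "\<And>z. z \<in> ball 0 1 \<Longrightarrow> V_lim z = 0" by blast
  obtain t where g: "good (cis t)" using good_exists by blast
  define X where "X = insert (cis t) (stolz_region (cis t) 2)"
  have seg: "of_real x * cis t \<in> X" if "x \<in> {0..1}" for x
  proof (cases "x = 1")
    case False
    have "of_real x * cis t - cis t = of_real (x - 1) * cis t" by (simp add: algebra_simps)
    hence "cmod (of_real x * cis t - cis t) = \<bar>x - 1\<bar>" by (simp only: norm_mult norm_of_real norm_cis mult_1_right)
    thus ?thesis using that False by (simp add: X_def stolz_region_def norm_mult)
  qed (simp add: X_def)
  have "continuous_on X V_lim" unfolding X_def by (rule good_continuous[OF g]) simp
  hence "continuous_on {0..1} (\<lambda>x::real. V_lim (of_real x * cis t))"
    by (rule continuous_on_compose2) (use seg in \<open>auto intro!: continuous_intros\<close>)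
  hence "continuous_on (closure {0..<1}) (\<lambda>x::real. V_lim (of_real x * cis t))" by simp
  hence "V_lim (of_real 1 * cis t) = 0"
    by (rule continuous_constant_on_closure) (auto intro!: z simp: norm_mult)
  thus False using good_values(1)[OF g] by simp
qed

lemma has_angular_limit_cong:
  "(\<And>z. z \<in> ball 0 1 \<Longrightarrow> h z = h' z) \<Longrightarrow> has_angular_limit h \<xi> L \<longleftrightarrow> has_angular_limit h' \<xi> L"
  unfolding has_angular_limit_def
  by (intro all_cong imp_cong refl Lim_cong_within) (auto simp: stolz_region_def)

lemma univalent_f: "univalent_on f (ball 0 1)"
  using f_hol f_inj by (simp add: univalent_on_def)

text \<open>The inverse \<open>g\<close> of \<open>f\<close> carries \<open>U_lim\<close> and
  \<open>V_lim\<close> over to \<open>G\<close>. Composing back with \<open>f\<close> recovers them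
  only in the open disc, which is all that angular limits see.\<close>

lemma nevanlinna_G: "nevanlinna_domain G"
proof -
  obtain g where g: "g holomorphic_on G" "\<And>z. z \<in> ball 0 1 \<Longrightarrow> g (f z) = z"
    using holomorphic_has_inverse[OF f_hol open_ball f_inj] by metis
  have gim: "g ` G \<subseteq> ball 0 1" using g(2) by auto
  have "homeomorphism (ball 0 1) G f g"
    using g f_hol by (auto simp: homeomorphism_def holomorphic_on_imp_continuous_on image_image)
  hence "ball (0::complex) 1 homeomorphic G" by (auto simp: homeomorphic_def)
  hence sc: "simply_connected G"
    by (rule homeomorphic_simply_connected) (simp add: convex_imp_simply_connected)
  have uH: "U_lim \<circ> g \<in> H_infinity G"
    unfolding H_infinity_def using g(2) U_lim_bounded
    by (auto intro!: holomorphic_on_compose_gen[OF g(1) U_lim_hol gim] boundedI[of _ 25])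
  have vH: "V_lim \<circ> g \<in> H_infinity G"
    unfolding H_infinity_def using g(2) V_lim_bounded
    by (auto intro!: holomorphic_on_compose_gen[OF g(1) V_lim_hol gim] boundedI[of _ 1])
  obtain z where z: "z \<in> ball 0 1" "V_lim z \<noteq> 0" using V_lim_nonzero by blast
  hence vn: "\<exists>w\<in>G. (V_lim \<circ> g) w \<noteq> 0" using g(2)[OF z(1)] by (intro bexI[of _ "f z"]) auto
  have pt: "\<exists>L U V. has_angular_limit f (cis t) L \<and> has_angular_limit (U_lim \<circ> g \<circ> f) (cis t) U \<and>
      has_angular_limit (V_lim \<circ> g \<circ> f) (cis t) V \<and> V \<noteq> 0 \<and> cnj L = U / V" if gt: "good (cis t)" for t
  proof (intro exI conjI)
    show "has_angular_limit f (cis t) (f (cis t))" by (rule continuous_imp_angular) (rule good_continuous[OF gt])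
    have "has_angular_limit U_lim (cis t) (U_lim (cis t))" by (rule continuous_imp_angular) (rule good_continuous[OF gt])
    thus "has_angular_limit (U_lim \<circ> g \<circ> f) (cis t) (U_lim (cis t))"
      by (subst has_angular_limit_cong[of _ U_lim]) (auto simp: g(2))
    have "has_angular_limit V_lim (cis t) (V_lim (cis t))" by (rule continuous_imp_angular) (rule good_continuous[OF gt])
    thus "has_angular_limit (V_lim \<circ> g \<circ> f) (cis t) (V_lim (cis t))"
      by (subst has_angular_limit_cong[of _ V_lim]) (auto simp: g(2))
    show "V_lim (cis t) \<noteq> 0" using good_values(1)[OF gt] by auto
    thus "cnj (f (cis t)) = U_lim (cis t) / V_lim (cis t)" using good_values(2)[OF gt] by simp
  qed
  have "AE t in lebesgue. t \<in> {0..<2 * pi} \<longrightarrow> good (cis t)" by (rule AE_completion[OF AE_good])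
  hence "AE t in lebesgue_on {0..<2 * pi}. good (cis t)" by (subst AE_restrict_space_iff) auto
  hence ae: "AE t in lebesgue_on {0..<2 * pi}. \<exists>L U V. has_angular_limit f (cis t) L \<and> has_angular_limit (U_lim \<circ> g \<circ> f) (cis t) U \<and>
      has_angular_limit (V_lim \<circ> g \<circ> f) (cis t) V \<and> V \<noteq> 0 \<and> cnj L = U / V"
    by eventually_elim (rule pt)
  have "conformal_map f (ball 0 1) G" using univalent_f by (simp add: conformal_map_def)
  with ae have "\<exists>g'. conformal_map g' (ball 0 1) G \<and> (AE t in lebesgue_on {0..<2 * pi}. \<exists>L U V. has_angular_limit g' (cis t) L \<and>
      has_angular_limit (U_lim \<circ> g \<circ> g') (cis t) U \<and> has_angular_limit (V_lim \<circ> g \<circ> g') (cis t) V \<and> V \<noteq> 0 \<and> cnj L = U / V)"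
    by (intro exI[of _ f] conjI)
  thus ?thesis unfolding nevanlinna_domain_def using G_open sc G_bounded uH vH vn
    by (intro conjI bexI[of _ "U_lim \<circ> g"] bexI[of _ "V_lim \<circ> g"]) auto
qed

end

section \<open>The Carleson condition\<close>

lemma pdist_sym: "pdist a b = pdist b a"
proof -
  have "cmod (1 - a * cnj b) = cmod (cnj (1 - a * cnj b))" by (rule complex_mod_cnj[symmetric])
  also have "\<dots> = cmod (1 - b * cnj a)" by (simp add: mult.commute)
  finally show ?thesis by (simp add: pdist_def norm_divide norm_minus_commute)
qed

lemma pdist_le1:
  assumes "cmod a < 1" "cmod b < 1" shows "pdist a b \<le> 1"
proof -
  have "(cmod (1 - a * cnj b))\<^sup>2 - (cmod (a - b))\<^sup>2 = (1 - (cmod a)\<^sup>2) * (1 - (cmod b)\<^sup>2)"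
    unfolding cmod_power2 by (simp add: power2_eq_square algebra_simps)
  moreover have "(cmod a)\<^sup>2 \<le> 1" "(cmod b)\<^sup>2 \<le> 1" using assms by (auto simp: power_le_one)
  hence "(1 - (cmod a)\<^sup>2) * (1 - (cmod b)\<^sup>2) \<ge> 0" by (intro mult_nonneg_nonneg) auto
  ultimately have "(cmod (a - b))\<^sup>2 \<le> (cmod (1 - a * cnj b))\<^sup>2" by linarith
  hence "cmod (a - b) \<le> cmod (1 - a * cnj b)" by (rule power2_le_imp_le) simp
  thus ?thesis by (simp add: pdist_def norm_divide divide_le_eq)
qed

context bump_chain
begin

abbreviation "poles n \<equiv> pole (\<zeta> n) (s n)"
abbreviation "weights n \<equiv> \<beta> n * of_real (s n / (1 + s n))"

lemma norm_a: "cmod (poles n) < 1" "1 - cmod (poles n) \<le> s n"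
  using norm_pole[OF par, of n] par(2)[of n] by (auto simp: field_simps)

lemma blaschke_a: "blaschke_sequence poles"
  unfolding blaschke_sequence_def
proof (intro conjI allI)
  show "summable (\<lambda>n. 1 - cmod (poles n))"
  proof (rule summable_comparison_test'[where N = 0])
    show "summable (\<lambda>n. (1/4) ^ n :: real)" by (rule summable_geometric) simp
    show "norm (1 - cmod (poles n)) \<le> (1/4) ^ n" for n
      using norm_a[of n] s_le4[of n] by (simp add: power_divide)
  qed
qed (rule norm_a)

lemma term_eq: "weights n / (1 - cnj (poles n) * z) = \<beta> n * bp n z"
proof -
  have p: "of_real (1 + s n) \<noteq> (0::complex)" using par(2)[of n] by (simp del: of_real_add)
  have "1 - cnj (poles n) * z = (of_real (s n) + 1 - cnj (\<zeta> n) * z) / of_real (1 + s n)"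
    using p by (simp add: pole_def field_simps)
  thus ?thesis using p by (simp add: bump_def of_real_divide del: of_real_add)
qed

lemma series_f: "sums_locally_uniformly_on (\<lambda>n z. weights n / (1 - cnj (poles n) * z)) f (ball 0 1)"
  unfolding sums_locally_uniformly_on_def term_eq
  using f_uniform_compact by (auto simp: bump_sum_def[abs_def])

text \<open>Each step controls its pole only against earlier ones; symmetry makes the larger index
  decisive.\<close>

lemma pdist_a: "k \<noteq> n \<Longrightarrow> 1 - pdist (poles n) (poles k) \<le> 1 / 8 ^ max n k"
proof -
  have *: "1 - pdist (poles n) (poles k) \<le> 1 / 8 ^ n" if "k < n" for n k
    using step[of n] that by (auto simp: step_ok_def)
  assume "k \<noteq> n"
  thus ?thesis using *[of k n] *[of n k] pdist_sym[of "poles n" "poles k"] by (cases "k < n") (auto simp: max_def)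
qed

text \<open>A product of factors \<open>1 - x k\<close> is at least 1 minus the sum of the
  \<open>x k\<close>, and that sum is at most 1/2 uniformly in \<open>n\<close>.\<close>

lemma carleson_a: "carleson_condition poles"
proof -
  have half: "(\<Prod>k. if k = n then 1 else pdist (poles n) (poles k)) \<ge> 1/2" for n
  proof -
    define x where "x k = (if k = n then 0 else 1 - pdist (poles n) (poles k))" for k
    have x0: "0 \<le> x k" "x k \<le> 1" for k
      using pdist_le1[OF norm_a(1) norm_a(1), of n k] by (auto simp: x_def pdist_def)
    \<comment> \<open>Off the diagonal the larger index is at least 1, so
      \<open>8 ^ m = 4 ^ m * 2 ^ m \<ge> 4 * 2 ^ k\<close>. The factor 1/4 keeps the geometric sum
      below 1/2.\<close>
    have xb: "x k \<le> 1/4 * (1/2) ^ k" for k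
    proof (cases "k = n")
      case False
      define m where "m = max n k"
      have m: "m \<ge> 1" "k \<le> m" using False by (auto simp: m_def)
      have "(4::real) ^ 1 \<le> 4 ^ m" using m by (intro power_increasing) auto
      hence "(4::real) * 2 ^ m \<le> 4 ^ m * 2 ^ m" by (intro mult_right_mono) auto
      also have "\<dots> = 8 ^ m" by (simp flip: power_mult_distrib)
      finally have "1 / 8 ^ m \<le> 1 / (4 * 2 ^ m :: real)" by (intro divide_left_mono) auto
      also have "\<dots> \<le> 1 / (4 * 2 ^ k)" using m by (intro divide_left_mono mult_left_mono power_increasing) auto
      finally show ?thesis using pdist_a[OF False] False by (simp add: x_def m_def power_divide)
    qed (simp add: x_def)
    have geo: "summable (\<lambda>k. 1/4 * (1/2) ^ k :: real)" by (intro summable_mult summable_geometric) simp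
    have sx: "summable x" by (rule summable_comparison_test'[OF geo, of 0]) (use xb x0 in auto)
    have fac: "(if k = n then 1 else pdist (poles n) (poles k)) = 1 - x k" for k by (simp add: x_def)
    have "abs_convergent_prod (\<lambda>k. 1 - x k)" using sx x0 by (simp add: abs_convergent_prod_conv_summable)
    hence "convergent_prod (\<lambda>k. 1 - x k)" by (rule abs_convergent_prod_imp_convergent_prod)
    hence lim: "(\<lambda>N. \<Prod>k\<le>N. 1 - x k) \<longlonglongrightarrow> (\<Prod>k. 1 - x k)" by (rule convergent_prod_LIMSEQ)
    have "(\<Prod>k\<le>N. 1 - x k) \<ge> 1/2" for N
    proof -
      have "(\<Sum>k\<le>N. x k) \<le> (\<Sum>k\<le>N. 1/4 * (1/2) ^ k)" by (intro sum_mono xb)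
      also have "\<dots> = 1/4 * (\<Sum>k<Suc N. (1/2) ^ k)" by (simp add: sum_distrib_left lessThan_Suc_atMost)
      also have "(\<Sum>k<Suc N. (1/2) ^ k :: real) \<le> 2" by (subst geometric_sum) auto
      finally have "(\<Sum>k\<le>N. x k) \<le> 1/2" by simp
      moreover have "1 - (\<Sum>k\<le>N. x k) \<le> (\<Prod>k\<le>N. 1 - x k)" using x0 by (intro Weierstrass_prod_ineq) auto
      ultimately show ?thesis by linarith
    qed
    hence "(\<Prod>k. 1 - x k) \<ge> 1/2" by (intro LIMSEQ_le_const[OF lim]) auto
    thus ?thesis by (simp only: fac)
  qed
  have "1/2 \<le> (INF n. \<Prod>k. if k = n then 1 else pdist (poles n) (poles k))" by (intro cINF_greatest half) auto
  thus ?thesis unfolding carleson_condition_def pdist_def[symmetric] by linarith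
qed

end

section \<open>Minkowski dimension of the accessible boundary\<close>

lemma accessible_subset: "accessible_boundary G \<subseteq> frontier G"
  by (auto simp: accessible_boundary_def)

lemma frontier_subset_closure_accessible:
  assumes "open G" shows "frontier G \<subseteq> closure (accessible_boundary G)"
proof
  fix x assume x: "x \<in> frontier G"
  show "x \<in> closure (accessible_boundary G)" unfolding closure_approachable
  proof (intro allI impI)
    fix e :: real assume e: "e > 0"
    have op: "openin (top_of_set (frontier G)) (frontier G \<inter> ball x e)" by (rule openin_open_Int) simp
    have ne: "frontier G \<inter> ball x e \<noteq> {}" using x e by auto
    obtain g where g: "arc g" "g ` {0..<1} \<subseteq> G" "pathfinish g \<in> frontier G \<inter> ball x e"
      using dense_accessible_frontier_points[OF assms op ne] by metis
    have "pathfinish g \<in> accessible_boundary G" using g arc_imp_path[of g] by (auto simp: accessible_boundary_def intro!: exI[of _ g])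
    thus "\<exists>y\<in>accessible_boundary G. dist y x < e" using g(3) by (auto simp: dist_commute)
  qed
qed

lemma squares_closed: "q \<in> squares s \<Longrightarrow> closed q"
  by (auto simp: squares_def intro!: compact_imp_closed compact_continuous_image continuous_intros)

text \<open>Enclosing the square in a disc about the image of its corner 0 treats all orientations
  alike; the constant only shifts the logarithm by a bounded amount.\<close>

lemma squares_emeasure:
  assumes "q \<in> squares s" "s \<ge> 0" shows "emeasure lborel q \<le> ennreal (4 * pi * s\<^sup>2)"
proof -
  obtain p \<omega> where q: "q = (\<lambda>z. p + \<omega> * z) ` cbox 0 (Complex s s)" "cmod \<omega> = 1"
    using assms(1) by (auto simp: squares_def)
  have "q \<subseteq> cball p (2 * s)"
  proof
    fix y assume "y \<in> q"
    then obtain z where z: "y = p + \<omega> * z" "z \<in> cbox 0 (Complex s s)" using q by auto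
    have "cmod z \<le> \<bar>Re z\<bar> + \<bar>Im z\<bar>" by (rule cmod_le)
    also have "\<dots> \<le> 2 * s" using z(2) by (auto simp: in_cbox_complex_iff)
    finally show "y \<in> cball p (2 * s)" using q(2) by (simp add: z(1) dist_norm norm_mult)
  qed
  hence "emeasure lborel q \<le> emeasure lborel (cball p (2 * s))" by (rule emeasure_mono) auto
  also have "\<dots> = ennreal (4 * pi * s\<^sup>2)"
    using emeasure_cball[of "2 * s" p] assms(2) by (simp add: unit_ball_vol_2 power_mult_distrib mult_ac)
  finally show ?thesis .
qed

lemma grid_cover:
  assumes "E \<subseteq> cball 0 (real B)"
  shows "\<exists>Q. finite Q \<and> card Q \<le> (2 * B * 2 ^ N + 1)\<^sup>2 \<and> Q \<subseteq> squares (1 / 2 ^ N) \<and> E \<subseteq> \<Union>Q"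
proof -
  define I where "I = {- int (B * 2 ^ N)..int (B * 2 ^ N)}"
  define sq where "sq = (\<lambda>(i, j). (\<lambda>z. Complex (of_int i / 2 ^ N) (of_int j / 2 ^ N) + 1 * z) ` cbox 0 (Complex (1 / 2 ^ N) (1 / 2 ^ N)))"
  have cI: "card I = 2 * B * 2 ^ N + 1" by (simp add: I_def nat_add_distrib nat_mult_distrib)
  have fl: "\<lfloor>x * 2 ^ N\<rfloor> \<in> I" if "\<bar>x\<bar> \<le> real B" for x :: real
  proof -
    have "\<bar>x * 2 ^ N\<bar> \<le> real B * 2 ^ N" using that by (simp add: abs_mult)
    hence "- (real B * 2 ^ N) \<le> x * 2 ^ N" "x * 2 ^ N \<le> real B * 2 ^ N" by linarith+
    hence "\<lfloor>- (real B * 2 ^ N)\<rfloor> \<le> \<lfloor>x * 2 ^ N\<rfloor>" "\<lfloor>x * 2 ^ N\<rfloor> \<le> \<lfloor>real B * 2 ^ N\<rfloor>" by (intro floor_mono; simp)+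
    moreover have "\<lfloor>real B * 2 ^ N\<rfloor> = int (B * 2 ^ N)" "\<lfloor>- (real B * 2 ^ N)\<rfloor> = - int (B * 2 ^ N)"
      using floor_of_int[of "int (B * 2 ^ N)"] floor_of_int[of "- int (B * 2 ^ N)"] by simp_all
    ultimately show ?thesis by (simp add: I_def)
  qed
  have "E \<subseteq> \<Union> (sq ` (I \<times> I))"
  proof
    fix x assume "x \<in> E"
    hence n: "cmod x \<le> real B" using assms by auto
    define i j where "i = \<lfloor>Re x * 2 ^ N\<rfloor>" "j = \<lfloor>Im x * 2 ^ N\<rfloor>"
    note ij = this
    have "i \<in> I" "j \<in> I" using fl n abs_Re_le_cmod[of x] abs_Im_le_cmod[of x] by (auto simp: ij)
    moreover have "x \<in> sq (i, j)"
    proof -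
      define z where "z = x - Complex (of_int i / 2 ^ N) (of_int j / 2 ^ N)"
      have fr: "of_int \<lfloor>y * 2 ^ N\<rfloor> / 2 ^ N \<le> y" "y \<le> (of_int \<lfloor>y * 2 ^ N\<rfloor> + 1) / 2 ^ N" for y :: real
        using of_int_floor_le[of "y * 2 ^ N"] real_of_int_floor_add_one_ge[of "y * 2 ^ N"]
        by (simp_all add: divide_le_eq le_divide_eq)
      have "z \<in> cbox 0 (Complex (1 / 2 ^ N) (1 / 2 ^ N))"
        using fr[of "Re x"] fr[of "Im x"] by (simp add: in_cbox_complex_iff z_def ij add_divide_distrib)
      thus ?thesis by (auto simp: sq_def z_def intro!: image_eqI[of _ _ z])
    qed
    ultimately show "x \<in> \<Union> (sq ` (I \<times> I))" by blast
  qed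
  moreover have "sq ` (I \<times> I) \<subseteq> squares (1 / 2 ^ N)"
  proof safe
    fix i j :: int
    show "sq (i, j) \<in> squares (1 / 2 ^ N)" unfolding squares_def mem_Collect_eq
      by (rule exI[of _ "Complex (of_int i / 2 ^ N) (of_int j / 2 ^ N)"], rule exI[of _ 1]) (simp add: sq_def)
  qed
  moreover have "card (sq ` (I \<times> I)) \<le> (2 * B * 2 ^ N + 1)\<^sup>2"
  proof -
    have "card (sq ` (I \<times> I)) \<le> card (I \<times> I)" by (rule card_image_le) (simp add: I_def)
    also have "\<dots> = (2 * B * 2 ^ N + 1)\<^sup>2" by (simp only: card_cartesian_product cI power2_eq_square)
    finally show ?thesis .
  qed
  ultimately show ?thesis by (intro exI[of _ "sq ` (I \<times> I)"]) (auto simp: I_def)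
qed

lemma minkowski_dim_accessible:
  assumes op: "open G" and bd: "bounded G" and pos: "emeasure lborel (frontier G) > 0"
  shows "has_minkowski_dim (accessible_boundary G) 2"
proof -
  let ?E = "accessible_boundary G"
  let ?m = "square_covering_number ?E"
  have fb: "bounded (frontier G)" 
    by (rule bounded_subset[OF bounded_closure[OF bd]]) (simp add: frontier_def)
  have Eb: "bounded ?E" using fb accessible_subset by (rule bounded_subset)
  have Ene: "?E \<noteq> {}"
  proof
    assume "?E = {}"
    hence "frontier G = {}" using frontier_subset_closure_accessible[OF op] by simp
    thus False using pos by simp
  qed
  obtain B' where B': "\<And>x. x \<in> ?E \<Longrightarrow> cmod x \<le> B'" using Eb unfolding bounded_iff by blast
  obtain B where "B' \<le> real B" using real_arch_simple by blast
  hence EB: "?E \<subseteq> cball 0 (real (Suc B))" using B' by force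
  define K where "K = (2 * real (Suc B) + 1)\<^sup>2"
  have K: "K > 0" by (simp add: K_def add_pos_pos)
  have fin: "emeasure lborel (frontier G) < \<infinity>" by (rule emeasure_bounded_finite[OF fb])
  define \<mu> where "\<mu> = enn2real (emeasure lborel (frontier G))"
  have mu: "\<mu> > 0" "emeasure lborel (frontier G) = ennreal \<mu>"
    using pos fin by (auto simp: \<mu>_def enn2real_positive_iff)
  have p4: "(2 ^ N)\<^sup>2 = (4::real) ^ N" for N :: nat
    using power_mult[of "2::real" N 2] power_mult[of "2::real" 2 N] by (simp add: mult.commute)
  have ex: "\<exists>Q. finite Q \<and> card Q = ?m N \<and> Q \<subseteq> squares (1 / 2 ^ N) \<and> ?E \<subseteq> \<Union>Q" for N
    unfolding square_covering_number_def by (rule LeastI_ex) (use grid_cover[OF EB, of N] in blast)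
  have up: "real (?m N) \<le> K * 4 ^ N" for N
  proof -
    obtain Q where Q: "finite Q" "card Q \<le> (2 * Suc B * 2 ^ N + 1)\<^sup>2" "Q \<subseteq> squares (1 / 2 ^ N)" "?E \<subseteq> \<Union>Q"
      using grid_cover[OF EB, of N] by blast
    have "?m N \<le> card Q" unfolding square_covering_number_def by (rule Least_le) (use Q in blast)
    hence "real (?m N) \<le> real ((2 * Suc B * 2 ^ N + 1)\<^sup>2)" using Q(2) by linarith
    also have "\<dots> = (2 * real (Suc B) * 2 ^ N + 1)\<^sup>2" by (simp add: algebra_simps)
    also have "\<dots> \<le> ((2 * real (Suc B) + 1) * 2 ^ N)\<^sup>2" by (intro power_mono) (simp_all add: algebra_simps)
    also have "\<dots> = K * 4 ^ N" by (simp only: K_def power_mult_distrib p4)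
    finally show ?thesis .
  qed
  have low: "real (?m N) \<ge> \<mu> / (4 * pi) * 4 ^ N" for N
  proof -
    obtain Q where Q: "finite Q" "card Q = ?m N" "Q \<subseteq> squares (1 / 2 ^ N)" "?E \<subseteq> \<Union>Q" 
      using ex[of N] by (elim exE conjE) (rule that)
    have cl: "closed q" if "q \<in> Q" for q using squares_closed Q(3) that by blast
    \<comment> \<open>A finite union of closed squares is closed, so a cover of the accessible
      points also covers the frontier and has at least its area.\<close>
    have "closure ?E \<subseteq> \<Union>Q" by (rule closure_minimal[OF Q(4)]) (use Q(1) cl in auto)
    hence "frontier G \<subseteq> (\<Union>q\<in>Q. q)" using frontier_subset_closure_accessible[OF op] by auto
    hence "ennreal \<mu> \<le> emeasure lborel (\<Union>q\<in>Q. q)" unfolding mu(2)[symmetric]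
      by (rule emeasure_mono) (use Q(1) cl in \<open>auto intro!: borel_closed\<close>)
    also have "\<dots> \<le> (\<Sum>q\<in>Q. emeasure lborel q)"
      using Q(1) cl by (intro emeasure_subadditive_finite) (auto intro!: borel_closed)
    also have "\<dots> \<le> (\<Sum>q\<in>Q. ennreal (4 * pi * (1 / 2 ^ N)\<^sup>2))" using Q(3) by (intro sum_mono squares_emeasure) auto
    also have "\<dots> = ennreal (\<Sum>q\<in>Q. 4 * pi * (1 / 2 ^ N)\<^sup>2)" by (rule sum_ennreal) simp
    finally have "\<mu> \<le> (\<Sum>q\<in>Q. 4 * pi * (1 / 2 ^ N)\<^sup>2)" by (subst (asm) ennreal_le_iff) (auto intro: sum_nonneg)
    also have "\<dots> = real (?m N) * (4 * pi) / 4 ^ N"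
      using Q(2) by (simp add: power_divide p4)
    finally show ?thesis by (simp add: field_simps)
  qed
  have lg: "log 2 (x * 4 ^ N) = log 2 x + 2 * real N" if "x > 0" for x :: real and N
  proof -
    have "log 2 (4 ^ N) = real N * log 2 4" by (simp add: log_nat_power)
    also have "log 2 (4::real) = 2" using log_nat_power[of 2 2 2] by simp
    finally show ?thesis using that by (simp add: log_mult)
  qed
  have mu4: "\<mu> / (4 * pi) > 0" using mu by simp
  have "(\<lambda>N. log 2 (real (?m N)) / real N) \<longlonglongrightarrow> 2"
  proof (rule tendsto_sandwich)
    show "(\<lambda>N. (log 2 (\<mu> / (4 * pi)) + 2 * real N) / real N) \<longlonglongrightarrow> 2" by real_asymp
    show "(\<lambda>N. (log 2 K + 2 * real N) / real N) \<longlonglongrightarrow> 2" by real_asymp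
    show "\<forall>\<^sub>F N in sequentially. (log 2 (\<mu> / (4 * pi)) + 2 * real N) / real N \<le> log 2 (real (?m N)) / real N"
    proof (intro always_eventually allI divide_right_mono)
      fix N
      have "0 < \<mu> / (4 * pi) * 4 ^ N" by (intro mult_pos_pos mu4) simp
      hence "log 2 (\<mu> / (4 * pi) * 4 ^ N) \<le> log 2 (real (?m N))" using low[of N] by (subst log_le_cancel_iff) auto
      thus "log 2 (\<mu> / (4 * pi)) + 2 * real N \<le> log 2 (real (?m N))" unfolding lg[OF mu4] .
    qed simp
    show "\<forall>\<^sub>F N in sequentially. log 2 (real (?m N)) / real N \<le> (log 2 K + 2 * real N) / real N"
    proof (intro always_eventually allI divide_right_mono)
      fix N
      have "0 < \<mu> / (4 * pi) * 4 ^ N" by (intro mult_pos_pos mu4) simp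
      hence "0 < real (?m N)" using low[of N] by linarith
      hence "log 2 (real (?m N)) \<le> log 2 (K * 4 ^ N)" using up[of N] K by (subst log_le_cancel_iff) auto
      thus "log 2 (real (?m N)) \<le> log 2 K + 2 * real N" unfolding lg[OF K] .
    qed simp
  qed
  thus ?thesis using Eb Ene by (simp add: has_minkowski_dim_def)
qed

section \<open>Choice of a countable dense set of targets and assembly of the example\<close>

theorem theorem5:
  shows "\<exists>(f :: complex \<Rightarrow> complex) (a :: nat \<Rightarrow> complex) (c :: nat \<Rightarrow> complex).
    blaschke_sequence a \<and>
    carleson_condition a \<and>
    sums_locally_uniformly_on (\<lambda>n z. c n / (1 - cnj (a n) * z)) f (ball 0 1) \<and>
    univalent_on f (ball 0 1) \<and>
    nevanlinna_domain (f ` ball 0 1) \<and>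
    emeasure lborel (frontier (f ` ball 0 1)) > 0 \<and>
    has_minkowski_dim (accessible_boundary (f ` ball 0 1)) 2"
proof -
  obtain T :: "complex set" where T: "countable T" "T \<subseteq> cball 0 10" "cball 0 10 \<subseteq> closure T"
    by (rule separable)
  have "T \<noteq> {}" using T(3) by auto
  hence rg: "range (from_nat_into T) = T" using T(1) by (rule range_from_nat_into)
  let ?w = "\<lambda>n. from_nat_into T (multiplicity 2 (n + 1))"
  obtain \<zeta> \<beta> :: "nat \<Rightarrow> complex" and s :: "nat \<Rightarrow> real"
    where st: "\<And>n. step_ok ?w \<zeta> \<beta> s n (\<zeta> n) (\<beta> n) (s n)"
    using sequence_exists[of ?w] by blast
  interpret bump_filling ?w \<zeta> \<beta> s "from_nat_into T"
    by unfold_locales (use st rg T in auto)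
  show ?thesis
    using blaschke_a carleson_a series_f univalent_f nevanlinna_G frontier_positive
      minkowski_dim_accessible[OF G_open G_bounded frontier_positive]
    by (rule_tac exI[of _ f], rule_tac exI[of _ poles], rule_tac exI[of _ weights]) (intro conjI)
qed

end
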